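(* Let $\mathcal{C}$ be a $\mathbb{C}$-linear abelian symmetric rigid tensor category with unit object $\mathbf{1}$ such that $\mathrm{End}(\mathbf{1})=\mathbb{C}$, and suppose that $\mathcal{C}$ has finitely many irreducible objects (up to isomorphism). Then for every object $V$ of $\mathcal{C}$, the categorical dimension $\dim_c(V)\in\mathbb{C}$ is an integer.
   Context: Let $\beta$ denote the commutativity constraint of $\mathcal{C}$. The categorical dimension $\dim_c(V)\in\mathrm{End}(\mathbf{1})=\mathbb{C}$ of an object $V$ is the composition $$\mathbf{1}\longrightarrow V\otimes V^*\xrightarrow{\ \beta_{V,V^*}\ }V^*\otimes V\longrightarrow\mathbf{1},$$ where $V^*$ is the dual object of $V$ and the first and last arrows are the canonical structure morphisms of the duality (the standard maps $\mathbf{1}\to V\otimes V^*$ and $V^*\otimes V\to\mathbf{1}$).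
   Formalization: "Tensor category" is taken to include that every object has finite length; without this the claim fails, e.g. in a nonprincipal ultrapower of finite-dimensional complex vector spaces, where 1 is the only irreducible object but some dimensions are not integers. *)

theory Defs
  imports Complex_Main
begin

section \<open>Categories\<close>

record ('o, 'a) cat =
  Ob :: "'o set"
  Ar :: "'a set"
  src :: "'a \<Rightarrow> 'o"
  tgt :: "'a \<Rightarrow> 'o"
  ident :: "'o \<Rightarrow> 'a" ("\<iota>\<index>")
  cmp :: "'a \<Rightarrow> 'a \<Rightarrow> 'a" (infixr "\<cdot>\<index>" 55)

definition hom :: "('o, 'a, 'z) cat_scheme \<Rightarrow> 'o \<Rightarrow> 'o \<Rightarrow> 'a set" where
  "hom C X Y = {f \<in> Ar C. src C f = X \<and> tgt C f = Y}"

locale category =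
  fixes C :: "('o, 'a, 'z) cat_scheme" (structure)
  assumes src_Ob: "f \<in> Ar C \<Longrightarrow> src C f \<in> Ob C"
    and tgt_Ob: "f \<in> Ar C \<Longrightarrow> tgt C f \<in> Ob C"
    and ident_hom: "X \<in> Ob C \<Longrightarrow> \<iota> X \<in> hom C X X"
    and cmp_hom: "f \<in> hom C X Y \<Longrightarrow> g \<in> hom C Y Z \<Longrightarrow> g \<cdot> f \<in> hom C X Z"
    and cmp_ident_right: "f \<in> hom C X Y \<Longrightarrow> f \<cdot> \<iota> X = f"
    and cmp_ident_left: "f \<in> hom C X Y \<Longrightarrow> \<iota> Y \<cdot> f = f"
    and cmp_assoc:
      "f \<in> hom C W X \<Longrightarrow> g \<in> hom C X Y \<Longrightarrow> h \<in> hom C Y Z \<Longrightarrow> (h \<cdot> g) \<cdot> f = h \<cdot> (g \<cdot> f)"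

definition inverse_pair :: "('o, 'a, 'z) cat_scheme \<Rightarrow> 'a \<Rightarrow> 'a \<Rightarrow> bool" where
  "inverse_pair C f g \<longleftrightarrow> f \<in> Ar C \<and> g \<in> hom C (tgt C f) (src C f) \<and>
     g \<cdot>\<^bsub>C\<^esub> f = \<iota>\<^bsub>C\<^esub> (src C f) \<and> f \<cdot>\<^bsub>C\<^esub> g = \<iota>\<^bsub>C\<^esub> (tgt C f)"

definition iso_arr :: "('o, 'a, 'z) cat_scheme \<Rightarrow> 'a \<Rightarrow> bool" where
  "iso_arr C f \<longleftrightarrow> (\<exists>g. inverse_pair C f g)"

definition inv_arr :: "('o, 'a, 'z) cat_scheme \<Rightarrow> 'a \<Rightarrow> 'a" where
  "inv_arr C f = (THE g. inverse_pair C f g)"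

definition isomorphic :: "('o, 'a, 'z) cat_scheme \<Rightarrow> 'o \<Rightarrow> 'o \<Rightarrow> bool" where
  "isomorphic C X Y \<longleftrightarrow> (\<exists>f \<in> hom C X Y. iso_arr C f)"

definition mono_arr :: "('o, 'a, 'z) cat_scheme \<Rightarrow> 'a \<Rightarrow> bool" where
  "mono_arr C f \<longleftrightarrow> f \<in> Ar C \<and>
     (\<forall>W. \<forall>g \<in> hom C W (src C f). \<forall>h \<in> hom C W (src C f). f \<cdot>\<^bsub>C\<^esub> g = f \<cdot>\<^bsub>C\<^esub> h \<longrightarrow> g = h)"

definition epi_arr :: "('o, 'a, 'z) cat_scheme \<Rightarrow> 'a \<Rightarrow> bool" where
  "epi_arr C f \<longleftrightarrow> f \<in> Ar C \<and>
     (\<forall>Z. \<forall>g \<in> hom C (tgt C f) Z. \<forall>h \<in> hom C (tgt C f) Z. g \<cdot>\<^bsub>C\<^esub> f = h \<cdot>\<^bsub>C\<^esub> f \<longrightarrow> g = h)"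

definition zero_object :: "('o, 'a, 'z) cat_scheme \<Rightarrow> 'o \<Rightarrow> bool" where
  "zero_object C Z \<longleftrightarrow> Z \<in> Ob C \<and>
     (\<forall>X \<in> Ob C. (\<exists>!f. f \<in> hom C X Z) \<and> (\<exists>!f. f \<in> hom C Z X))"

text \<open>Irreducible (simple) objects: nonzero objects all of whose subobjects are zero or everything.\<close>

definition irreducible_object :: "('o, 'a, 'z) cat_scheme \<Rightarrow> 'o \<Rightarrow> bool" where
  "irreducible_object C S \<longleftrightarrow> S \<in> Ob C \<and> \<not> zero_object C S \<and>
     (\<forall>i. mono_arr C i \<and> tgt C i = S \<longrightarrow> zero_object C (src C i) \<or> iso_arr C i)"

definition finitely_many_irreducibles :: "('o, 'a, 'z) cat_scheme \<Rightarrow> bool" where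
  "finitely_many_irreducibles C \<longleftrightarrow>
     (\<exists>F. finite F \<and> (\<forall>S. irreducible_object C S \<longrightarrow> (\<exists>T \<in> F. isomorphic C S T)))"


section \<open>Complex-linear abelian categories\<close>

text \<open>\<open>add\<close> is only meaningful on parallel arrows; \<open>zer X Y\<close> is the zero arrow from \<open>X\<close> to \<open>Y\<close>.\<close>

record ('o, 'a) lin_cat = "('o, 'a) cat" +
  zer :: "'o \<Rightarrow> 'o \<Rightarrow> 'a" ("\<zero>\<index>")
  add :: "'a \<Rightarrow> 'a \<Rightarrow> 'a" (infixl "\<oplus>\<index>" 65)
  scale :: "complex \<Rightarrow> 'a \<Rightarrow> 'a" (infixr "\<odot>\<index>" 75)

locale linear_category = category C
  for C :: "('o, 'a, 'z) lin_cat_scheme" (structure) +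
  assumes zer_hom: "X \<in> Ob C \<Longrightarrow> Y \<in> Ob C \<Longrightarrow> \<zero> X Y \<in> hom C X Y"
    and add_hom: "f \<in> hom C X Y \<Longrightarrow> g \<in> hom C X Y \<Longrightarrow> f \<oplus> g \<in> hom C X Y"
    and scale_hom: "f \<in> hom C X Y \<Longrightarrow> c \<odot> f \<in> hom C X Y"
    and add_assoc: "f \<in> hom C X Y \<Longrightarrow> g \<in> hom C X Y \<Longrightarrow> h \<in> hom C X Y \<Longrightarrow>
          (f \<oplus> g) \<oplus> h = f \<oplus> (g \<oplus> h)"
    and add_commute: "f \<in> hom C X Y \<Longrightarrow> g \<in> hom C X Y \<Longrightarrow> f \<oplus> g = g \<oplus> f"
    and add_zer: "f \<in> hom C X Y \<Longrightarrow> f \<oplus> \<zero> X Y = f"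
    and add_neg: "f \<in> hom C X Y \<Longrightarrow> \<exists>g \<in> hom C X Y. f \<oplus> g = \<zero> X Y"
    and scale_one: "f \<in> hom C X Y \<Longrightarrow> 1 \<odot> f = f"
    and scale_scale: "f \<in> hom C X Y \<Longrightarrow> c \<odot> (d \<odot> f) = (c * d) \<odot> f"
    and scale_add_left: "f \<in> hom C X Y \<Longrightarrow> (c + d) \<odot> f = (c \<odot> f) \<oplus> (d \<odot> f)"
    and scale_add_right: "f \<in> hom C X Y \<Longrightarrow> g \<in> hom C X Y \<Longrightarrow>
          c \<odot> (f \<oplus> g) = (c \<odot> f) \<oplus> (c \<odot> g)"
    and cmp_add_left: "f \<in> hom C X Y \<Longrightarrow> g \<in> hom C Y Z \<Longrightarrow> h \<in> hom C Y Z \<Longrightarrow>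
          (g \<oplus> h) \<cdot> f = (g \<cdot> f) \<oplus> (h \<cdot> f)"
    and cmp_add_right: "f \<in> hom C X Y \<Longrightarrow> g \<in> hom C X Y \<Longrightarrow> h \<in> hom C Y Z \<Longrightarrow>
          h \<cdot> (f \<oplus> g) = (h \<cdot> f) \<oplus> (h \<cdot> g)"
    and cmp_scale_left: "f \<in> hom C X Y \<Longrightarrow> g \<in> hom C Y Z \<Longrightarrow> (c \<odot> g) \<cdot> f = c \<odot> (g \<cdot> f)"
    and cmp_scale_right: "f \<in> hom C X Y \<Longrightarrow> g \<in> hom C Y Z \<Longrightarrow> g \<cdot> (c \<odot> f) = c \<odot> (g \<cdot> f)"

definition is_kernel :: "('o, 'a, 'z) lin_cat_scheme \<Rightarrow> 'a \<Rightarrow> 'a \<Rightarrow> bool" where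
  "is_kernel C f k \<longleftrightarrow> f \<in> Ar C \<and> k \<in> Ar C \<and> tgt C k = src C f \<and>
     f \<cdot>\<^bsub>C\<^esub> k = \<zero>\<^bsub>C\<^esub> (src C k) (tgt C f) \<and>
     (\<forall>W. \<forall>g \<in> hom C W (src C f). f \<cdot>\<^bsub>C\<^esub> g = \<zero>\<^bsub>C\<^esub> W (tgt C f) \<longrightarrow>
        (\<exists>!u. u \<in> hom C W (src C k) \<and> k \<cdot>\<^bsub>C\<^esub> u = g))"

definition is_cokernel :: "('o, 'a, 'z) lin_cat_scheme \<Rightarrow> 'a \<Rightarrow> 'a \<Rightarrow> bool" where
  "is_cokernel C f q \<longleftrightarrow> f \<in> Ar C \<and> q \<in> Ar C \<and> src C q = tgt C f \<and>
     q \<cdot>\<^bsub>C\<^esub> f = \<zero>\<^bsub>C\<^esub> (src C f) (tgt C q) \<and>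
     (\<forall>Z. \<forall>g \<in> hom C (tgt C f) Z. g \<cdot>\<^bsub>C\<^esub> f = \<zero>\<^bsub>C\<^esub> (src C f) Z \<longrightarrow>
        (\<exists>!u. u \<in> hom C (tgt C q) Z \<and> u \<cdot>\<^bsub>C\<^esub> q = g))"

definition is_biproduct :: "('o, 'a, 'z) lin_cat_scheme \<Rightarrow> 'o \<Rightarrow> 'o \<Rightarrow> 'o \<Rightarrow> bool" where
  "is_biproduct C X Y B \<longleftrightarrow>
     (\<exists>i \<in> hom C X B. \<exists>j \<in> hom C Y B. \<exists>p \<in> hom C B X. \<exists>q \<in> hom C B Y.
        p \<cdot>\<^bsub>C\<^esub> i = \<iota>\<^bsub>C\<^esub> X \<and> q \<cdot>\<^bsub>C\<^esub> j = \<iota>\<^bsub>C\<^esub> Y \<and>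
        q \<cdot>\<^bsub>C\<^esub> i = \<zero>\<^bsub>C\<^esub> X Y \<and> p \<cdot>\<^bsub>C\<^esub> j = \<zero>\<^bsub>C\<^esub> Y X \<and>
        (i \<cdot>\<^bsub>C\<^esub> p) \<oplus>\<^bsub>C\<^esub> (j \<cdot>\<^bsub>C\<^esub> q) = \<iota>\<^bsub>C\<^esub> B)"

locale abelian_category = linear_category C
  for C :: "('o, 'a, 'z) lin_cat_scheme" (structure) +
  assumes ex_zero_object: "\<exists>Z. zero_object C Z"
    and ex_biproduct: "X \<in> Ob C \<Longrightarrow> Y \<in> Ob C \<Longrightarrow> \<exists>B \<in> Ob C. is_biproduct C X Y B"
    and ex_kernel: "f \<in> Ar C \<Longrightarrow> \<exists>k. is_kernel C f k"
    and ex_cokernel: "f \<in> Ar C \<Longrightarrow> \<exists>q. is_cokernel C f q"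
    and mono_is_kernel: "mono_arr C k \<Longrightarrow> \<exists>f. is_kernel C f k"
    and epi_is_cokernel: "epi_arr C q \<Longrightarrow> \<exists>f. is_cokernel C f q"

text \<open>Existence of a composition series: \<open>X\<close> is reached from a zero object by finitely many
  extensions \<open>0 \<rightarrow> Y \<rightarrow> X \<rightarrow> S \<rightarrow> 0\<close> with \<open>S\<close> irreducible.\<close>

inductive finite_length :: "('o, 'a, 'z) lin_cat_scheme \<Rightarrow> 'o \<Rightarrow> bool"
  for C :: "('o, 'a, 'z) lin_cat_scheme" where
  zero: "zero_object C Z \<Longrightarrow> finite_length C Z"
| step: "finite_length C Y \<Longrightarrow> i \<in> hom C Y X \<Longrightarrow> mono_arr C i \<Longrightarrow> q \<in> hom C X S \<Longrightarrow>
     is_cokernel C i q \<Longrightarrow> irreducible_object C S \<Longrightarrow> finite_length C X"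


section \<open>Symmetric rigid tensor categories\<close>

text \<open>
  \<open>ten\<close> and \<open>tenA\<close> are the tensor product on objects and on arrows;
  \<open>asc X Y Z : (X \<otimes> Y) \<otimes> Z \<rightarrow> X \<otimes> (Y \<otimes> Z)\<close>, \<open>lun X : \<one> \<otimes> X \<rightarrow> X\<close> and \<open>run X : X \<otimes> \<one> \<rightarrow> X\<close>
  are the associativity and unit constraints, \<open>bra X Y : X \<otimes> Y \<rightarrow> Y \<otimes> X\<close> is the commutativity
  constraint, and \<open>coev V : \<one> \<rightarrow> V \<otimes> V*\<close>, \<open>ev V : V* \<otimes> V \<rightarrow> \<one>\<close> exhibit \<open>V* = dua V\<close>
  as the dual of \<open>V\<close>.
\<close>

record ('o, 'a) ten_cat = "('o, 'a) lin_cat" +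
  unt :: 'o ("\<one>\<index>")
  ten :: "'o \<Rightarrow> 'o \<Rightarrow> 'o" (infixr "\<otimes>\<index>" 70)
  tenA :: "'a \<Rightarrow> 'a \<Rightarrow> 'a" (infixr "\<boxtimes>\<index>" 70)
  asc :: "'o \<Rightarrow> 'o \<Rightarrow> 'o \<Rightarrow> 'a" ("\<alpha>\<index>")
  lun :: "'o \<Rightarrow> 'a"
  run :: "'o \<Rightarrow> 'a"
  bra :: "'o \<Rightarrow> 'o \<Rightarrow> 'a" ("\<beta>\<index>")
  dua :: "'o \<Rightarrow> 'o"
  coev :: "'o \<Rightarrow> 'a"
  ev :: "'o \<Rightarrow> 'a"

locale linear_monoidal_category = linear_category C
  for C :: "('o, 'a, 'z) ten_cat_scheme" (structure) +
  assumes unt_Ob: "\<one> \<in> Ob C"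
    and ten_Ob: "X \<in> Ob C \<Longrightarrow> Y \<in> Ob C \<Longrightarrow> X \<otimes> Y \<in> Ob C"
    and tenA_hom: "f \<in> hom C X X' \<Longrightarrow> g \<in> hom C Y Y' \<Longrightarrow> f \<boxtimes> g \<in> hom C (X \<otimes> Y) (X' \<otimes> Y')"
    and tenA_ident: "X \<in> Ob C \<Longrightarrow> Y \<in> Ob C \<Longrightarrow> \<iota> X \<boxtimes> \<iota> Y = \<iota> (X \<otimes> Y)"
    and tenA_cmp: "f \<in> hom C X X' \<Longrightarrow> f' \<in> hom C X' X'' \<Longrightarrow>
          g \<in> hom C Y Y' \<Longrightarrow> g' \<in> hom C Y' Y'' \<Longrightarrow>
          (f' \<cdot> f) \<boxtimes> (g' \<cdot> g) = (f' \<boxtimes> g') \<cdot> (f \<boxtimes> g)"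
    and tenA_add_left: "f \<in> hom C X X' \<Longrightarrow> f' \<in> hom C X X' \<Longrightarrow> g \<in> hom C Y Y' \<Longrightarrow>
          (f \<oplus> f') \<boxtimes> g = (f \<boxtimes> g) \<oplus> (f' \<boxtimes> g)"
    and tenA_add_right: "f \<in> hom C X X' \<Longrightarrow> g \<in> hom C Y Y' \<Longrightarrow> g' \<in> hom C Y Y' \<Longrightarrow>
          f \<boxtimes> (g \<oplus> g') = (f \<boxtimes> g) \<oplus> (f \<boxtimes> g')"
    and tenA_scale_left: "f \<in> hom C X X' \<Longrightarrow> g \<in> hom C Y Y' \<Longrightarrow>
          (c \<odot> f) \<boxtimes> g = c \<odot> (f \<boxtimes> g)"
    and tenA_scale_right: "f \<in> hom C X X' \<Longrightarrow> g \<in> hom C Y Y' \<Longrightarrow>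
          f \<boxtimes> (c \<odot> g) = c \<odot> (f \<boxtimes> g)"
    and asc_hom: "X \<in> Ob C \<Longrightarrow> Y \<in> Ob C \<Longrightarrow> Z \<in> Ob C \<Longrightarrow>
          \<alpha> X Y Z \<in> hom C ((X \<otimes> Y) \<otimes> Z) (X \<otimes> (Y \<otimes> Z))"
    and asc_iso: "X \<in> Ob C \<Longrightarrow> Y \<in> Ob C \<Longrightarrow> Z \<in> Ob C \<Longrightarrow> iso_arr C (\<alpha> X Y Z)"
    and asc_natural: "f \<in> hom C X X' \<Longrightarrow> g \<in> hom C Y Y' \<Longrightarrow> h \<in> hom C Z Z' \<Longrightarrow>
          \<alpha> X' Y' Z' \<cdot> ((f \<boxtimes> g) \<boxtimes> h) = (f \<boxtimes> (g \<boxtimes> h)) \<cdot> \<alpha> X Y Z"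
    and lun_hom: "X \<in> Ob C \<Longrightarrow> lun C X \<in> hom C (\<one> \<otimes> X) X"
    and lun_iso: "X \<in> Ob C \<Longrightarrow> iso_arr C (lun C X)"
    and lun_natural: "f \<in> hom C X Y \<Longrightarrow> lun C Y \<cdot> (\<iota> \<one> \<boxtimes> f) = f \<cdot> lun C X"
    and run_hom: "X \<in> Ob C \<Longrightarrow> run C X \<in> hom C (X \<otimes> \<one>) X"
    and run_iso: "X \<in> Ob C \<Longrightarrow> iso_arr C (run C X)"
    and run_natural: "f \<in> hom C X Y \<Longrightarrow> run C Y \<cdot> (f \<boxtimes> \<iota> \<one>) = f \<cdot> run C X"
    and pentagon: "W \<in> Ob C \<Longrightarrow> X \<in> Ob C \<Longrightarrow> Y \<in> Ob C \<Longrightarrow> Z \<in> Ob C \<Longrightarrow>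
          (\<iota> W \<boxtimes> \<alpha> X Y Z) \<cdot> \<alpha> W (X \<otimes> Y) Z \<cdot> (\<alpha> W X Y \<boxtimes> \<iota> Z) =
          \<alpha> W X (Y \<otimes> Z) \<cdot> \<alpha> (W \<otimes> X) Y Z"
    and triangle: "X \<in> Ob C \<Longrightarrow> Y \<in> Ob C \<Longrightarrow>
          (\<iota> X \<boxtimes> lun C Y) \<cdot> \<alpha> X \<one> Y = run C X \<boxtimes> \<iota> Y"

locale symmetric_monoidal_category = linear_monoidal_category C
  for C :: "('o, 'a, 'z) ten_cat_scheme" (structure) +
  assumes bra_hom: "X \<in> Ob C \<Longrightarrow> Y \<in> Ob C \<Longrightarrow> \<beta> X Y \<in> hom C (X \<otimes> Y) (Y \<otimes> X)"
    and bra_natural: "f \<in> hom C X X' \<Longrightarrow> g \<in> hom C Y Y' \<Longrightarrow>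
          \<beta> X' Y' \<cdot> (f \<boxtimes> g) = (g \<boxtimes> f) \<cdot> \<beta> X Y"
    and bra_symmetric: "X \<in> Ob C \<Longrightarrow> Y \<in> Ob C \<Longrightarrow> \<beta> Y X \<cdot> \<beta> X Y = \<iota> (X \<otimes> Y)"
    and hexagon: "X \<in> Ob C \<Longrightarrow> Y \<in> Ob C \<Longrightarrow> Z \<in> Ob C \<Longrightarrow>
          \<alpha> Y Z X \<cdot> \<beta> X (Y \<otimes> Z) \<cdot> \<alpha> X Y Z =
          (\<iota> Y \<boxtimes> \<beta> X Z) \<cdot> \<alpha> Y X Z \<cdot> (\<beta> X Y \<boxtimes> \<iota> Z)"

text \<open>
  The two duality axioms say that \<open>V \<rightarrow> (V \<otimes> V*) \<otimes> V \<rightarrow> V \<otimes> (V* \<otimes> V) \<rightarrow> V\<close> and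
  \<open>V* \<rightarrow> V* \<otimes> (V \<otimes> V*) \<rightarrow> (V* \<otimes> V) \<otimes> V* \<rightarrow> V*\<close> are identities, with the unit constraint at the
  source moved to the right-hand side. By symmetry one-sided duals are two-sided.
\<close>

locale rigid_symmetric_category = symmetric_monoidal_category C
  for C :: "('o, 'a, 'z) ten_cat_scheme" (structure) +
  assumes dua_Ob: "V \<in> Ob C \<Longrightarrow> dua C V \<in> Ob C"
    and coev_hom: "V \<in> Ob C \<Longrightarrow> coev C V \<in> hom C \<one> (V \<otimes> dua C V)"
    and ev_hom: "V \<in> Ob C \<Longrightarrow> ev C V \<in> hom C (dua C V \<otimes> V) \<one>"
    and duality_left: "V \<in> Ob C \<Longrightarrow>
          run C V \<cdot> (\<iota> V \<boxtimes> ev C V) \<cdot> \<alpha> V (dua C V) V \<cdot> (coev C V \<boxtimes> \<iota> V) = lun C V"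
    and duality_right: "V \<in> Ob C \<Longrightarrow>
          lun C (dua C V) \<cdot> (ev C V \<boxtimes> \<iota> (dua C V)) \<cdot> inv_arr C (\<alpha> (dua C V) V (dua C V)) \<cdot>
            (\<iota> (dua C V) \<boxtimes> coev C V) = run C (dua C V)"

text \<open>
  As usual for tensor categories, objects have finite length. This does not follow from the other
  axioms: in an ultrapower of the category of finite-dimensional complex vector spaces, which is
  linear over a field isomorphic to \<open>\<complex>\<close>, the unit is the only irreducible object, but there are
  objects of non-standard, hence non-integral, dimension.
\<close>

locale symmetric_tensor_category = abelian_category C + rigid_symmetric_category C
  for C :: "('o, 'a, 'z) ten_cat_scheme" (structure) +
  assumes objects_finite_length: "X \<in> Ob C \<Longrightarrow> finite_length C X"

text \<open>The scalar is well defined only if \<open>c \<mapsto> c \<odot> \<iota> \<one>\<close> is a bijection onto the endomorphisms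
  of the unit object.\<close>

definition cat_dim :: "('o, 'a, 'z) ten_cat_scheme \<Rightarrow> 'o \<Rightarrow> complex" where
  "cat_dim C V =
     (THE c. ev C V \<cdot>\<^bsub>C\<^esub> \<beta>\<^bsub>C\<^esub> V (dua C V) \<cdot>\<^bsub>C\<^esub> coev C V = c \<odot>\<^bsub>C\<^esub> \<iota>\<^bsub>C\<^esub> \<one>\<^bsub>C\<^esub>)"

end

theory Submission
  imports Defs
begin

text \<open>
  The dimension is additive on short exact sequences, so by finite length all dimensions lie in the
  subgroup of \<open>\<complex>\<close> generated by the dimensions of the finitely many irreducible objects. If \<open>V\<close> has
  dimension \<open>d\<close>, its exterior and symmetric powers have dimensions \<open>binom(d, n)\<close> and
  \<open>(-1)^n binom(-d, n)\<close>, so these numbers all lie in one finitely generated group.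
  This forces \<open>d\<close> to be an integer: \<open>x\<^sub>n = binom(d, n) binom(-d, n)\<close> satisfies
  \<open>(n + 1)^2 x\<^sub>n\<^sub>+\<^sub>1 = (n^2 - d^2) x\<^sub>n\<close>, so its coordinates with respect to a \<open>\<rat>\<close>-basis tend to
  \<open>0\<close> while having bounded denominators, and hence \<open>x\<^sub>n = 0\<close> for some \<open>n\<close>.
  Computations with duals and braidings are carried out in a strict category equivalent to the given one.
\<close>

section \<open>Integrality from binomial coefficients\<close>

text \<open>One binomial sequence alone would not do: in binom(d, n + 1) / binom(d, n) = (d - n) /
  (n + 1) the number d enters at relative order 1/n, and such factors give only polynomial bounds.
  In the product with binom(-d, n) the linear terms cancel, d enters as d^2 at relative order 1/n^2,
  and the decay of (n / (n + 1))^2 survives. Limits are taken in coordinates because a finitely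
  generated subgroup of \<complex> may be dense, while coordinate vectors with bounded denominators
  are discrete. The price is that d^2 acts as a linear operator on a rational vector space; its
  boundedness rests on \<rat>[d] being finite-dimensional, which the binomial coefficients
  themselves provide. Exact sequences need not split, so additivity of the dimension cannot be read
  off from biproducts; instead the traces are compared on a kernel inside
  \<open>X \<star> X'\<close>. Exterior and symmetric powers are obtained as images of idempotents,
  whose traces are computed by closing one tensor factor at a time.\<close>

definition int_span :: "complex set \<Rightarrow> complex set" where
  "int_span G = {x. \<exists>k :: complex \<Rightarrow> int. x = (\<Sum>g\<in>G. of_int (k g) * g)}"

lemma int_span_add: "x \<in> int_span G \<Longrightarrow> y \<in> int_span G \<Longrightarrow> x + y \<in> int_span G"
proof -
  assume "x \<in> int_span G" "y \<in> int_span G"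
  then obtain k l :: "complex \<Rightarrow> int" where "x = (\<Sum>g\<in>G. of_int (k g) * g)" "y = (\<Sum>g\<in>G. of_int (l g) * g)"
    by (auto simp: int_span_def)
  then have "x + y = (\<Sum>g\<in>G. of_int (k g + l g) * g)" by (simp add: sum.distrib algebra_simps)
  then show ?thesis unfolding int_span_def mem_Collect_eq by (intro exI[of _ "\<lambda>g. k g + l g"])
qed

lemma int_span_scale: "x \<in> int_span G \<Longrightarrow> of_int m * x \<in> int_span G"
proof -
  assume "x \<in> int_span G"
  then obtain k :: "complex \<Rightarrow> int" where "x = (\<Sum>g\<in>G. of_int (k g) * g)"
    by (auto simp: int_span_def)
  then have "of_int m * x = (\<Sum>g\<in>G. of_int (m * k g) * g)" by (simp add: sum_distrib_left mult.assoc)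
  then show ?thesis unfolding int_span_def mem_Collect_eq by (intro exI[of _ "\<lambda>g. m * k g"])
qed

lemma int_span_0: "0 \<in> int_span G"
  unfolding int_span_def by (auto intro!: exI[of _ "\<lambda>_. 0"])

lemma int_span_sum: "(\<And>i. i \<in> I \<Longrightarrow> f i \<in> int_span G) \<Longrightarrow> sum f I \<in> int_span G"
  by (induction I rule: infinite_finite_induct) (auto intro: int_span_add int_span_0)

lemma int_span_base: "finite G \<Longrightarrow> g \<in> G \<Longrightarrow> g \<in> int_span G"
  unfolding int_span_def by (auto intro!: exI[of _ "\<lambda>h. of_bool (h = g)"] simp: of_bool_def if_distrib[of "\<lambda>c. c * _"] if_distrib[of of_int] cong: if_cong)

text \<open>Products of generators generate the products. The numbers \<open>x n\<close> used later
  are products of two members of one finitely generated group, and they stay in a finitely generated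
  group.\<close>

lemma int_span_mult:
  assumes "finite G" "finite H" "x \<in> int_span G" "y \<in> int_span H"
  shows "x * y \<in> int_span ((\<lambda>(g, h). g * h) ` (G \<times> H))"
proof -
  obtain k l :: "complex \<Rightarrow> int" where "x = (\<Sum>g\<in>G. of_int (k g) * g)" "y = (\<Sum>g\<in>H. of_int (l g) * g)"
    using assms by (auto simp: int_span_def)
  then have "x * y = (\<Sum>g\<in>G. \<Sum>h\<in>H. of_int (k g * l h) * (g * h))"
    by (simp add: sum_product algebra_simps)
  also have "\<dots> \<in> int_span ((\<lambda>(g, h). g * h) ` (G \<times> H))"
    by (intro int_span_sum int_span_scale int_span_base) (use assms in auto)
  finally show ?thesis .
qed

section \<open>Coordinates over the rational numbers\<close>

abbreviation rscale :: "rat \<Rightarrow> complex \<Rightarrow> complex" where "rscale q x \<equiv> of_rat q * x"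

interpretation Q: vector_space rscale
  by unfold_locales (auto simp: algebra_simps of_rat_add of_rat_mult)

lemma common_denominator:
  assumes "finite (S :: rat set)"
  obtains N :: int where "N > 0" "\<And>q. q \<in> S \<Longrightarrow> of_int N * q \<in> \<int>"
proof
  define den where "den q = snd (quotient_of q)" for q
  let ?N = "\<Prod>q\<in>S. den q"
  have pos: "den q > 0" for q by (simp add: den_def quotient_of_denom_pos')
  then show "?N > 0" by (simp add: prod_pos)
  show "of_int ?N * q \<in> \<int>" if q: "q \<in> S" for q
  proof -
    have "q = of_int (fst (quotient_of q)) / of_int (den q)"
      by (metis den_def prod.collapse quotient_of_div)
    moreover have "of_int (den q) \<noteq> (0::rat)" using pos[of q] by simp
    ultimately have "of_int (den q) * q = of_int (fst (quotient_of q))" by (metis nonzero_mult_div_cancel_left times_divide_eq_right)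
    moreover have "of_int ?N * q = of_int (\<Prod>q\<in>S - {q}. den q) * (of_int (den q) * q)"
      using assms q by (simp add: prod.remove mult_ac)
    ultimately show ?thesis by (metis Ints_mult Ints_of_int)
  qed
qed

text \<open>Coordinates are rational-linear, so a common denominator for the finitely many
  coordinates of the generators also clears those of every integer combination. This makes the group
  discrete in coordinates.\<close>

lemma bounded_coordinate_denominators:
  assumes G: "finite G" and B: "Q.independent B" "finite B" "G \<subseteq> Q.span B"
  obtains N :: int where "N > 0"
    "\<And>x b. x \<in> int_span G \<Longrightarrow> of_int N * Q.representation B x b \<in> \<int>"
proof -
  let ?S = "(\<lambda>(g, b). Q.representation B g b) ` (G \<times> B)"
  obtain N where N: "N > 0" "\<And>q. q \<in> ?S \<Longrightarrow> of_int N * q \<in> \<int>"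
    using common_denominator[of ?S] G B by blast
  have "of_int N * Q.representation B x b \<in> \<int>" if x: "x \<in> int_span G" for x b
  proof (cases "b \<in> B")
    case True
    obtain k :: "complex \<Rightarrow> int" where k: "x = (\<Sum>g\<in>G. of_int (k g) * g)"
      using x by (auto simp: int_span_def)
    have "Q.representation B x b = (\<Sum>g\<in>G. Q.representation B (rscale (of_int (k g)) g) b)"
    proof -
      have "rscale (of_int (k g)) g \<in> Q.span B" if "g \<in> G" for g
        using B that by (intro Q.span_scale) auto
      from Q.representation_sum[OF B(1) this, of G] show ?thesis
        unfolding k by simp
    qed
    also have "\<dots> = (\<Sum>g\<in>G. of_int (k g) * Q.representation B g b)"
    proof (intro sum.cong refl)
      fix g assume "g \<in> G"
      then show "Q.representation B (rscale (of_int (k g)) g) b = of_int (k g) * Q.representation B g b"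
        using Q.representation_scale[OF B(1), of g "of_int (k g)"] B by auto
    qed
    finally have "of_int N * Q.representation B x b = (\<Sum>g\<in>G. of_int (k g) * (of_int N * Q.representation B g b))"
      by (simp add: sum_distrib_left mult_ac)
    also have "\<dots> \<in> \<int>"
    proof (rule Ints_sum, rule Ints_mult[OF Ints_of_int])
      fix g assume "g \<in> G"
      then show "of_int N * Q.representation B g b \<in> \<int>" using True by (intro N(2)) auto
    qed
    finally show ?thesis .
  next
    case False
    then have "Q.representation B x b = 0" using Q.representation_ne_zero by blast
    then show ?thesis by simp
  qed
  with N(1) show ?thesis using that by blast
qed

text \<open>With \<open>L = 0\<close> the recursion gives \<open>y n = O(1 / n^2)\<close>; the factors \<open>1 + L / n^2\<close> have a
  convergent product and do not spoil this.\<close>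

lemma product_tends_to_zero:
  fixes y :: "nat \<Rightarrow> real" and L :: real
  assumes nn: "\<And>n. y n \<ge> 0" and step: "\<And>n. y (Suc n) \<le> y n * ((real n)\<^sup>2 + L) / (real (Suc n))\<^sup>2" and L: "L \<ge> 0"
  shows "y \<longlonglongrightarrow> 0"
proof -
  \<comment> \<open>The recursion multiplies \<open>y k * k^2\<close> by at most 1 + L / k^2 \<le>
    exp (L / k^2), starting from k = 1. The exponent 2 - 1 / (n + 1) majorizes the sum of 1 / k^2
    for k from 1 to n + 1, by the telescoping bound 1 / m^2 \<le> 1 / (m - 1) - 1 / m.\<close>
  have b: "y (Suc (Suc n)) * (real (Suc (Suc n)))\<^sup>2 \<le> y 1 * exp (L * (2 - 1 / real (Suc n)))" for n
  proof (induction n)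
    case 0
    have "y 2 * 4 \<le> y 1 * (1 + L)" using step[of 1] by (simp add: numeral_2_eq_2 pos_le_divide_eq)
    also have "\<dots> \<le> y 1 * exp L" using nn exp_ge_add_one_self[of L] by (intro mult_left_mono) auto
    finally show ?case by (simp add: numeral_2_eq_2)
  next
    case (Suc n)
    let ?m = "real (Suc (Suc n))"
    have m: "?m > 0" by simp
    have "y (Suc (Suc (Suc n))) * (real (Suc (Suc (Suc n))))\<^sup>2 \<le> y (Suc (Suc n)) * (?m\<^sup>2 + L)"
      using step[of "Suc (Suc n)"] by (simp add: pos_le_divide_eq)
    also have "\<dots> = (y (Suc (Suc n)) * ?m\<^sup>2) * (1 + L / ?m\<^sup>2)" using m by (simp add: distrib_left)
    also have "\<dots> \<le> (y 1 * exp (L * (2 - 1 / real (Suc n)))) * exp (L / ?m\<^sup>2)"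
      by (rule mult_mono[OF Suc exp_ge_add_one_self]) (use nn L in auto)
    also have "\<dots> = y 1 * exp (L * (2 - 1 / real (Suc n) + 1 / ?m\<^sup>2))" by (simp add: exp_add[symmetric] algebra_simps)
    also have "\<dots> \<le> y 1 * exp (L * (2 - 1 / ?m))"
    proof -
      have "1 / ?m\<^sup>2 \<le> 1 / (real (Suc n) * ?m)"
        by (intro divide_left_mono) (auto simp: power2_eq_square)
      also have "\<dots> = 1 / real (Suc n) - 1 / ?m" by (simp add: field_simps)
      finally show ?thesis using nn[of 1] L
        by (intro mult_left_mono exp_le_cancel_iff[THEN iffD2]) auto
    qed
    finally show ?case .
  qed
  define C where "C = y 1 * exp (L * 2)"
  have le: "y (n + 2) \<le> C / (real (n + 2))\<^sup>2" for n
  proof -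
    have "y 1 * exp (L * (2 - 1 / real (Suc n))) \<le> C" unfolding C_def using nn[of 1] L
      by (intro mult_left_mono exp_le_cancel_iff[THEN iffD2]) auto
    with b[of n] show ?thesis by (simp add: pos_le_divide_eq)
  qed
  have "(\<lambda>n. C / (real (n + 2))\<^sup>2) \<longlonglongrightarrow> 0"
  proof -
    have "(\<lambda>n. C * (inverse (real (Suc n)) * inverse (real (Suc n)))) \<longlonglongrightarrow> C * (0 * 0)"
      by (intro tendsto_intros LIMSEQ_inverse_real_of_nat)
    from LIMSEQ_Suc[OF this] show ?thesis
      by (simp add: field_simps power2_eq_square)
  qed
  then have "(\<lambda>n. y (n + 2)) \<longlonglongrightarrow> 0"
    by (rule tendsto_sandwich[OF _ _ tendsto_const, rotated 2]) (use nn le in auto)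
  then show ?thesis by (rule LIMSEQ_offset)
qed

section \<open>Recursions for binomial coefficients\<close>

lemma Suc_times_gbinomial_Suc:
  "of_nat (Suc n) * ((a :: complex) gchoose Suc n) = (a - of_nat n) * (a gchoose n)"
  using gbinomial_mult_1[of a n] by (simp add: algebra_simps)

text \<open>This is (d - n) (-d - n) = n^2 - d^2. The factor n^2 appears as a rational scalar and
  d^2 as two multiplications, because the former acts on coordinates as a number and the latter only
  as a linear map.\<close>

lemma gbinomial_minus_product_Suc:
  fixes d :: complex
  shows "of_rat (of_nat (Suc n) ^ 2) * ((d gchoose Suc n) * ((- d) gchoose Suc n))
    = rscale (of_nat n ^ 2) ((d gchoose n) * ((- d) gchoose n)) - d * (d * ((d gchoose n) * ((- d) gchoose n)))"
proof -
  note a = Suc_times_gbinomial_Suc[of n]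
  have "of_rat (of_nat (Suc n) ^ 2) * ((d gchoose Suc n) * ((- d) gchoose Suc n))
    = (of_nat (Suc n) * (d gchoose Suc n)) * (of_nat (Suc n) * ((- d) gchoose Suc n))"
    by (simp add: of_rat_power power2_eq_square of_rat_mult of_rat_add)
  also have "\<dots> = rscale (of_nat n ^ 2) ((d gchoose n) * ((- d) gchoose n)) - d * (d * ((d gchoose n) * ((- d) gchoose n)))"
    unfolding a by (simp add: of_rat_power power2_eq_square of_rat_mult algebra_simps)
  finally show ?thesis .
qed

text \<open>The identity d binom(d, k) = (k + 1) binom(d, k + 1) + k binom(d, k) makes the rational
  span of the binomial coefficients stable under multiplication by d, and it contains binom(d, 0) =
  1. Hence \<rat>[d] is finite-dimensional once these coefficients lie in a finitely generated
  group.\<close>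

lemma power_in_gbinomial_span: "(d :: complex) ^ n \<in> Q.span (range (\<lambda>k. d gchoose k))"
  (is "_ \<in> Q.span ?R")
proof -
  note a = Suc_times_gbinomial_Suc[of _ d]
  have mult_d: "d * x \<in> Q.span ?R" if "x \<in> Q.span ?R" for x
    using that
  proof (induction rule: Q.span_induct_alt)
    case base
    then show ?case by (simp add: Q.span_zero)
  next
    case (step q x y)
    then obtain k where k: "x = d gchoose k" by auto
    have "d * x = rscale (of_nat (Suc k)) (d gchoose Suc k) + rscale (of_nat k) (d gchoose k)"
      using a[of k] unfolding k by (simp add: algebra_simps of_rat_add)
    also have "\<dots> \<in> Q.span ?R" by (intro Q.span_add Q.span_scale Q.span_base) auto
    finally have "d * x \<in> Q.span ?R" .
    then have "rscale q (d * x) + d * y \<in> Q.span ?R" using step by (intro Q.span_add Q.span_scale)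
    then show ?case by (simp add: algebra_simps)
  qed
  show ?thesis
  proof (induction n)
    case 0
    have "d gchoose 0 \<in> Q.span ?R" by (rule Q.span_base, rule rangeI)
    then show ?case by simp
  next
    case (Suc n)
    then show ?case using mult_d by simp
  qed
qed

text \<open>In the application \<open>P\<close> consists of the powers of d and \<open>H\<close>
  generates the group containing the products \<open>x n\<close>. Two nested bases are wanted: the
  span of \<open>B0\<close> is \<rat>[d], on which d acts, while \<open>B\<close> is large enough to
  give the generators in \<open>H\<close> coordinates. \<open>B0\<close> is finite as an independent
  subset of the span of a finite set.\<close>

lemma finite_span_basis_extension:
  assumes G: "finite G" "P \<subseteq> Q.span G" and H: "finite H"
  obtains B0 B where "B0 \<subseteq> B" "finite B" "Q.independent B" "P \<subseteq> Q.span B0" "B0 \<subseteq> P" "H \<subseteq> Q.span B"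
proof -
  obtain B0 where B0: "B0 \<subseteq> P" "Q.independent B0" "P \<subseteq> Q.span B0"
    using Q.maximal_independent_subset by blast
  have "finite B0" using Q.independent_span_bound[OF G(1) B0(2)] B0(1) G(2) by blast
  obtain B where B: "B0 \<subseteq> B" "B \<subseteq> B0 \<union> H" "Q.independent B" "B0 \<union> H \<subseteq> Q.span B"
    using Q.maximal_independent_subset_extend[of B0 "B0 \<union> H"] B0(2) by auto
  show ?thesis using that[of B0 B] B B0 finite_subset[OF B(2)] \<open>finite B0\<close> H by auto
qed

text \<open>The products here and in the next lemma are the traces of the antisymmetrizers and the
  symmetrizers, with \<epsilon> = -1 and \<epsilon> = 1 in \<open>trace_symmetrizer\<close>.\<close>

lemma prod_eq_gbinomial:
  "(\<Prod>k<n. ((z :: complex) + (-1) * of_nat k) / of_nat (Suc k)) = z gchoose n"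
proof (induction n)
  case (Suc n)
  have "z gchoose Suc n = (z - of_nat n) * (z gchoose n) / of_nat (Suc n)"
    using Suc_times_gbinomial_Suc[of n z] by (simp add: eq_divide_eq mult.commute del: of_nat_Suc)
  with Suc show ?case by (simp del: of_nat_Suc)
qed simp

lemma prod_eq_gbinomial_minus:
  "(\<Prod>k<n. ((z :: complex) + 1 * of_nat k) / of_nat (Suc k)) = (-1) ^ n * ((- z) gchoose n)"
proof (induction n)
  case (Suc n)
  have "(- z) gchoose Suc n = - ((z + of_nat n) * ((- z) gchoose n) / of_nat (Suc n))"
    using Suc_times_gbinomial_Suc[of n "- z"] by (simp add: field_simps del: of_nat_Suc)
  with Suc show ?case by (simp del: of_nat_Suc)
qed simp

text \<open>The size of \<open>x n\<close> is measured by \<open>nrm\<close>, the sum of the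
  absolute coordinates with respect to \<open>B\<close>. On \<rat>[d] multiplication by d^2 is
  bounded for this norm, which turns the recursion into the inequality required by
  \<open>product_tends_to_zero\<close>.\<close>

lemma integer_if_gbinomials_in_int_span:
  fixes d :: complex
  assumes G: "finite G" and d1: "\<And>n. d gchoose n \<in> int_span G" and d2: "\<And>n. (- d) gchoose n \<in> int_span G"
  shows "d \<in> \<int>"
proof -
  define x where "x n = (d gchoose n) * ((- d) gchoose n)" for n
  define P where "P = range (\<lambda>n. d ^ n)"
  define H where "H = (\<lambda>(g, h). g * h) ` (G \<times> G)"
  have H: "finite H" using G by (simp add: H_def)
  have xH: "x n \<in> int_span H" for n
    unfolding x_def H_def by (intro int_span_mult G d1 d2)
  have "int_span G \<subseteq> Q.span G"
  proof
    fix y assume "y \<in> int_span G"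
    then obtain k :: "complex \<Rightarrow> int" where "y = (\<Sum>g\<in>G. rscale (of_int (k g)) g)"
      by (auto simp: int_span_def)
    moreover have "(\<Sum>g\<in>G. rscale (of_int (k g)) g) \<in> Q.span G"
      by (intro Q.span_sum Q.span_scale Q.span_base)
    ultimately show "y \<in> Q.span G" by simp
  qed
  then have "Q.span (range (\<lambda>k. d gchoose k)) \<subseteq> Q.span G"
    using d1 by (intro Q.span_minimal) auto
  then have "P \<subseteq> Q.span G" using power_in_gbinomial_span[of d] by (auto simp: P_def)
  then obtain B0 B where B: "B0 \<subseteq> B" "finite B" "Q.independent B" "P \<subseteq> Q.span B0" "B0 \<subseteq> P" "H \<subseteq> Q.span B"
    using finite_span_basis_extension[OF G _ H] by blast
  have U: "Q.span B0 \<subseteq> Q.span B" by (rule Q.span_mono[OF B(1)])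
  \<comment> \<open>\<open>B0\<close> consists of powers of d and spans all of them, so
    multiplication by d preserves its span.\<close>
  have dU: "d * u \<in> Q.span B0" if "u \<in> Q.span B0" for u
    using that
  proof (induction rule: Q.span_induct_alt)
    case base
    then show ?case by (simp add: Q.span_zero)
  next
    case (step q b y)
    then obtain n where "b = d ^ n" using B(5) by (auto simp: P_def)
    then have "d * b \<in> P" by (auto simp: P_def intro!: image_eqI[of _ _ "Suc n"])
    then have "rscale q (d * b) + d * y \<in> Q.span B0" using step B(4) by (intro Q.span_add Q.span_scale) auto
    then show ?case by (simp add: algebra_simps)
  qed
  note rec = gbinomial_minus_product_Suc[of _ d, folded x_def]
  have xU: "x n \<in> Q.span B0" for n
  proof (induction n)
    case 0
    have "d ^ 0 \<in> P" unfolding P_def by blast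
    then show ?case using B(4) by (auto simp: x_def)
  next
    case (Suc n)
    have "rscale (of_nat n ^ 2) (x n) - d * (d * x n) \<in> Q.span B0"
      by (intro Q.span_diff Q.span_scale dU Suc)
    then have "rscale (1 / of_nat (Suc n) ^ 2) (rscale (of_nat (Suc n) ^ 2) (x (Suc n))) \<in> Q.span B0"
      unfolding rec by (rule Q.span_scale)
    then show ?case by (simp add: of_rat_divide of_rat_power del: of_nat_Suc)
  qed
  define nrm :: "complex \<Rightarrow> real" where "nrm y = (\<Sum>b\<in>B. \<bar>of_rat (Q.representation B y b)\<bar>)" for y
  have nrm_nn: "nrm y \<ge> 0" for y by (simp add: nrm_def sum_nonneg)
  have nrm_scale: "nrm (rscale q y) = \<bar>of_rat q\<bar> * nrm y" if "y \<in> Q.span B" for q y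
    using Q.representation_scale[OF B(3) that, of q] by (simp add: nrm_def of_rat_mult abs_mult sum_distrib_left)
  have nrm_diff: "nrm (y - z) \<le> nrm y + nrm z" if "y \<in> Q.span B" "z \<in> Q.span B" for y z
    using Q.representation_diff[OF B(3) that(2) that(1)]
    unfolding nrm_def sum.distrib[symmetric] by (intro sum_mono) (simp only: of_rat_diff abs_triangle_ineq4)
  have nrm_sum: "nrm (\<Sum>i\<in>I. f i) \<le> (\<Sum>i\<in>I. nrm (f i))" if "\<And>i. i \<in> I \<Longrightarrow> f i \<in> Q.span B" for I and f :: "complex \<Rightarrow> complex"
  proof -
    have "nrm (\<Sum>i\<in>I. f i) \<le> (\<Sum>b\<in>B. \<Sum>i\<in>I. \<bar>of_rat (Q.representation B (f i) b)\<bar>)"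
      using Q.representation_sum[of B I f, OF B(3) that] unfolding nrm_def
      by (intro sum_mono) (simp only: of_rat_sum sum_abs)
    then show ?thesis by (subst (asm) sum.swap) (simp add: nrm_def)
  qed
  \<comment> \<open>A bound for multiplication by d^2 on the span of \<open>B0\<close>: expand u in
    \<open>B0\<close> and estimate each coefficient by \<open>nrm u\<close>.\<close>
  define L where "L = (\<Sum>b\<in>B0. nrm (d * (d * b)))"
  have B0f: "finite B0" by (rule finite_subset[OF B(1,2)])
  have bound: "nrm (d * (d * u)) \<le> L * nrm u" if u: "u \<in> Q.span B0" for u
  proof -
    let ?r = "Q.representation B0 u"
    have ind0: "Q.independent B0" by (rule Q.independent_mono[OF B(3,1)])
    \<comment> \<open>Since \<open>B\<close> extends \<open>B0\<close>, the norm taken in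
      \<open>B\<close> controls the coefficients of u in \<open>B0\<close>.\<close>
    have rep: "Q.representation B u b = ?r b" for b
      using Q.representation_extend[OF B(3) u B(1)] by simp
    have u_eq: "u = (\<Sum>b\<in>B0. rscale (?r b) b)"
      using Q.sum_representation_eq[OF ind0 u B0f order_refl] by simp
    have "d * (d * u) = (\<Sum>b\<in>B0. rscale (?r b) (d * (d * b)))"
      using arg_cong[OF u_eq, of "\<lambda>v. d * (d * v)"] unfolding sum_distrib_left
      by (simp only: mult.left_commute)
    moreover have db: "d * (d * b) \<in> Q.span B" if "b \<in> B0" for b
      using dU[OF dU[OF Q.span_base[OF that]]] U by auto
    ultimately have "nrm (d * (d * u)) \<le> (\<Sum>b\<in>B0. nrm (rscale (?r b) (d * (d * b))))"
      using nrm_sum[of B0 "\<lambda>b. rscale (?r b) (d * (d * b))"] by (auto intro: Q.span_scale)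
    also have "\<dots> = (\<Sum>b\<in>B0. \<bar>of_rat (?r b)\<bar> * nrm (d * (d * b)))"
      using nrm_scale db by (intro sum.cong) auto
    also have "\<dots> \<le> (\<Sum>b\<in>B0. nrm u * nrm (d * (d * b)))"
    proof (intro sum_mono mult_right_mono nrm_nn)
      fix b assume "b \<in> B0"
      then show "\<bar>of_rat (?r b)\<bar> \<le> nrm u" unfolding nrm_def rep[symmetric]
        using B by (intro member_le_sum) auto
    qed
    also have "\<dots> = L * nrm u" by (simp add: L_def sum_distrib_left sum_distrib_right mult.commute)
    finally show ?thesis .
  qed
  have L: "L \<ge> 0" by (simp add: L_def sum_nonneg nrm_nn)
  have "(\<lambda>n. nrm (x n)) \<longlonglongrightarrow> 0"
  proof (rule product_tends_to_zero[OF nrm_nn _ L])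
    fix n
    have "nrm (x (Suc n)) * (real (Suc n))\<^sup>2 = nrm (rscale (of_nat (Suc n) ^ 2) (x (Suc n)))"
      using nrm_scale[OF subsetD[OF U xU[of "Suc n"]], of "of_nat (Suc n) ^ 2"]
      by (simp add: of_rat_power of_rat_add abs_mult mult.commute)
    also have "\<dots> \<le> nrm (rscale (of_nat n ^ 2) (x n)) + nrm (d * (d * x n))"
      unfolding rec using U by (intro nrm_diff subsetD[OF U] Q.span_scale dU xU)
    also have "\<dots> \<le> (real n)\<^sup>2 * nrm (x n) + L * nrm (x n)"
      using bound[OF xU[of n]] nrm_scale[OF subsetD[OF U xU[of n]], of "of_nat n ^ 2"]
      by (simp add: of_rat_power)
    finally show "nrm (x (Suc n)) \<le> nrm (x n) * ((real n)\<^sup>2 + L) / (real (Suc n))\<^sup>2"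
      by (simp add: pos_le_divide_eq algebra_simps)
  qed
  moreover obtain N :: int where N: "N > 0" "\<And>x b. x \<in> int_span H \<Longrightarrow> of_int N * Q.representation B x b \<in> \<int>"
    using bounded_coordinate_denominators[OF H B(3,2,6)] by blast
  ultimately have "eventually (\<lambda>n. nrm (x n) < 1 / of_int N) sequentially"
    by (intro order_tendstoD) auto
  then obtain n where n: "nrm (x n) < 1 / of_int N" by (auto simp: eventually_sequentially)
  \<comment> \<open>Multiplied by \<open>N\<close>, each coordinate of \<open>x n\<close> is an
    integer of absolute value less than 1.\<close>
  have "Q.representation B (x n) b = 0" for b
  proof (cases "b \<in> B")
    case True
    obtain m where m: "of_int N * Q.representation B (x n) b = of_int m"
      using N(2)[OF xH[of n], of b] by (rule Ints_cases)
    have "\<bar>of_rat (Q.representation B (x n) b)\<bar> < 1 / real_of_int N"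
      using n member_le_sum[OF True, of "\<lambda>b. \<bar>of_rat (Q.representation B (x n) b)\<bar> :: real"] B(2)
      by (simp add: nrm_def)
    moreover have "of_int N * of_rat (Q.representation B (x n) b) = real_of_int m"
      by (metis m of_rat_mult of_rat_of_int_eq)
    ultimately have "\<bar>real_of_int m\<bar> < 1" using N(1)
      by (simp flip: \<open>of_int N * of_rat (Q.representation B (x n) b) = real_of_int m\<close>
          add: abs_mult pos_less_divide_eq mult.commute del: abs_of_rat)
    then have "m = 0" by linarith
    then show ?thesis using m N(1) by simp
  next
    case False
    then show ?thesis using Q.representation_ne_zero by blast
  qed
  then have "x n = 0"
    using Q.sum_representation_eq[OF B(3) _ B(2) order_refl, of "x n"] xU U by auto
  \<comment> \<open>A vanishing binomial coefficient has a vanishing factor d - i or -d - i in its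
    numerator.\<close>
  then have "d gchoose n = 0 \<or> (- d) gchoose n = 0" by (simp add: x_def)
  then show ?thesis
  proof
    assume "d gchoose n = 0"
    then obtain i where "d = of_nat i" by (auto simp: gbinomial_prod_rev)
    then show ?thesis by simp
  next
    assume "(- d) gchoose n = 0"
    then obtain i where "- d = of_nat i" by (auto simp: gbinomial_prod_rev)
    then show ?thesis by (metis Ints_minus Ints_of_nat minus_minus)
  qed
qed

section \<open>Strict symmetric categories\<close>

text \<open>Objects are lists and the tensor product of objects is \<open>@\<close>, so that the associativity and unit
  laws are equations between arrows which the simplifier can use.\<close>

locale strict_category =
  fixes obj :: "'o list \<Rightarrow> bool"
    and arr :: "'b \<Rightarrow> bool"
    and dm :: "'b \<Rightarrow> 'o list"
    and cd :: "'b \<Rightarrow> 'o list"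
    and one :: "'o list \<Rightarrow> 'b"
    and comp :: "'b \<Rightarrow> 'b \<Rightarrow> 'b" (infixr "\<bullet>" 55)
    and tens :: "'b \<Rightarrow> 'b \<Rightarrow> 'b" (infixr "\<star>" 70)
    and nul :: "'o list \<Rightarrow> 'o list \<Rightarrow> 'b"
    and plus :: "'b \<Rightarrow> 'b \<Rightarrow> 'b" (infixl "\<uplus>" 53)
    and scal :: "complex \<Rightarrow> 'b \<Rightarrow> 'b" (infixr "\<ltimes>" 65)
    and br :: "'o list \<Rightarrow> 'o list \<Rightarrow> 'b"
  assumes obj_Nil [simp]: "obj []"
    and obj_append [simp]: "obj (A @ B) \<longleftrightarrow> obj A \<and> obj B"
    and obj_dm [simp]: "arr f \<Longrightarrow> obj (dm f)"
    and obj_cd [simp]: "arr f \<Longrightarrow> obj (cd f)"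
    and arr_one [simp]: "obj A \<Longrightarrow> arr (one A)"
    and dm_one [simp]: "dm (one A) = A"
    and cd_one [simp]: "cd (one A) = A"
    and arr_comp [simp]: "arr f \<Longrightarrow> arr g \<Longrightarrow> dm g = cd f \<Longrightarrow> arr (g \<bullet> f)"
    and dm_comp [simp]: "dm (g \<bullet> f) = dm f"
    and cd_comp [simp]: "cd (g \<bullet> f) = cd g"
    and comp_one_right [simp]: "arr f \<Longrightarrow> dm f = A \<Longrightarrow> f \<bullet> one A = f"
    and comp_one_left [simp]: "arr f \<Longrightarrow> cd f = A \<Longrightarrow> one A \<bullet> f = f"
    and comp_assoc: "arr f \<Longrightarrow> arr g \<Longrightarrow> arr h \<Longrightarrow> dm g = cd f \<Longrightarrow> dm h = cd g \<Longrightarrow>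
          (h \<bullet> g) \<bullet> f = h \<bullet> g \<bullet> f"
    and arr_tens [simp]: "arr f \<Longrightarrow> arr g \<Longrightarrow> arr (f \<star> g)"
    and dm_tens [simp]: "dm (f \<star> g) = dm f @ dm g"
    and cd_tens [simp]: "cd (f \<star> g) = cd f @ cd g"
    and tens_assoc: "arr f \<Longrightarrow> arr g \<Longrightarrow> arr h \<Longrightarrow> (f \<star> g) \<star> h = f \<star> g \<star> h"
    and tens_unit_left [simp]: "arr f \<Longrightarrow> one [] \<star> f = f"
    and tens_unit_right [simp]: "arr f \<Longrightarrow> f \<star> one [] = f"
    and tens_one: "obj A \<Longrightarrow> obj B \<Longrightarrow> one A \<star> one B = one (A @ B)"
    and interchange: "arr f \<Longrightarrow> arr f' \<Longrightarrow> arr g \<Longrightarrow> arr g' \<Longrightarrow> dm f' = cd f \<Longrightarrow> dm g' = cd g \<Longrightarrow>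
          (f' \<star> g') \<bullet> (f \<star> g) = (f' \<bullet> f) \<star> (g' \<bullet> g)"
    and arr_nul [simp]: "obj A \<Longrightarrow> obj B \<Longrightarrow> arr (nul A B)"
    and dm_nul [simp]: "dm (nul A B) = A"
    and cd_nul [simp]: "cd (nul A B) = B"
    and arr_plus [simp]: "arr f \<Longrightarrow> arr g \<Longrightarrow> dm f = dm g \<Longrightarrow> cd f = cd g \<Longrightarrow> arr (f \<uplus> g)"
    and dm_plus [simp]: "dm (f \<uplus> g) = dm f"
    and cd_plus [simp]: "cd (f \<uplus> g) = cd f"
    and arr_scal [simp]: "arr f \<Longrightarrow> arr (c \<ltimes> f)"
    and dm_scal [simp]: "dm (c \<ltimes> f) = dm f"
    and cd_scal [simp]: "cd (c \<ltimes> f) = cd f"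
    and plus_assoc: "arr f \<Longrightarrow> arr g \<Longrightarrow> arr h \<Longrightarrow> dm f = dm g \<Longrightarrow> cd f = cd g \<Longrightarrow>
          dm g = dm h \<Longrightarrow> cd g = cd h \<Longrightarrow> (f \<uplus> g) \<uplus> h = f \<uplus> (g \<uplus> h)"
    and plus_commute: "arr f \<Longrightarrow> arr g \<Longrightarrow> dm f = dm g \<Longrightarrow> cd f = cd g \<Longrightarrow> f \<uplus> g = g \<uplus> f"
    and plus_nul [simp]: "arr f \<Longrightarrow> dm f = A \<Longrightarrow> cd f = B \<Longrightarrow> f \<uplus> nul A B = f"
    and scal_one [simp]: "arr f \<Longrightarrow> 1 \<ltimes> f = f"
    and scal_zero [simp]: "arr f \<Longrightarrow> 0 \<ltimes> f = nul (dm f) (cd f)"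
    and scal_scal [simp]: "arr f \<Longrightarrow> c \<ltimes> d \<ltimes> f = (c * d) \<ltimes> f"
    and scal_add: "arr f \<Longrightarrow> (c + d) \<ltimes> f = (c \<ltimes> f) \<uplus> (d \<ltimes> f)"
    and scal_plus: "arr f \<Longrightarrow> arr g \<Longrightarrow> dm f = dm g \<Longrightarrow> cd f = cd g \<Longrightarrow>
          c \<ltimes> (f \<uplus> g) = (c \<ltimes> f) \<uplus> (c \<ltimes> g)"
    and comp_plus_left: "arr f \<Longrightarrow> arr g \<Longrightarrow> arr h \<Longrightarrow> dm g = cd f \<Longrightarrow> dm h = dm g \<Longrightarrow> cd h = cd g \<Longrightarrow>
          (g \<uplus> h) \<bullet> f = (g \<bullet> f) \<uplus> (h \<bullet> f)"
    and comp_plus_right: "arr f \<Longrightarrow> arr g \<Longrightarrow> arr h \<Longrightarrow> dm h = cd f \<Longrightarrow> dm g = dm f \<Longrightarrow> cd g = cd f \<Longrightarrow>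
          h \<bullet> (f \<uplus> g) = (h \<bullet> f) \<uplus> (h \<bullet> g)"
    and comp_scal_left [simp]: "arr f \<Longrightarrow> arr g \<Longrightarrow> dm g = cd f \<Longrightarrow> (c \<ltimes> g) \<bullet> f = c \<ltimes> (g \<bullet> f)"
    and comp_scal_right [simp]: "arr f \<Longrightarrow> arr g \<Longrightarrow> dm g = cd f \<Longrightarrow> g \<bullet> (c \<ltimes> f) = c \<ltimes> (g \<bullet> f)"
    and tens_plus_left: "arr f \<Longrightarrow> arr g \<Longrightarrow> arr h \<Longrightarrow> dm f = dm g \<Longrightarrow> cd f = cd g \<Longrightarrow>
          (f \<uplus> g) \<star> h = (f \<star> h) \<uplus> (g \<star> h)"
    and tens_scal_left [simp]: "arr f \<Longrightarrow> arr g \<Longrightarrow> (c \<ltimes> f) \<star> g = c \<ltimes> (f \<star> g)"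
    and tens_scal_right [simp]: "arr f \<Longrightarrow> arr g \<Longrightarrow> f \<star> (c \<ltimes> g) = c \<ltimes> (f \<star> g)"
    and arr_br [simp]: "obj A \<Longrightarrow> obj B \<Longrightarrow> arr (br A B)"
    and dm_br [simp]: "dm (br A B) = A @ B"
    and cd_br [simp]: "cd (br A B) = B @ A"
    and br_natural: "arr f \<Longrightarrow> arr g \<Longrightarrow> br (cd f) (cd g) \<bullet> (f \<star> g) = (g \<star> f) \<bullet> br (dm f) (dm g)"
    and br_br [simp]: "obj A \<Longrightarrow> obj B \<Longrightarrow> br B A \<bullet> br A B = one (A @ B)"
    and br_append_right: "obj A \<Longrightarrow> obj B \<Longrightarrow> obj C \<Longrightarrow>
          br A (B @ C) = (one B \<star> br A C) \<bullet> (br A B \<star> one C)"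
begin

section \<open>Linear arithmetic and interchange\<close>

lemma nul_comp [simp]:
  assumes "arr f" "cd f = A" "obj B" shows "nul A B \<bullet> f = nul (dm f) B"
proof -
  have "nul A B \<bullet> f = (0 \<ltimes> nul A B) \<bullet> f" using assms by (auto simp del: comp_scal_left)
  also have "\<dots> = nul (dm f) B" using assms by (subst comp_scal_left) auto
  finally show ?thesis .
qed

lemma comp_nul [simp]:
  assumes "arr f" "dm f = B" "obj A" shows "f \<bullet> nul A B = nul A (cd f)"
proof -
  have "f \<bullet> nul A B = f \<bullet> (0 \<ltimes> nul A B)" using assms by (auto simp del: comp_scal_right)
  also have "\<dots> = nul A (cd f)" using assms by (subst comp_scal_right) auto
  finally show ?thesis .
qed

lemma tens_nul [simp]:
  assumes "arr f" "obj A" "obj B" shows "f \<star> nul A B = nul (dm f @ A) (cd f @ B)"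
proof -
  have "f \<star> nul A B = f \<star> (0 \<ltimes> nul A B)" using assms by (auto simp del: tens_scal_right)
  also have "\<dots> = nul (dm f @ A) (cd f @ B)" using assms by (subst tens_scal_right) auto
  finally show ?thesis .
qed

lemma nul_tens [simp]:
  assumes "arr f" "obj A" "obj B" shows "nul A B \<star> f = nul (A @ dm f) (B @ cd f)"
proof -
  have "nul A B \<star> f = (0 \<ltimes> nul A B) \<star> f" using assms by (auto simp del: tens_scal_left)
  also have "\<dots> = nul (A @ dm f) (B @ cd f)" using assms by (subst tens_scal_left) auto
  finally show ?thesis .
qed

text \<open>The signature has no subtraction; the negative of g is \<open>(-1) \<ltimes> g\<close>,
  and g is added back to conclude.\<close>

lemma eq_if_diff_nul:
  assumes "arr f" "arr g" "dm f = dm g" "cd f = cd g" "f \<uplus> ((-1) \<ltimes> g) = nul (dm f) (cd f)"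
  shows "f = g"
proof -
  have z: "((-1) \<ltimes> g) \<uplus> g = nul (dm g) (cd g)"
    using scal_add[of g "-1" 1] assms by simp
  have "g = nul (dm f) (cd f) \<uplus> g" using assms plus_commute[of "nul (dm f) (cd f)" g] by simp
  also have "\<dots> = f \<uplus> (((-1) \<ltimes> g) \<uplus> g)"
    using assms by (simp add: plus_assoc[symmetric])
  also have "\<dots> = f" using z assms by simp
  finally show ?thesis by simp
qed

text \<open>Arrows on disjoint tensor factors may be performed in either order. In diagrams, this
  moves a box, a cup or a cap past parallel strands.\<close>

lemma slide:
  assumes "arr f" "arr g"
  shows "(f \<star> one (cd g)) \<bullet> (one (dm f) \<star> g) = f \<star> g"
    and "(one (cd f) \<star> g) \<bullet> (f \<star> one (dm g)) = f \<star> g"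
  using assms by (simp_all add: interchange)

lemma whisker_comp_left: "arr f \<Longrightarrow> arr g \<Longrightarrow> dm g = cd f \<Longrightarrow> obj A \<Longrightarrow>
   one A \<star> (g \<bullet> f) = (one A \<star> g) \<bullet> (one A \<star> f)"
  by (simp add: interchange)

lemma whisker_comp_right: "arr f \<Longrightarrow> arr g \<Longrightarrow> dm g = cd f \<Longrightarrow> obj A \<Longrightarrow>
   (g \<bullet> f) \<star> one A = (g \<star> one A) \<bullet> (f \<star> one A)"
  by (simp add: interchange)

text \<open>Composites are kept right-associated, so \<open>h \<bullet> g\<close> is not a subterm
  of \<open>h \<bullet> g \<bullet> f\<close>; this form lets an equation for it be applied
  there.\<close>

lemma comp_cong_assoc:
  "h \<bullet> g = k \<Longrightarrow> arr f \<Longrightarrow> arr g \<Longrightarrow> arr h \<Longrightarrow> dm g = cd f \<Longrightarrow> dm h = cd g \<Longrightarrow> h \<bullet> g \<bullet> f = k \<bullet> f"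
  by (metis comp_assoc)

section \<open>The braiding\<close>

lemma br_Nil_right [simp]: assumes "obj A" shows "br A [] = one A"
proof -
  \<comment> \<open>The hexagon at empty lists makes \<open>br A []\<close> idempotent; being
    invertible, it is an identity.\<close>
  have "br A [] = br A [] \<bullet> br A []" using br_append_right[of A "[]" "[]"] assms by simp
  moreover have "br [] A \<bullet> br A [] = one A" using br_br[of A "[]"] assms by simp
  ultimately show ?thesis using assms comp_assoc[of "br A []" "br A []" "br [] A"]
    by (metis arr_br append_Nil append_Nil2 cd_br dm_br comp_one_left obj_Nil)
qed

lemma br_Nil_left [simp]: assumes "obj A" shows "br [] A = one A"
  using assms br_br[of A "[]"] by simp

text \<open>The second hexagon is the inverse of the first: the right-hand side is a right inverse
  of \<open>br C (A @ B)\<close>, whose two-sided inverse is the left-hand side by symmetry.\<close>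

lemma br_append_left:
  assumes "obj A" "obj B" "obj C"
  shows "br (A @ B) C = (br A C \<star> one B) \<bullet> (one A \<star> br B C)"
proof -
  have 1: "br C (A @ B) = (one A \<star> br C B) \<bullet> (br C A \<star> one B)"
    using assms by (simp add: br_append_right)
  have a: "(one A \<star> br C B) \<bullet> (one A \<star> br B C) = one (A @ B @ C)"
    using assms by (simp add: interchange tens_one)
  have b: "(br C A \<star> one B) \<bullet> (br A C \<star> one B) = one (A @ C @ B)"
    using assms by (simp add: interchange tens_one)
  have "br C (A @ B) \<bullet> ((br A C \<star> one B) \<bullet> (one A \<star> br B C)) =
     (one A \<star> br C B) \<bullet> ((br C A \<star> one B) \<bullet> (br A C \<star> one B)) \<bullet> (one A \<star> br B C)"
    using assms by (simp add: 1 comp_assoc)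
  also have "\<dots> = one (A @ B @ C)" using assms by (simp add: b a)
  finally have "br (A @ B) C \<bullet> (br C (A @ B) \<bullet> ((br A C \<star> one B) \<bullet> (one A \<star> br B C))) = br (A @ B) C"
    using assms by simp
  moreover have "br (A @ B) C \<bullet> (br C (A @ B) \<bullet> ((br A C \<star> one B) \<bullet> (one A \<star> br B C)))
     = (br A C \<star> one B) \<bullet> (one A \<star> br B C)"
    using assms by (subst comp_assoc[symmetric]) auto
  ultimately show ?thesis by simp
qed

text \<open>Naturality of \<open>br (A @ A) A\<close> at the arrow \<open>br A A\<close>, read after
  splitting the braiding of the product.\<close>

lemma braid_relation:
  assumes "obj A"
  shows "(br A A \<star> one A) \<bullet> (one A \<star> br A A) \<bullet> (br A A \<star> one A)
    = (one A \<star> br A A) \<bullet> (br A A \<star> one A) \<bullet> (one A \<star> br A A)"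
proof -
  have "br (A @ A) A \<bullet> (br A A \<star> one A) = (one A \<star> br A A) \<bullet> br (A @ A) A"
    using br_natural[of "br A A" "one A"] assms by simp
  then show ?thesis using assms by (simp add: br_append_left comp_assoc)
qed

section \<open>Duals, transposes and traces\<close>

definition dual :: "'o list \<Rightarrow> 'o list \<Rightarrow> 'b \<Rightarrow> 'b \<Rightarrow> bool" where
  "dual X D c e \<longleftrightarrow> obj X \<and> obj D \<and> arr c \<and> dm c = [] \<and> cd c = X @ D \<and>
     arr e \<and> dm e = D @ X \<and> cd e = [] \<and>
     (one X \<star> e) \<bullet> (c \<star> one X) = one X \<and> (e \<star> one D) \<bullet> (one D \<star> c) = one D"

lemma dualD:
  assumes "dual X D c e"
  shows "obj X" "obj D" "arr c" "dm c = []" "cd c = X @ D" "arr e" "dm e = D @ X" "cd e = []"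
    and "(one X \<star> e) \<bullet> (c \<star> one X) = one X" "(e \<star> one D) \<bullet> (one D \<star> c) = one D"
  using assms by (auto simp: dual_def)

text \<open>Together with \<open>dual_adjunction_right_2\<close> this says that
  \<open>- \<star> X\<close> is left adjoint to \<open>- \<star> D\<close>: bending the strand X
  with c and bending it back with e are inverse operations. After a slide, one zigzag
  remains.\<close>

lemma dual_adjunction_right_1:
  assumes d: "dual X D c e" and f: "arr f" "dm f = A @ X" "cd f = B"
  shows "(one B \<star> e) \<bullet> (((f \<star> one D) \<bullet> (one A \<star> c)) \<star> one X) = f"
proof -
  note [simp] = dualD[OF d]
  have A: "obj A" "obj B" using obj_dm[OF f(1)] obj_cd[OF f(1)] f by auto
  have 1: "((f \<star> one D) \<bullet> (one A \<star> c)) \<star> one X = (f \<star> one (D @ X)) \<bullet> (one A \<star> (c \<star> one X))"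
    using f A by (simp add: whisker_comp_right tens_assoc tens_one)
  have 2: "(one B \<star> e) \<bullet> (f \<star> one (D @ X)) = f \<bullet> (one A \<star> (one X \<star> e))"
    using slide[of f e] f A by (simp add: tens_one tens_assoc[symmetric])
  have "(one B \<star> e) \<bullet> (((f \<star> one D) \<bullet> (one A \<star> c)) \<star> one X)
     = ((one B \<star> e) \<bullet> (f \<star> one (D @ X))) \<bullet> (one A \<star> (c \<star> one X))"
    unfolding 1 using f A by (subst comp_assoc) auto
  also have "\<dots> = f \<bullet> (one A \<star> ((one X \<star> e) \<bullet> (c \<star> one X)))"
    unfolding 2 using f A by (subst whisker_comp_left) (auto simp: comp_assoc)
  finally show ?thesis using f A by (simp add: tens_one)
qed

lemma dual_adjunction_right_2:
  assumes d: "dual X D c e" and g: "arr g" "dm g = A" "cd g = B @ D"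
  shows "(((one B \<star> e) \<bullet> (g \<star> one X)) \<star> one D) \<bullet> (one A \<star> c) = g"
proof -
  note [simp] = dualD[OF d]
  have A: "obj A" "obj B" using obj_dm[OF g(1)] obj_cd[OF g(1)] g by auto
  have 1: "((one B \<star> e) \<bullet> (g \<star> one X)) \<star> one D = (one B \<star> (e \<star> one D)) \<bullet> (g \<star> one (X @ D))"
    using g A by (simp add: whisker_comp_right tens_assoc tens_one)
  have 2: "(g \<star> one (X @ D)) \<bullet> (one A \<star> c) = (one B \<star> (one D \<star> c)) \<bullet> g"
    using slide[of g c] g A by (simp add: tens_one tens_assoc[symmetric])
  have "(((one B \<star> e) \<bullet> (g \<star> one X)) \<star> one D) \<bullet> (one A \<star> c)
     = (one B \<star> (e \<star> one D)) \<bullet> ((g \<star> one (X @ D)) \<bullet> (one A \<star> c))"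
    unfolding 1 using g A by (subst comp_assoc) auto
  also have "\<dots> = (one B \<star> ((e \<star> one D) \<bullet> (one D \<star> c))) \<bullet> g"
    unfolding 2 using g A by (subst whisker_comp_left) (auto simp: comp_assoc)
  finally show ?thesis using g A by (simp add: tens_one)
qed

text \<open>The mirror image, again a pair with the lemma that follows: \<open>D \<star> -\<close>
  is left adjoint to \<open>X \<star> -\<close>.\<close>

lemma dual_adjunction_left_1:
  assumes d: "dual X D c e" and f: "arr f" "dm f = D @ A" "cd f = B"
  shows "(e \<star> one B) \<bullet> (one D \<star> ((one X \<star> f) \<bullet> (c \<star> one A))) = f"
proof -
  note [simp] = dualD[OF d]
  have A: "obj A" "obj B" using obj_dm[OF f(1)] obj_cd[OF f(1)] f by auto
  have 1: "one D \<star> ((one X \<star> f) \<bullet> (c \<star> one A)) = (one (D @ X) \<star> f) \<bullet> ((one D \<star> c) \<star> one A)"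
    using f A by (simp add: whisker_comp_left tens_one tens_assoc[symmetric])
  have 2: "(e \<star> one B) \<bullet> (one (D @ X) \<star> f) = f \<bullet> ((e \<star> one D) \<star> one A)"
    using slide[of e f] f A by (simp add: tens_one tens_assoc)
  have "(e \<star> one B) \<bullet> (one D \<star> ((one X \<star> f) \<bullet> (c \<star> one A)))
     = ((e \<star> one B) \<bullet> (one (D @ X) \<star> f)) \<bullet> ((one D \<star> c) \<star> one A)"
    unfolding 1 using f A by (subst comp_assoc) auto
  also have "\<dots> = f \<bullet> (((e \<star> one D) \<bullet> (one D \<star> c)) \<star> one A)"
    unfolding 2 using f A by (subst whisker_comp_right) (auto simp: comp_assoc)
  finally show ?thesis using f A by (simp add: tens_one)
qed

lemma dual_adjunction_left_2:
  assumes d: "dual X D c e" and g: "arr g" "dm g = A" "cd g = X @ B"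
  shows "(one X \<star> ((e \<star> one B) \<bullet> (one D \<star> g))) \<bullet> (c \<star> one A) = g"
proof -
  note [simp] = dualD[OF d]
  have A: "obj A" "obj B" using obj_dm[OF g(1)] obj_cd[OF g(1)] g by auto
  have 1: "one X \<star> ((e \<star> one B) \<bullet> (one D \<star> g)) = ((one X \<star> e) \<star> one B) \<bullet> (one (X @ D) \<star> g)"
    using g A by (simp add: whisker_comp_left tens_one tens_assoc[symmetric])
  have 2: "(one (X @ D) \<star> g) \<bullet> (c \<star> one A) = ((c \<star> one X) \<star> one B) \<bullet> g"
    using slide[of c g] g A by (simp add: tens_one tens_assoc)
  have "(one X \<star> ((e \<star> one B) \<bullet> (one D \<star> g))) \<bullet> (c \<star> one A)
     = ((one X \<star> e) \<star> one B) \<bullet> ((one (X @ D) \<star> g) \<bullet> (c \<star> one A))"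
    unfolding 1 using g A by (subst comp_assoc) auto
  also have "\<dots> = (((one X \<star> e) \<bullet> (c \<star> one X)) \<star> one B) \<bullet> g"
    unfolding 2 using g A by (subst whisker_comp_right) (auto simp: comp_assoc)
  finally show ?thesis using g A by (simp add: tens_one)
qed

text \<open>Naturality of the braiding at a cap: the strand X passes across it, because braiding
  with the unit is an identity. The next three lemmas are the mirror image and the two versions for
  cups.\<close>

lemma br_slide_right:
  assumes "arr e" "dm e = A @ B" "cd e = []" "obj X"
  shows "(e \<star> one X) \<bullet> (one A \<star> br X B) \<bullet> (br X A \<star> one B) = one X \<star> e"
  using assms br_natural[of "one X" e] obj_dm[OF assms(1)] by (simp add: br_append_right)

lemma br_slide_left:
  assumes "arr e" "dm e = A @ B" "cd e = []" "obj X"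
  shows "(one X \<star> e) \<bullet> (br A X \<star> one B) \<bullet> (one A \<star> br B X) = e \<star> one X"
  using assms br_natural[of e "one X"] obj_dm[OF assms(1)] by (simp add: br_append_left)

lemma br_coslide_right:
  assumes "arr c" "cd c = A @ B" "dm c = []" "obj X"
  shows "(one A \<star> br X B) \<bullet> (br X A \<star> one B) \<bullet> (one X \<star> c) = c \<star> one X"
  using assms br_natural[of "one X" c] obj_cd[OF assms(1)]
  by (simp add: br_append_right comp_assoc)

lemma br_coslide_left:
  assumes "arr c" "cd c = A @ B" "dm c = []" "obj X"
  shows "(br A X \<star> one B) \<bullet> (one A \<star> br B X) \<bullet> (c \<star> one X) = one X \<star> c"
  using assms br_natural[of c "one X"] obj_cd[OF assms(1)]
  by (simp add: br_append_left comp_assoc)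

text \<open>A strand that crosses itself once and is closed on one side straightens out: the
  crossings slide across the cup and a zigzag remains. This is the partial trace of a
  transposition.\<close>

lemma dual_dim_braid:
  assumes d: "dual X D c e"
  shows "(one X \<star> (e \<bullet> br X D)) \<bullet> (br X X \<star> one D) \<bullet> (one X \<star> c) = one X"
proof -
  note [simp] = dualD[OF d]
  have "(one X \<star> (e \<bullet> br X D)) \<bullet> (br X X \<star> one D) \<bullet> (one X \<star> c)
     = (one X \<star> e) \<bullet> ((one X \<star> br X D) \<bullet> (br X X \<star> one D) \<bullet> (one X \<star> c))"
    by (simp add: whisker_comp_left comp_assoc)
  also have "\<dots> = one X"
    by (subst br_coslide_right) auto
  finally show ?thesis .
qed

text \<open>Each zigzag of the braided pair reduces to the original zigzag on the same object.
  Sliding the cup across a strand costs a crossing of that object with itself, and sliding the cap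
  back removes it.\<close>

lemma dual_sym:
  assumes d: "dual X D c e"
  shows "dual D X (br X D \<bullet> c) (e \<bullet> br X D)"
proof -
  note [simp] = dualD[OF d]
  have n1: "br (X @ X) D \<bullet> (br X X \<star> one D) = (one D \<star> br X X) \<bullet> br (X @ X) D"
    using br_natural[of "br X X" "one D"] by simp
  have "(br X D \<star> one X) \<bullet> (one X \<star> br X D) \<bullet> (br X X \<star> one D) \<bullet> (one X \<star> br D X)
     = (br (X @ X) D \<bullet> (br X X \<star> one D)) \<bullet> (one X \<star> br D X)"
    by (simp add: br_append_left comp_assoc)
  also have "\<dots> = (one D \<star> br X X) \<bullet> (br X D \<star> one X) \<bullet> (one X \<star> br X D) \<bullet> (one X \<star> br D X)"
    unfolding n1 by (simp add: br_append_left comp_assoc)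
  also have "\<dots> = (one D \<star> br X X) \<bullet> (br X D \<star> one X)"
    by (simp add: interchange tens_one)
  finally have W1: "(br X D \<star> one X) \<bullet> (one X \<star> br X D) \<bullet> (br X X \<star> one D) \<bullet> (one X \<star> br D X)
     = (one D \<star> br X X) \<bullet> (br X D \<star> one X)" .
  have "((e \<bullet> br X D) \<star> one X) \<bullet> (one X \<star> (br X D \<bullet> c))
     = (e \<star> one X) \<bullet> (br X D \<star> one X) \<bullet> (one X \<star> br X D) \<bullet> (one X \<star> c)"
    by (simp add: whisker_comp_left whisker_comp_right comp_assoc)
  also have "\<dots> = (e \<star> one X) \<bullet> ((br X D \<star> one X) \<bullet> (one X \<star> br X D) \<bullet> (br X X \<star> one D) \<bullet> (one X \<star> br D X)) \<bullet> (c \<star> one X)"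
    using br_coslide_left[of c X D X] by (simp add: comp_assoc)
  also have "\<dots> = ((e \<star> one X) \<bullet> (one D \<star> br X X) \<bullet> (br X D \<star> one X)) \<bullet> (c \<star> one X)"
    unfolding W1 by (simp add: comp_assoc)
  also have "\<dots> = one X" by (subst br_slide_right) auto
  finally have z2: "((e \<bullet> br X D) \<star> one X) \<bullet> (one X \<star> (br X D \<bullet> c)) = one X" .
  have n2: "br X (D @ D) \<bullet> (one X \<star> br D D) = (br D D \<star> one X) \<bullet> br X (D @ D)"
    using br_natural[of "one X" "br D D"] by simp
  have "(one D \<star> br X D) \<bullet> (br X D \<star> one D) \<bullet> (one X \<star> br D D) \<bullet> (br D X \<star> one D)
     = (br X (D @ D) \<bullet> (one X \<star> br D D)) \<bullet> (br D X \<star> one D)"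
    by (simp add: br_append_right comp_assoc)
  also have "\<dots> = (br D D \<star> one X) \<bullet> (one D \<star> br X D) \<bullet> (br X D \<star> one D) \<bullet> (br D X \<star> one D)"
    unfolding n2 by (simp add: br_append_right comp_assoc)
  also have "\<dots> = (br D D \<star> one X) \<bullet> (one D \<star> br X D)"
    by (simp add: interchange tens_one)
  finally have W2: "(one D \<star> br X D) \<bullet> (br X D \<star> one D) \<bullet> (one X \<star> br D D) \<bullet> (br D X \<star> one D)
     = (br D D \<star> one X) \<bullet> (one D \<star> br X D)" .
  have "(one D \<star> (e \<bullet> br X D)) \<bullet> ((br X D \<bullet> c) \<star> one D)
     = (one D \<star> e) \<bullet> (one D \<star> br X D) \<bullet> (br X D \<star> one D) \<bullet> (c \<star> one D)"
    by (simp add: whisker_comp_left whisker_comp_right comp_assoc)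
  also have "\<dots> = (one D \<star> e) \<bullet> ((one D \<star> br X D) \<bullet> (br X D \<star> one D) \<bullet> (one X \<star> br D D) \<bullet> (br D X \<star> one D)) \<bullet> (one D \<star> c)"
    using br_coslide_right[of c X D D] by (simp add: comp_assoc)
  also have "\<dots> = ((one D \<star> e) \<bullet> (br D D \<star> one X) \<bullet> (one D \<star> br X D)) \<bullet> (one D \<star> c)"
    unfolding W2 by (simp add: comp_assoc)
  also have "\<dots> = one D" by (subst br_slide_left) auto
  finally have z1: "(one D \<star> (e \<bullet> br X D)) \<bullet> ((br X D \<bullet> c) \<star> one D) = one D" .
  show ?thesis unfolding dual_def using z1 z2 by auto
qed

text \<open>The arrow h is the transpose of f. The first equation trades f for h at a cup, the
  second at a cap.\<close>

lemma transpose_exists: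
  assumes d: "dual X D c e" and d': "dual Y D' c' e'"
    and f: "arr f" "dm f = X" "cd f = Y"
  obtains h where "arr h" "dm h = D'" "cd h = D"
    "(one Y \<star> h) \<bullet> c' = (f \<star> one D) \<bullet> c" "e \<bullet> (h \<star> one X) = e' \<bullet> (one D' \<star> f)"
proof
  note [simp] = dualD(1-8)[OF d] dualD(1-8)[OF d'] f
  let ?h = "(e' \<star> one D) \<bullet> (one D' \<star> ((f \<star> one D) \<bullet> c))"
  show "arr ?h" "dm ?h = D'" "cd ?h = D" by auto
  show "(one Y \<star> ?h) \<bullet> c' = (f \<star> one D) \<bullet> c"
    using dual_adjunction_left_2[OF d', of "(f \<star> one D) \<bullet> c" "[]" D] by simp
  have "?h = ((e' \<bullet> (one D' \<star> f)) \<star> one D) \<bullet> (one D' \<star> c)"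
    by (simp add: whisker_comp_right whisker_comp_left comp_assoc tens_assoc)
  then show "e \<bullet> (?h \<star> one X) = e' \<bullet> (one D' \<star> f)"
    using dual_adjunction_right_1[OF d, of "e' \<bullet> (one D' \<star> f)" D' "[]"] by simp
qed

text \<open>The arrow f travels around the loop as its transpose. The two dual pairs are unrelated,
  so f = g = \<open>one X\<close> also shows that the dimension does not depend on the dual; this is
  what allows duals to be treated as a relation.\<close>

lemma trace_cyclic:
  assumes d: "dual X D c e" and d': "dual Y D' c' e'"
    and f: "arr f" "dm f = X" "cd f = Y"
    and g: "arr g" "dm g = Y" "cd g = X"
  shows "e \<bullet> br X D \<bullet> ((g \<bullet> f) \<star> one D) \<bullet> c = e' \<bullet> br Y D' \<bullet> ((f \<bullet> g) \<star> one D') \<bullet> c'"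
proof -
  note [simp] = dualD(1-8)[OF d] dualD(1-8)[OF d'] f g
  obtain h where h [simp]: "arr h" "dm h = D'" "cd h = D"
    and h1: "(one Y \<star> h) \<bullet> c' = (f \<star> one D) \<bullet> c" and h2: "e \<bullet> (h \<star> one X) = e' \<bullet> (one D' \<star> f)"
    using transpose_exists[OF d d' f] by blast
  have "e \<bullet> br X D \<bullet> ((g \<bullet> f) \<star> one D) \<bullet> c = e \<bullet> br X D \<bullet> (g \<star> one D) \<bullet> ((f \<star> one D) \<bullet> c)"
    by (simp add: whisker_comp_right comp_assoc)
  also have "\<dots> = e \<bullet> (br X D \<bullet> ((g \<star> one D) \<bullet> (one Y \<star> h))) \<bullet> c'"
    unfolding h1[symmetric] by (simp add: comp_assoc)
  also have "br X D \<bullet> ((g \<star> one D) \<bullet> (one Y \<star> h)) = (h \<star> g) \<bullet> br Y D'"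
    using br_natural[of g h] slide(1)[of g h] by simp
  also have "h \<star> g = (h \<star> one X) \<bullet> (one D' \<star> g)" by (simp add: interchange)
  also have "e \<bullet> (((h \<star> one X) \<bullet> (one D' \<star> g)) \<bullet> br Y D') \<bullet> c'
     = (e \<bullet> (h \<star> one X)) \<bullet> (one D' \<star> g) \<bullet> br Y D' \<bullet> c'"
    by (simp add: comp_assoc)
  also have "\<dots> = e' \<bullet> ((one D' \<star> (f \<bullet> g)) \<bullet> br Y D') \<bullet> c'"
    unfolding h2 by (simp add: comp_assoc whisker_comp_left)
  also have "(one D' \<star> (f \<bullet> g)) \<bullet> br Y D' = br Y D' \<bullet> ((f \<bullet> g) \<star> one D')"
    using br_natural[of "f \<bullet> g" "one D'"] by simp
  finally show ?thesis by (simp add: comp_assoc)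
qed

text \<open>The dual of a product is the product of the duals in reverse order, with nested cups and
  nested caps. Once the inner cup has slid past the outer cap, the zigzags of W and V
  separate.\<close>

lemma dual_tensor:
  assumes d: "dual W D c e" and d': "dual V D' c' e'"
  shows "dual (W @ V) (D' @ D) ((one W \<star> c' \<star> one D) \<bullet> c) (e' \<bullet> (one D' \<star> e \<star> one V))"
    (is "dual _ _ ?c ?e")
proof -
  note [simp] = dualD(1-8)[OF d] dualD(1-8)[OF d']
  note zigzag = dualD(9,10)[OF d] dualD(9,10)[OF d']
  have m1: "(one (V @ D') \<star> e \<star> one V) \<bullet> (c' \<star> one (D @ W @ V)) = (c' \<star> one V) \<bullet> (e \<star> one V)"
    using slide[of c' "e \<star> one V"] by simp
  have c: "?c \<star> one (W @ V) = ((one W \<star> c' \<star> one D) \<star> one (W @ V)) \<bullet> (c \<star> one (W @ V))"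
    by (rule whisker_comp_right) auto
  have "(one (W @ V) \<star> ?e) \<bullet> (?c \<star> one (W @ V))
     = (one W \<star> (one V \<star> e')) \<bullet> (one W \<star> ((one (V @ D') \<star> e \<star> one V) \<bullet> (c' \<star> one (D @ W @ V))))
        \<bullet> ((c \<star> one W) \<star> one V)"
    unfolding c by (simp add: whisker_comp_left whisker_comp_right tens_one[symmetric] comp_assoc tens_assoc)
  also have "\<dots> = (one W \<star> ((one V \<star> e') \<bullet> (c' \<star> one V))) \<bullet> (((one W \<star> e) \<bullet> (c \<star> one W)) \<star> one V)"
    unfolding m1
    by (simp add: whisker_comp_left whisker_comp_right comp_assoc tens_assoc)
  also have "\<dots> = one (W @ V)" by (simp add: zigzag tens_one)
  finally have 1: "(one (W @ V) \<star> ?e) \<bullet> (?c \<star> one (W @ V)) = one (W @ V)" .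
  have m2: "(e \<star> one (V @ D' @ D)) \<bullet> (one (D @ W) \<star> c' \<star> one D) = (c' \<star> one D) \<bullet> (e \<star> one D)"
    using slide[of e "c' \<star> one D"] by simp
  have e: "?e \<star> one (D' @ D) = (e' \<star> one (D' @ D)) \<bullet> ((one D' \<star> e \<star> one V) \<star> one (D' @ D))"
    by (rule whisker_comp_right) auto
  have "(?e \<star> one (D' @ D)) \<bullet> (one (D' @ D) \<star> ?c)
     = ((e' \<star> one D') \<star> one D) \<bullet> (one D' \<star> ((e \<star> one (V @ D' @ D)) \<bullet> (one (D @ W) \<star> c' \<star> one D)))
        \<bullet> (one D' \<star> (one D \<star> c))"
    unfolding e by (simp add: whisker_comp_left whisker_comp_right tens_one[symmetric] comp_assoc tens_assoc)
  also have "\<dots> = (((e' \<star> one D') \<bullet> (one D' \<star> c')) \<star> one D) \<bullet> (one D' \<star> ((e \<star> one D) \<bullet> (one D \<star> c)))"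
    unfolding m2
    by (simp add: whisker_comp_left whisker_comp_right comp_assoc tens_assoc)
  also have "\<dots> = one (D' @ D)" by (simp add: zigzag tens_one)
  finally have 2: "(?e \<star> one (D' @ D)) \<bullet> (one (D' @ D) \<star> ?c) = one (D' @ D)" .
  show ?thesis unfolding dual_def using 1 2 by auto
qed

text \<open>The pairing that closes \<open>W @ V\<close> is a nested one: V is closed inside, then W
  outside. This makes the trace over a product computable in two stages.\<close>

lemma trace_pairing_tensor:
  assumes d: "dual W D c e" and d': "dual V D' c' e'"
  shows "(e' \<bullet> (one D' \<star> e \<star> one V)) \<bullet> br (W @ V) (D' @ D)
    = (e \<bullet> br W D) \<bullet> (one W \<star> (e' \<bullet> br V D') \<star> one D)"
proof -
  note [simp] = dualD(1-8)[OF d] dualD(1-8)[OF d']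
  define E where "E = e \<bullet> br W D"
  have E [simp]: "arr E" "dm E = W @ D" "cd E = []" by (auto simp: E_def)
  \<comment> \<open>The pairing of W is moved to the other side of the strand V; inserting a pair of
    inverse crossings brings in the configuration of \<open>br_slide_right\<close>.\<close>
  have s1: "(E \<star> one V) \<bullet> (one W \<star> br V D) = (one V \<star> E) \<bullet> (br W V \<star> one D)"
  proof -
    have "(E \<star> one V) \<bullet> (one W \<star> br V D)
       = (E \<star> one V) \<bullet> (one W \<star> br V D) \<bullet> ((br V W \<star> one D) \<bullet> (br W V \<star> one D))"
      by (simp add: interchange tens_one)
    also have "\<dots> = ((E \<star> one V) \<bullet> (one W \<star> br V D) \<bullet> (br V W \<star> one D)) \<bullet> (br W V \<star> one D)"
      by (simp add: comp_assoc)
    also have "\<dots> = (one V \<star> E) \<bullet> (br W V \<star> one D)"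
      by (subst br_slide_right) auto
    finally show ?thesis .
  qed
  have "(e' \<bullet> (one D' \<star> e \<star> one V)) \<bullet> br (W @ V) (D' @ D)
    = e' \<bullet> (one D' \<star> ((E \<star> one V) \<bullet> (one W \<star> br V D)))
        \<bullet> (((br W D' \<star> one V) \<bullet> (one W \<star> br V D')) \<star> one D)"
    by (simp add: E_def whisker_comp_left whisker_comp_right comp_assoc tens_assoc
      br_append_left br_append_right)
  also have "\<dots> = (e' \<bullet> (one (D' @ V) \<star> E)) \<bullet> (((one D' \<star> br W V) \<bullet> (br W D' \<star> one V) \<bullet> (one W \<star> br V D')) \<star> one D)"
    unfolding s1
    by (simp add: whisker_comp_left whisker_comp_right comp_assoc tens_assoc tens_one[symmetric])
  also have "e' \<bullet> (one (D' @ V) \<star> E) = E \<bullet> ((e' \<star> one W) \<star> one D)"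
    using slide[of e' E] by (simp add: tens_one tens_assoc)
  also have "(E \<bullet> ((e' \<star> one W) \<star> one D)) \<bullet> (((one D' \<star> br W V) \<bullet> (br W D' \<star> one V) \<bullet> (one W \<star> br V D')) \<star> one D)
    = E \<bullet> ((((e' \<star> one W) \<bullet> (one D' \<star> br W V) \<bullet> (br W D' \<star> one V)) \<bullet> (one W \<star> br V D')) \<star> one D)"
    by (simp add: whisker_comp_left whisker_comp_right comp_assoc)
  also have "(e' \<star> one W) \<bullet> (one D' \<star> br W V) \<bullet> (br W D' \<star> one V) = one W \<star> e'"
    by (rule br_slide_right) auto
  finally show ?thesis by (simp add: E_def interchange tens_assoc[symmetric])
qed

section \<open>Partial traces\<close>

definition ptr :: "'o list \<Rightarrow> 'o list \<Rightarrow> 'b \<Rightarrow> 'b \<Rightarrow> 'o list \<Rightarrow> 'o list \<Rightarrow> 'b \<Rightarrow> 'b" where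
  "ptr V D c e W W' f = (one W' \<star> (e \<bullet> br V D)) \<bullet> (f \<star> one D) \<bullet> (one W \<star> c)"

text \<open>Closing \<open>W @ V\<close> amounts to closing V first and W afterwards, so a trace
  over a tensor power can be peeled off one factor at a time.\<close>

lemma trace_tensor:
  assumes d: "dual W D c e" and d': "dual V D' c' e'"
    and f: "arr f" "dm f = W @ V" "cd f = W @ V"
  shows "(e' \<bullet> (one D' \<star> e \<star> one V)) \<bullet> br (W @ V) (D' @ D) \<bullet> (f \<star> one (D' @ D)) \<bullet> (one W \<star> c' \<star> one D) \<bullet> c
    = e \<bullet> br W D \<bullet> (ptr V D' c' e' W W f \<star> one D) \<bullet> c"
proof -
  note [simp] = dualD(1-8)[OF d] dualD(1-8)[OF d'] f
  have "(e' \<bullet> (one D' \<star> e \<star> one V)) \<bullet> br (W @ V) (D' @ D) \<bullet> (f \<star> one (D' @ D)) \<bullet> (one W \<star> c' \<star> one D) \<bullet> c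
    = ((e' \<bullet> (one D' \<star> e \<star> one V)) \<bullet> br (W @ V) (D' @ D)) \<bullet> (f \<star> one (D' @ D)) \<bullet> (one W \<star> c' \<star> one D) \<bullet> c"
    by (simp add: comp_assoc)
  also have "\<dots> = (e \<bullet> br W D) \<bullet> ((one W \<star> (e' \<bullet> br V D')) \<star> one D) \<bullet> ((f \<star> one D') \<star> one D) \<bullet> ((one W \<star> c') \<star> one D) \<bullet> c"
    unfolding trace_pairing_tensor[OF d d'] by (simp add: comp_assoc tens_assoc tens_one)
  also have "\<dots> = e \<bullet> br W D \<bullet> (ptr V D' c' e' W W f \<star> one D) \<bullet> c"
    by (simp add: ptr_def whisker_comp_right comp_assoc)
  finally show ?thesis .
qed

context
  fixes V D c e
  assumes d: "dual V D c e"
begin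

lemma arr_ptr [simp]:
  assumes "arr f" "dm f = W @ V" "cd f = W' @ V"
  shows "arr (ptr V D c e W W' f)" "dm (ptr V D c e W W' f) = W" "cd (ptr V D c e W W' f) = W'"
  using assms dualD(1-8)[OF d] obj_dm[OF assms(1)] obj_cd[OF assms(1)] by (auto simp: ptr_def)

lemma ptr_scal:
  assumes "arr f" "dm f = W @ V" "cd f = W' @ V"
  shows "ptr V D c e W W' (z \<ltimes> f) = z \<ltimes> ptr V D c e W W' f"
  using assms dualD(1-8)[OF d] obj_dm[OF assms(1)] obj_cd[OF assms(1)] by (auto simp: ptr_def)

lemma ptr_plus:
  assumes "arr f" "dm f = W @ V" "cd f = W' @ V" "arr g" "dm g = W @ V" "cd g = W' @ V"
  shows "ptr V D c e W W' (f \<uplus> g) = ptr V D c e W W' f \<uplus> ptr V D c e W W' g"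
  using assms dualD(1-8)[OF d] obj_dm[OF assms(1)] obj_cd[OF assms(1)]
  by (auto simp: ptr_def tens_plus_left comp_plus_left comp_plus_right)

text \<open>Only the strand V is closed, so arrows on the remaining factors slide out of the loop
  above and below.\<close>

lemma ptr_whisker:
  assumes f: "arr f" "dm f = W @ V" "cd f = W' @ V"
    and a: "arr a" "dm a = W'" "cd a = W''" and b: "arr b" "cd b = W" "dm b = U"
  shows "ptr V D c e U W'' ((a \<star> one V) \<bullet> f \<bullet> (b \<star> one V)) = a \<bullet> ptr V D c e W W' f \<bullet> b"
proof -
  note [simp] = dualD(1-8)[OF d]
  have [simp]: "obj W" "obj W'" "obj W''" "obj U"
    using obj_dm[OF f(1)] obj_cd[OF f(1)] obj_dm[OF a(1)] obj_cd[OF a(1)] obj_dm[OF b(1)] f a b by auto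
  have 1: "(b \<star> one (V @ D)) \<bullet> (one U \<star> c) = (one W \<star> c) \<bullet> b"
    using slide[of b c] b by simp
  have 2: "(one W'' \<star> (e \<bullet> br V D)) \<bullet> (a \<star> one (V @ D)) = a \<bullet> (one W' \<star> (e \<bullet> br V D))"
    using slide[of a "e \<bullet> br V D"] a by simp
  have "ptr V D c e U W'' ((a \<star> one V) \<bullet> f \<bullet> (b \<star> one V))
    = ((one W'' \<star> (e \<bullet> br V D)) \<bullet> (a \<star> one (V @ D))) \<bullet> (f \<star> one D) \<bullet> ((b \<star> one (V @ D)) \<bullet> (one U \<star> c))"
    using f a b by (simp add: ptr_def whisker_comp_right comp_assoc tens_assoc tens_one)
  then show ?thesis unfolding 1 2 using f a b by (simp add: ptr_def comp_assoc)
qed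

lemma ptr_one:
  assumes "e \<bullet> br V D \<bullet> c = z \<ltimes> one []" "obj W"
  shows "ptr V D c e W W (one (W @ V)) = z \<ltimes> one W"
proof -
  note [simp] = dualD(1-8)[OF d]
  have "ptr V D c e W W (one (W @ V)) = one W \<star> (e \<bullet> br V D \<bullet> c)"
    using assms(2) by (simp add: ptr_def tens_one whisker_comp_left comp_assoc)
  then show ?thesis using assms by simp
qed

lemma ptr_br:
  assumes "obj W"
  shows "ptr V D c e (W @ V) (W @ V) (one W \<star> br V V) = one (W @ V)"
proof -
  note [simp] = dualD(1-8)[OF d]
  have "ptr V D c e (W @ V) (W @ V) (one W \<star> br V V)
    = one W \<star> ((one V \<star> (e \<bullet> br V D)) \<bullet> (br V V \<star> one D) \<bullet> (one V \<star> c))"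
    using assms by (simp add: ptr_def whisker_comp_left tens_assoc tens_one[symmetric])
  then show ?thesis using assms by (simp add: dual_dim_braid[OF d] tens_one)
qed

end

lemma plus_swap4:
  assumes "arr f" "arr g" "arr h" "dm f = dm g" "cd f = cd g" "dm g = dm h" "cd g = cd h"
  shows "f \<uplus> (g \<uplus> h) = g \<uplus> (f \<uplus> h)"
  using assms by (metis arr_plus cd_plus dm_plus plus_assoc plus_commute)

text \<open>The recursion for the symmetrizers (\<open>\<epsilon> = 1\<close>) and antisymmetrizers (\<open>\<epsilon> = -1\<close>) comes from the
  decomposition of \<open>S\<^sub>n\<^sub>+\<^sub>1\<close> into the double cosets of \<open>1\<close> and a transposition \<open>s\<close> with respect to \<open>S\<^sub>n\<close>.
  The two step lemmas show that \<open>s\<close> acts on the new element by \<open>\<epsilon>\<close>; only the braid relation with the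
  last transposition \<open>t\<close> of \<open>S\<^sub>n\<close> is needed.\<close>

lemma symmetrizer_step_left:
  assumes t: "\<forall>f \<in> {s, t, P, E}. arr f \<and> dm f = X \<and> cd f = X"
    and ss: "s \<bullet> s = one X" and yb: "s \<bullet> t \<bullet> s = t \<bullet> s \<bullet> t" and Ps: "P \<bullet> s = s \<bullet> P"
    and E: "E = a \<ltimes> (P \<uplus> b \<ltimes> (P \<bullet> t \<bullet> P))" and PE: "P \<bullet> E = E" and tE: "t \<bullet> E = \<epsilon> \<ltimes> E"
    and ab: "a * b' = \<epsilon>" and \<epsilon>: "\<epsilon> * \<epsilon> = 1"
  shows "s \<bullet> (E \<uplus> b' \<ltimes> (E \<bullet> s \<bullet> E)) = \<epsilon> \<ltimes> (E \<uplus> b' \<ltimes> (E \<bullet> s \<bullet> E))"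
proof -
  have [simp]: "arr s" "dm s = X" "cd s = X" "arr t" "dm t = X" "cd t = X"
    "arr P" "dm P = X" "cd P = X" "arr E" "dm E = X" "cd E = X" using t by auto
  have [simp]: "obj X" using obj_dm[of s] by simp
  have 1: "s \<bullet> P \<bullet> s \<bullet> E = E"
  proof -
    have "s \<bullet> P \<bullet> s \<bullet> E = (s \<bullet> s) \<bullet> P \<bullet> E" using Ps by (metis comp_assoc \<open>arr s\<close> \<open>arr P\<close> \<open>arr E\<close>
      \<open>dm s = X\<close> \<open>cd s = X\<close> \<open>dm P = X\<close> \<open>cd P = X\<close> \<open>cd E = X\<close> arr_comp cd_comp dm_comp)
    then show ?thesis by (simp add: ss PE)
  qed
  have Ps': "P \<bullet> s \<bullet> f = s \<bullet> P \<bullet> f" if "arr f" "cd f = X" for f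
    using comp_cong_assoc[OF Ps, of f] that by (simp add: comp_assoc)
  have 2: "s \<bullet> P \<bullet> t \<bullet> P \<bullet> s \<bullet> E = \<epsilon> \<ltimes> (P \<bullet> t \<bullet> s \<bullet> E)"
  proof -
    have "s \<bullet> P \<bullet> t \<bullet> P \<bullet> s \<bullet> E = P \<bullet> (s \<bullet> t \<bullet> s) \<bullet> E"
      by (simp add: Ps' PE comp_assoc)
    also have "\<dots> = \<epsilon> \<ltimes> (P \<bullet> t \<bullet> s \<bullet> E)" unfolding yb by (simp add: comp_assoc tE)
    finally show ?thesis .
  qed
  have x: "E \<bullet> s \<bullet> E = a \<ltimes> (s \<bullet> E \<uplus> b \<ltimes> (P \<bullet> t \<bullet> s \<bullet> E))"
    by (subst (1) E) (simp add: comp_plus_left comp_assoc Ps' PE)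
  have y: "s \<bullet> E \<bullet> s \<bullet> E = a \<ltimes> (E \<uplus> (b * \<epsilon>) \<ltimes> (P \<bullet> t \<bullet> s \<bullet> E))"
    by (subst (1) E) (simp add: comp_plus_left comp_plus_right comp_assoc 1 2)
  have \<epsilon>': "\<epsilon> * (\<epsilon> * x) = x" for x using \<epsilon> by (simp add: mult.assoc[symmetric])
  have c: "b' * a = \<epsilon>" "\<epsilon> * (b' * a) = 1" using ab \<epsilon> by (auto simp: mult.commute)
  have "s \<bullet> (E \<uplus> b' \<ltimes> (E \<bullet> s \<bullet> E)) = s \<bullet> E \<uplus> (\<epsilon> \<ltimes> E \<uplus> b \<ltimes> (P \<bullet> t \<bullet> s \<bullet> E))"
    using \<epsilon> by (simp add: comp_plus_right y c scal_plus mult.assoc[symmetric])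
      (simp add: mult.commute mult.left_commute \<epsilon>')
  also have "\<dots> = \<epsilon> \<ltimes> (E \<uplus> b' \<ltimes> (E \<bullet> s \<bullet> E))"
    by (subst plus_swap4) (auto simp: x scal_plus c mult.assoc[symmetric] c[unfolded mult.assoc[symmetric]] \<epsilon>)
  finally show ?thesis .
qed

lemma symmetrizer_step_right:
  assumes t: "\<forall>f \<in> {s, t, P, E}. arr f \<and> dm f = X \<and> cd f = X"
    and ss: "s \<bullet> s = one X" and yb: "s \<bullet> t \<bullet> s = t \<bullet> s \<bullet> t" and Ps: "P \<bullet> s = s \<bullet> P"
    and E: "E = a \<ltimes> (P \<uplus> b \<ltimes> (P \<bullet> t \<bullet> P))" and EP: "E \<bullet> P = E" and Et: "E \<bullet> t = \<epsilon> \<ltimes> E"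
    and ab: "a * b' = \<epsilon>" and \<epsilon>: "\<epsilon> * \<epsilon> = 1"
  shows "(E \<uplus> b' \<ltimes> (E \<bullet> s \<bullet> E)) \<bullet> s = \<epsilon> \<ltimes> (E \<uplus> b' \<ltimes> (E \<bullet> s \<bullet> E))"
proof -
  have [simp]: "arr s" "dm s = X" "cd s = X" "arr t" "dm t = X" "cd t = X"
    "arr P" "dm P = X" "cd P = X" "arr E" "dm E = X" "cd E = X" using t by auto
  have [simp]: "obj X" using obj_dm[of s] by simp
  have sP': "s \<bullet> P \<bullet> f = P \<bullet> s \<bullet> f" if "arr f" "cd f = X" for f
    using comp_cong_assoc[OF Ps, of f] that by (simp add: comp_assoc)
  have EP': "E \<bullet> P \<bullet> f = E \<bullet> f" if "arr f" "cd f = X" for f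
    using comp_cong_assoc[OF EP, of f] that by simp
  have 1: "E \<bullet> s \<bullet> P \<bullet> s = E"
    by (simp add: sP' EP' ss EP)
  have 2: "E \<bullet> s \<bullet> P \<bullet> t \<bullet> P \<bullet> s = \<epsilon> \<ltimes> (E \<bullet> s \<bullet> t \<bullet> P)"
  proof -
    have "E \<bullet> s \<bullet> P \<bullet> t \<bullet> P \<bullet> s = E \<bullet> (s \<bullet> t \<bullet> s) \<bullet> P"
      by (simp add: sP' EP' comp_assoc Ps)
    also have "\<dots> = (E \<bullet> t) \<bullet> s \<bullet> t \<bullet> P" unfolding yb by (simp add: comp_assoc)
    finally show ?thesis unfolding Et by simp
  qed
  have x: "E \<bullet> s \<bullet> E = a \<ltimes> (E \<bullet> s \<uplus> b \<ltimes> (E \<bullet> s \<bullet> t \<bullet> P))"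
    by (subst (2) E) (simp add: comp_plus_right sP' EP' Ps[symmetric])
  have y: "E \<bullet> s \<bullet> E \<bullet> s = a \<ltimes> (E \<uplus> (b * \<epsilon>) \<ltimes> (E \<bullet> s \<bullet> t \<bullet> P))"
    by (subst (2) E) (simp add: comp_plus_right comp_plus_left comp_assoc 1 2)
  have \<epsilon>': "\<epsilon> * (\<epsilon> * x) = x" for x using \<epsilon> by (simp add: mult.assoc[symmetric])
  have c: "b' * a = \<epsilon>" "\<epsilon> * (b' * a) = 1" using ab \<epsilon> by (auto simp: mult.commute)
  have "(E \<uplus> b' \<ltimes> (E \<bullet> s \<bullet> E)) \<bullet> s = E \<bullet> s \<uplus> (\<epsilon> \<ltimes> E \<uplus> b \<ltimes> (E \<bullet> s \<bullet> t \<bullet> P))"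
    using \<epsilon> by (simp add: comp_plus_left comp_assoc y c scal_plus mult.assoc[symmetric])
      (simp add: mult.commute mult.left_commute \<epsilon>')
  also have "\<dots> = \<epsilon> \<ltimes> (E \<uplus> b' \<ltimes> (E \<bullet> s \<bullet> E))"
    by (subst plus_swap4) (auto simp: x scal_plus c mult.assoc[symmetric] c[unfolded mult.assoc[symmetric]] \<epsilon>)
  finally show ?thesis .
qed

section \<open>Symmetrizers on tensor powers\<close>

primrec tpow :: "'o list \<Rightarrow> nat \<Rightarrow> 'o list" where
  "tpow V 0 = []"
| "tpow V (Suc n) = tpow V n @ V"

lemma obj_tpow [simp]: "obj V \<Longrightarrow> obj (tpow V n)"
  by (induction n) auto

text \<open>The weights 1 / (n + 2) and (n + 1) / (n + 2) are the proportions of the two double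
  cosets of S_(n+1) in S_(n+2); the nontrivial one has (n + 1) (n + 1)! elements. The average over
  all permutations, with signs if \<epsilon> = -1, thus arises without constructing an action of the
  symmetric group. One factor is a separate case since the recursion transposes two.\<close>

fun symmetrizer :: "complex \<Rightarrow> 'o list \<Rightarrow> nat \<Rightarrow> 'b" where
  "symmetrizer \<epsilon> V 0 = one []"
| "symmetrizer \<epsilon> V (Suc 0) = one V"
| "symmetrizer \<epsilon> V (Suc (Suc n)) = (1 / of_nat (n + 2)) \<ltimes>
     ((symmetrizer \<epsilon> V (Suc n) \<star> one V) \<uplus> (\<epsilon> * of_nat (n + 1)) \<ltimes>
       ((symmetrizer \<epsilon> V (Suc n) \<star> one V) \<bullet> (one (tpow V n) \<star> br V V) \<bullet> (symmetrizer \<epsilon> V (Suc n) \<star> one V)))"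

lemma symmetrizer_typing [simp]:
  assumes "obj V"
  shows "arr (symmetrizer \<epsilon> V n)" "dm (symmetrizer \<epsilon> V n) = tpow V n" "cd (symmetrizer \<epsilon> V n) = tpow V n"
proof -
  have "arr (symmetrizer \<epsilon> V n) \<and> dm (symmetrizer \<epsilon> V n) = tpow V n \<and> cd (symmetrizer \<epsilon> V n) = tpow V n"
    using assms by (induction \<epsilon> V n rule: symmetrizer.induct) auto
  then show "arr (symmetrizer \<epsilon> V n)" "dm (symmetrizer \<epsilon> V n) = tpow V n" "cd (symmetrizer \<epsilon> V n) = tpow V n"
    by auto
qed

text \<open>The claims support one another. The eigenvalue of the last transposition and the
  absorption of the smaller symmetrizer give idempotence on the same number of factors; idempotence
  gives absorption on one more factor; and the step lemmas then supply the eigenvalue there.\<close>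

lemma symmetrizer_props:
  assumes V: "obj V" and \<epsilon>: "\<epsilon> * \<epsilon> = 1"
  defines "A \<equiv> symmetrizer \<epsilon> V" and "s \<equiv> \<lambda>n. one (tpow V n) \<star> br V V"
  shows "A (Suc n) \<bullet> A (Suc n) = A (Suc n) \<and>
    s n \<bullet> A (Suc (Suc n)) = \<epsilon> \<ltimes> A (Suc (Suc n)) \<and> A (Suc (Suc n)) \<bullet> s n = \<epsilon> \<ltimes> A (Suc (Suc n)) \<and>
    (A (Suc n) \<star> one V) \<bullet> A (Suc (Suc n)) = A (Suc (Suc n)) \<and>
    A (Suc (Suc n)) \<bullet> (A (Suc n) \<star> one V) = A (Suc (Suc n))"
proof (induction n)
  have [simp]: "arr (A n)" "dm (A n) = tpow V n" "cd (A n) = tpow V n" for n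
    using V by (auto simp: A_def)
  have [simp]: "arr (s n)" "dm (s n) = tpow V n @ V @ V" "cd (s n) = tpow V n @ V @ V" for n
    using V by (auto simp: s_def)
  note [simp] = V
  have ss: "s n \<bullet> s n = one (tpow V n @ V @ V)" for n
    by (simp add: s_def interchange tens_one)
  have A2: "A (Suc (Suc n)) = (1 / of_nat (n + 2)) \<ltimes> ((A (Suc n) \<star> one V) \<uplus> (\<epsilon> * of_nat (n + 1)) \<ltimes>
     ((A (Suc n) \<star> one V) \<bullet> s n \<bullet> (A (Suc n) \<star> one V)))" for n
    by (simp add: A_def s_def)
  have absorb: "(A (Suc n) \<star> one V) \<bullet> A (Suc (Suc n)) = A (Suc (Suc n)) \<and>
      A (Suc (Suc n)) \<bullet> (A (Suc n) \<star> one V) = A (Suc (Suc n))"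
    if "A (Suc n) \<bullet> A (Suc n) = A (Suc n)" for n
  proof -
    have EE: "(A (Suc n) \<star> one V) \<bullet> (A (Suc n) \<star> one V) = A (Suc n) \<star> one V"
      using that by (simp add: interchange)
    show ?thesis unfolding A2
      by (simp add: comp_plus_left comp_plus_right comp_assoc EE comp_cong_assoc[OF EE])
  qed
  {
    case 0
    have A: "A (Suc 0) = one V" by (simp add: A_def)
    have 1: "s 0 \<bullet> A (Suc (Suc 0)) = \<epsilon> \<ltimes> A (Suc (Suc 0)) \<and> A (Suc (Suc 0)) \<bullet> s 0 = \<epsilon> \<ltimes> A (Suc (Suc 0))"
      unfolding A2 using ss[of 0] \<epsilon>
      by (simp add: A tens_one comp_plus_left comp_plus_right scal_plus plus_commute mult.left_commute)
    show ?case using 1 absorb[of 0] by (simp add: A)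
  next
    case (Suc n)
    \<comment> \<open>In the step lemmas' notation: \<open>?P\<close> and \<open>?E\<close> are the
      two preceding symmetrizers extended by identities, \<open>?t\<close> is the last transposition
      of the smaller group, and \<open>s (Suc n)\<close> is the new one, disjoint from
      \<open>?P\<close>.\<close>
    let ?E = "A (Suc (Suc n)) \<star> one V" and ?P = "A (Suc n) \<star> one (V @ V)"
    let ?t = "s n \<star> one V"
    have z: "of_nat n + 2 \<noteq> (0::complex)" "of_nat n + 3 \<noteq> (0::complex)"
      by (metis add_2_eq_Suc' of_nat_eq_0_iff of_nat_add of_nat_numeral nat.distinct(1))
         (metis add_is_0 of_nat_eq_0_iff of_nat_add of_nat_numeral zero_neq_numeral)
    have ty: "\<forall>f \<in> {s (Suc n), ?t, ?P, ?E}. arr f \<and> dm f = tpow V n @ V @ V @ V \<and> cd f = tpow V n @ V @ V @ V"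
      by simp
    have yb: "s (Suc n) \<bullet> ?t \<bullet> s (Suc n) = ?t \<bullet> s (Suc n) \<bullet> ?t"
    proof -
      have "one (tpow V n) \<star> ((one V \<star> br V V) \<bullet> (br V V \<star> one V) \<bullet> (one V \<star> br V V))
       = one (tpow V n) \<star> ((br V V \<star> one V) \<bullet> (one V \<star> br V V) \<bullet> (br V V \<star> one V))"
        using braid_relation[of V] by simp
      then show ?thesis
        by (simp add: s_def whisker_comp_left tens_assoc tens_one[symmetric])
    qed
    have Ps: "?P \<bullet> s (Suc n) = s (Suc n) \<bullet> ?P"
      using slide[of "A (Suc n)" "br V V"] by (simp add: s_def)
    have E: "?E = (1 / of_nat (n + 2)) \<ltimes> (?P \<uplus> (\<epsilon> * of_nat (n + 1)) \<ltimes> (?P \<bullet> ?t \<bullet> ?P))"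
      by (subst A2) (simp add: tens_plus_left whisker_comp_right tens_assoc tens_one)
    have PE: "?P \<bullet> ?E = ?E" "?E \<bullet> ?P = ?E"
    proof -
      have "?P = (A (Suc n) \<star> one V) \<star> one V" by (simp add: tens_assoc tens_one)
      then show "?P \<bullet> ?E = ?E" "?E \<bullet> ?P = ?E" using Suc by (simp_all add: interchange)
    qed
    have tE: "?t \<bullet> ?E = \<epsilon> \<ltimes> ?E" "?E \<bullet> ?t = \<epsilon> \<ltimes> ?E"
      using Suc by (simp_all add: interchange)
    have ab: "(1 / of_nat (n + 2)) * (\<epsilon> * of_nat (Suc n + 1)) = \<epsilon>" using z by (simp add: field_simps)
    have sA: "s (Suc n) \<bullet> A (Suc (Suc (Suc n))) = \<epsilon> \<ltimes> A (Suc (Suc (Suc n)))"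
      using symmetrizer_step_left[OF ty ss[of "Suc n", simplified, folded tpow.simps] yb Ps E PE(1) tE(1) ab \<epsilon>]
      unfolding A2[of "Suc n"] by (simp add: mult.commute)
    have As: "A (Suc (Suc (Suc n))) \<bullet> s (Suc n) = \<epsilon> \<ltimes> A (Suc (Suc (Suc n)))"
      using symmetrizer_step_right[OF ty ss[of "Suc n", simplified] yb Ps E PE(2) tE(2) ab \<epsilon>]
      unfolding A2[of "Suc n"] by (simp add: mult.commute)
    have AA: "A (Suc (Suc n)) \<bullet> A (Suc (Suc n)) = A (Suc (Suc n))"
    proof -
      let ?A = "A (Suc (Suc n))" and ?F = "A (Suc n) \<star> one V"
      have 1: "?A \<bullet> s n \<bullet> ?F = \<epsilon> \<ltimes> ?A"
        using comp_cong_assoc[of ?A "s n" "\<epsilon> \<ltimes> ?A" ?F] Suc by simp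
      \<comment> \<open>With the right-hand factor expanded, both summands become multiples of
        \<open>?A\<close>, with coefficients 1 and \<epsilon>^2 (n + 1) = n + 1; their sum cancels
        the denominator n + 2.\<close>
      have "?A \<bullet> ?A = (1 / of_nat (n + 2)) \<ltimes> (?A \<uplus> (\<epsilon> * of_nat (n + 1)) \<ltimes> (\<epsilon> \<ltimes> ?A))"
        apply (subst (2) A2)
        using Suc 1 comp_cong_assoc[of ?A ?F ?A "s n \<bullet> ?F"]
        by (simp add: comp_plus_right del: scal_scal)
      also have "\<dots> = (1 / of_nat (n + 2)) \<ltimes> ((1 \<ltimes> ?A) \<uplus> (of_nat (n + 1) \<ltimes> ?A))"
        using \<epsilon> by (simp add: mult.assoc[symmetric] mult.commute mult.left_commute)
      also have "\<dots> = ?A"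
        using z unfolding scal_add[OF \<open>\<And>n. arr (A n)\<close>, symmetric] by (simp add: add.commute)
      finally show ?thesis .
    qed
    show ?case using AA sA As absorb[OF AA] by simp
  }
qed

lemma symmetrizer_idem:
  assumes "obj V" "\<epsilon> * \<epsilon> = 1"
  shows "symmetrizer \<epsilon> V n \<bullet> symmetrizer \<epsilon> V n = symmetrizer \<epsilon> V n"
  using symmetrizer_props[OF assms] by (cases n) auto

text \<open>Of the two summands in the recursion, the first closes a free loop and contributes z
  times the smaller symmetrizer. The second contains a single transposition of the last two factors,
  whose partial trace is an identity, and leaves the square of that idempotent.\<close>

lemma ptr_symmetrizer:
  assumes d: "dual V D c e" and z: "e \<bullet> br V D \<bullet> c = z \<ltimes> one []" and \<epsilon>: "\<epsilon> * \<epsilon> = 1"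
  shows "ptr V D c e (tpow V n) (tpow V n) (symmetrizer \<epsilon> V (Suc n))
    = ((z + \<epsilon> * of_nat n) / of_nat (Suc n)) \<ltimes> symmetrizer \<epsilon> V n"
proof (cases n)
  case 0
  then show ?thesis using ptr_one[OF d z, of "[]"] by simp
next
  case (Suc m)
  have V [simp]: "obj V" by (rule dualD(1)[OF d])
  note [simp] = arr_ptr[OF d]
  let ?A = "symmetrizer \<epsilon> V (Suc m)" and ?s = "one (tpow V m) \<star> br V V"
  let ?W = "tpow V (Suc m)"
  have 1: "ptr V D c e ?W ?W (?A \<star> one V) = z \<ltimes> ?A"
    using ptr_whisker[OF d, of "one (?W @ V)" ?W ?W ?A ?W "one ?W" ?W] ptr_one[OF d z, of ?W]
    by (simp add: tens_one)
  have 2: "ptr V D c e ?W ?W ((?A \<star> one V) \<bullet> ?s \<bullet> (?A \<star> one V)) = ?A"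
    using ptr_whisker[OF d, of ?s ?W ?W ?A ?W ?A ?W] ptr_br[OF d, of "tpow V m"]
      symmetrizer_idem[OF V \<epsilon>, of "Suc m"] by simp
  have "ptr V D c e ?W ?W (symmetrizer \<epsilon> V (Suc (Suc m)))
     = (1 / of_nat (m + 2)) \<ltimes> ((z \<ltimes> ?A) \<uplus> (\<epsilon> * of_nat (m + 1)) \<ltimes> ?A)"
    using 1 2 by (simp add: ptr_scal[OF d] ptr_plus[OF d])
  also have "\<dots> = ((z + \<epsilon> * of_nat (Suc m)) / of_nat (Suc (Suc m))) \<ltimes> ?A"
    by (simp add: scal_add[symmetric] add.commute)
  finally show ?thesis unfolding Suc .
qed

lemma dual_Nil: "dual [] [] (one []) (one [])"
  by (simp add: dual_def)

text \<open>The partial trace is iterated until no factor is left, which multiplies the scalars. The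
  dual of the tensor power is built along the way by \<open>dual_tensor\<close>.\<close>

lemma trace_symmetrizer:
  assumes d: "dual V D c e" and z: "e \<bullet> br V D \<bullet> c = z \<ltimes> one []" and \<epsilon>: "\<epsilon> * \<epsilon> = 1"
  shows "\<exists>D' c' e'. dual (tpow V n) D' c' e' \<and>
    e' \<bullet> br (tpow V n) D' \<bullet> (symmetrizer \<epsilon> V n \<star> one D') \<bullet> c'
      = (\<Prod>k<n. (z + \<epsilon> * of_nat k) / of_nat (Suc k)) \<ltimes> one []"
proof (induction n)
  case 0
  show ?case using dual_Nil by (intro exI[of _ "[]"] exI[of _ "one []"]) auto
next
  case (Suc n)
  have V [simp]: "obj V" by (rule dualD(1)[OF d])
  obtain D' c' e' where d': "dual (tpow V n) D' c' e'" and
    t: "e' \<bullet> br (tpow V n) D' \<bullet> (symmetrizer \<epsilon> V n \<star> one D') \<bullet> c'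
      = (\<Prod>k<n. (z + \<epsilon> * of_nat k) / of_nat (Suc k)) \<ltimes> one []"
    using Suc by blast
  note [simp] = dualD(1-8)[OF d] dualD(1-8)[OF d']
  show ?case
    apply (intro exI conjI)
    using dual_tensor[OF d' d] dualD[OF d] apply simp
    using trace_tensor[OF d' d, of "symmetrizer \<epsilon> V (Suc n)"] ptr_symmetrizer[OF d z \<epsilon>, of n] t
    by (simp add: comp_assoc mult.commute)
qed

section \<open>Dimensions in a strict category\<close>

definition has_dim :: "'o list \<Rightarrow> complex \<Rightarrow> bool" where
  "has_dim X z \<longleftrightarrow> (\<exists>D c e. dual X D c e \<and> e \<bullet> br X D \<bullet> c = z \<ltimes> one [])"

lemma has_dimI: "dual X D c e \<Longrightarrow> e \<bullet> br X D \<bullet> c = z \<ltimes> one [] \<Longrightarrow> has_dim X z"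
  by (auto simp: has_dim_def)

text \<open>The identity of Y is \<open>p \<bullet> i\<close>, and cyclicity replaces its trace by
  that of the idempotent \<open>i \<bullet> p\<close> on X.\<close>

lemma has_dim_retract:
  assumes X: "dual X D c e" "e \<bullet> br X D \<bullet> ((i \<bullet> p) \<star> one D) \<bullet> c = z \<ltimes> one []"
    and Y: "dual Y D' c' e'" and i: "arr i" "dm i = Y" "cd i = X" and p: "arr p" "dm p = X" "cd p = Y"
    and pi: "p \<bullet> i = one Y"
  shows "has_dim Y z"
  using trace_cyclic[OF X(1) Y p i] X(2) dualD(1-8)[OF Y] pi by (intro has_dimI[OF Y]) (simp add: tens_one)

text \<open>The conclusion compares multiples of the unit arrow, not scalars, because nothing in the
  locale makes z \<mapsto> \<open>z \<ltimes> one []\<close> injective. In the application this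
  comes from the assumption on the endomorphisms of the unit.\<close>

lemma has_dim_unique:
  assumes "has_dim X z" "has_dim X w" shows "z \<ltimes> one [] = w \<ltimes> one []"
proof -
  obtain D c e D' c' e' where d: "dual X D c e" "e \<bullet> br X D \<bullet> c = z \<ltimes> one []"
    "dual X D' c' e'" "e' \<bullet> br X D' \<bullet> c' = w \<ltimes> one []" using assms by (auto simp: has_dim_def)
  then show ?thesis using trace_cyclic[OF d(1,3), of "one X" "one X"] dualD(1-8)[OF d(1)] dualD(1-8)[OF d(3)]
    by (simp add: tens_one)
qed

section \<open>Kernels and cokernels under the tensor product\<close>

definition monic :: "'b \<Rightarrow> bool" where
  "monic k \<longleftrightarrow> arr k \<and> (\<forall>g h. arr g \<longrightarrow> arr h \<longrightarrow> cd g = dm k \<longrightarrow> cd h = dm k \<longrightarrow> dm g = dm h \<longrightarrow>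
     k \<bullet> g = k \<bullet> h \<longrightarrow> g = h)"

definition epic :: "'b \<Rightarrow> bool" where
  "epic k \<longleftrightarrow> arr k \<and> (\<forall>g h. arr g \<longrightarrow> arr h \<longrightarrow> dm g = cd k \<longrightarrow> dm h = cd k \<longrightarrow> cd g = cd h \<longrightarrow>
     g \<bullet> k = h \<bullet> k \<longrightarrow> g = h)"

text \<open>The universal property is split into existence of a factorization and
  \<open>monic\<close>, so that uniqueness is available as plain cancellation.\<close>

definition kernel :: "'b \<Rightarrow> 'b \<Rightarrow> bool" where
  "kernel f k \<longleftrightarrow> arr f \<and> monic k \<and> cd k = dm f \<and> f \<bullet> k = nul (dm k) (cd f) \<and>
     (\<forall>g. arr g \<longrightarrow> cd g = dm f \<longrightarrow> f \<bullet> g = nul (dm g) (cd f) \<longrightarrow>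
       (\<exists>u. arr u \<and> dm u = dm g \<and> cd u = dm k \<and> k \<bullet> u = g))"

definition cokernel :: "'b \<Rightarrow> 'b \<Rightarrow> bool" where
  "cokernel f q \<longleftrightarrow> arr f \<and> epic q \<and> dm q = cd f \<and> q \<bullet> f = nul (dm f) (cd q) \<and>
     (\<forall>g. arr g \<longrightarrow> dm g = cd f \<longrightarrow> g \<bullet> f = nul (dm f) (cd g) \<longrightarrow>
       (\<exists>u. arr u \<and> dm u = cd q \<and> cd u = cd g \<and> u \<bullet> q = g))"

lemma kernelD:
  assumes "kernel f k" shows "arr f" "arr k" "monic k" "cd k = dm f" "f \<bullet> k = nul (dm k) (cd f)"
  using assms by (auto simp: kernel_def monic_def)

lemma cokernelD:
  assumes "cokernel f q" shows "arr f" "arr q" "epic q" "dm q = cd f" "q \<bullet> f = nul (dm f) (cd q)"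
  using assms by (auto simp: cokernel_def epic_def)

lemma monicD: "monic k \<Longrightarrow> k \<bullet> g = k \<bullet> h \<Longrightarrow> arr g \<Longrightarrow> arr h \<Longrightarrow> cd g = dm k \<Longrightarrow> cd h = dm k \<Longrightarrow> dm g = dm h \<Longrightarrow> g = h"
  by (auto simp: monic_def)

lemma epicD: "epic k \<Longrightarrow> g \<bullet> k = h \<bullet> k \<Longrightarrow> arr g \<Longrightarrow> arr h \<Longrightarrow> dm g = cd k \<Longrightarrow> dm h = cd k \<Longrightarrow> cd g = cd h \<Longrightarrow> g = h"
  by (auto simp: epic_def)

lemma kernel_factor:
  assumes "kernel f k" "arr g" "cd g = dm f" "f \<bullet> g = nul (dm g) (cd f)"
  obtains u where "arr u" "dm u = dm g" "cd u = dm k" "k \<bullet> u = g"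
  using assms by (auto simp: kernel_def)

lemma cokernel_factor:
  assumes "cokernel f q" "arr g" "dm g = cd f" "g \<bullet> f = nul (dm f) (cd g)"
  obtains u where "arr u" "dm u = cd q" "cd u = cd g" "u \<bullet> q = g"
  using assms by (auto simp: cokernel_def)

text \<open>\<open>- \<star> D\<close> is a right adjoint and therefore preserves kernels.
  \<open>?\<Psi>\<close> is the adjunction map, and \<open>\<Psi>\<close> is its naturality in the
  target.\<close>

lemma kernel_tens_dual:
  assumes d: "dual X D c e" and k: "kernel q i"
  shows "kernel (q \<star> one D) (i \<star> one D)"
proof -
  note [simp] = dualD(1-8)[OF d] kernelD[OF k]
  let ?\<Psi> = "\<lambda>B g. (one B \<star> e) \<bullet> (g \<star> one X)"
  have \<Psi>: "?\<Psi> (cd f) ((f \<star> one D) \<bullet> g) = f \<bullet> ?\<Psi> (dm f) g"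
    if "arr f" "arr g" "cd g = dm f @ D" for f g
  proof -
    have "(one (cd f) \<star> e) \<bullet> (f \<star> one (D @ X)) = f \<bullet> (one (dm f) \<star> e)"
      using slide[of f e] that by simp
    from comp_cong_assoc[OF this, of "g \<star> one X"] that show ?thesis
      by (simp add: whisker_comp_right tens_assoc comp_assoc tens_one)
  qed
  show ?thesis unfolding kernel_def monic_def
  proof (intro conjI allI impI)
    fix g h assume gh: "arr g" "arr h" "cd g = dm (i \<star> one D)" "cd h = dm (i \<star> one D)" "dm g = dm h"
      "(i \<star> one D) \<bullet> g = (i \<star> one D) \<bullet> h"
    then have "i \<bullet> ?\<Psi> (dm i) g = i \<bullet> ?\<Psi> (dm i) h"
      using \<Psi>[of i g] \<Psi>[of i h] by simp
    then have "?\<Psi> (dm i) g = ?\<Psi> (dm i) h"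
      by (rule monicD[rotated]) (use gh in auto)
    then show "g = h" using dual_adjunction_right_2[OF d gh(1) refl, of "dm i"] dual_adjunction_right_2[OF d gh(2) refl, of "dm i"] gh(3-5)
      by (metis cd_one cd_tens dm_one dm_tens)
  next
    fix g assume g: "arr g" "cd g = dm (q \<star> one D)" "(q \<star> one D) \<bullet> g = nul (dm g) (cd (q \<star> one D))"
    then have "q \<bullet> ?\<Psi> (dm q) g = nul (dm g @ X) (cd q)"
      using \<Psi>[of q g] by simp
    then obtain w where w: "arr w" "dm w = dm g @ X" "cd w = dm i" "i \<bullet> w = ?\<Psi> (dm q) g"
      using kernel_factor[OF k, of "?\<Psi> (dm q) g"] g by auto
    have "g = ((i \<bullet> w) \<star> one D) \<bullet> (one (dm g) \<star> c)"
      using dual_adjunction_right_2[OF d, of g "dm g" "dm q"] g w by simp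
    also have "\<dots> = (i \<star> one D) \<bullet> ((w \<star> one D) \<bullet> (one (dm g) \<star> c))"
      using g w(1-3) by (simp add: whisker_comp_right comp_assoc)
    finally show "\<exists>u. arr u \<and> dm u = dm g \<and> cd u = dm (i \<star> one D) \<and> (i \<star> one D) \<bullet> u = g"
      using g w by (intro exI[of _ "(w \<star> one D) \<bullet> (one (dm g) \<star> c)"]) auto
  qed (auto simp: interchange)
qed

text \<open>The mirror image, with \<open>X \<star> -\<close> right adjoint to
  \<open>D \<star> -\<close>.\<close>

lemma kernel_tens_left:
  assumes d: "dual X D c e" and k: "kernel q i"
  shows "kernel (one X \<star> q) (one X \<star> i)"
proof -
  note [simp] = dualD(1-8)[OF d] kernelD[OF k]
  let ?\<Psi> = "\<lambda>B g. (e \<star> one B) \<bullet> (one D \<star> g)"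
  have \<Psi>: "?\<Psi> (cd f) ((one X \<star> f) \<bullet> g) = f \<bullet> ?\<Psi> (dm f) g"
    if "arr f" "arr g" "cd g = X @ dm f" for f g
  proof -
    have "(e \<star> one (cd f)) \<bullet> (one (D @ X) \<star> f) = f \<bullet> (e \<star> one (dm f))"
      using slide[of e f] that by simp
    from comp_cong_assoc[OF this, of "one D \<star> g"] that show ?thesis
      by (simp add: whisker_comp_left tens_assoc[symmetric] comp_assoc tens_one)
  qed
  show ?thesis unfolding kernel_def monic_def
  proof (intro conjI allI impI)
    fix g h assume gh: "arr g" "arr h" "cd g = dm (one X \<star> i)" "cd h = dm (one X \<star> i)" "dm g = dm h"
      "(one X \<star> i) \<bullet> g = (one X \<star> i) \<bullet> h"
    then have "i \<bullet> ?\<Psi> (dm i) g = i \<bullet> ?\<Psi> (dm i) h"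
      using \<Psi>[of i g] \<Psi>[of i h] by simp
    then have "?\<Psi> (dm i) g = ?\<Psi> (dm i) h"
      by (rule monicD[rotated]) (use gh in auto)
    then show "g = h" using dual_adjunction_left_2[OF d gh(1) refl, of "dm i"] dual_adjunction_left_2[OF d gh(2) refl, of "dm i"] gh(3-5)
      by (metis cd_one cd_tens dm_one dm_tens)
  next
    fix g assume g: "arr g" "cd g = dm (one X \<star> q)" "(one X \<star> q) \<bullet> g = nul (dm g) (cd (one X \<star> q))"
    then have "q \<bullet> ?\<Psi> (dm q) g = nul (D @ dm g) (cd q)"
      using \<Psi>[of q g] by simp
    then obtain w where w: "arr w" "dm w = D @ dm g" "cd w = dm i" "i \<bullet> w = ?\<Psi> (dm q) g"
      using kernel_factor[OF k, of "?\<Psi> (dm q) g"] g by auto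
    have "g = (one X \<star> (i \<bullet> w)) \<bullet> (c \<star> one (dm g))"
      using dual_adjunction_left_2[OF d, of g "dm g" "dm q"] g w by simp
    also have "\<dots> = (one X \<star> i) \<bullet> ((one X \<star> w) \<bullet> (c \<star> one (dm g)))"
      using g w(1-3) by (simp add: whisker_comp_left comp_assoc)
    finally show "\<exists>u. arr u \<and> dm u = dm g \<and> cd u = dm (one X \<star> i) \<and> (one X \<star> i) \<bullet> u = g"
      using g w by (intro exI[of _ "(one X \<star> w) \<bullet> (c \<star> one (dm g))"]) auto
  qed (auto simp: interchange)
qed

text \<open>\<open>- \<star> X\<close> is a left adjoint, hence preserves epimorphisms;
  \<open>?\<Phi>\<close> is the adjunction map.\<close>

lemma epic_tens_right:
  assumes d: "dual X D c e" and q: "epic q"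
  shows "epic (q \<star> one X)"
proof -
  have [simp]: "arr q" using q by (simp add: epic_def)
  note [simp] = dualD(1-8)[OF d]
  let ?\<Phi> = "\<lambda>A f. (f \<star> one D) \<bullet> (one A \<star> c)"
  have \<Phi>: "?\<Phi> (dm q) (f \<bullet> (q \<star> one X)) = ?\<Phi> (cd q) f \<bullet> q" if "arr f" "dm f = cd q @ X" for f
  proof -
    have "(q \<star> one (X @ D)) \<bullet> (one (dm q) \<star> c) = (one (cd q) \<star> c) \<bullet> q"
      using slide[of q c] by simp
    then show ?thesis using that
      by (simp add: whisker_comp_right tens_assoc comp_assoc tens_one)
  qed
  show ?thesis unfolding epic_def
  proof (intro conjI allI impI)
    fix g h assume gh: "arr g" "arr h" "dm g = cd (q \<star> one X)" "dm h = cd (q \<star> one X)" "cd g = cd h"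
      "g \<bullet> (q \<star> one X) = h \<bullet> (q \<star> one X)"
    then have "?\<Phi> (cd q) g \<bullet> q = ?\<Phi> (cd q) h \<bullet> q"
      using \<Phi>[of g] \<Phi>[of h] by simp
    then have "?\<Phi> (cd q) g = ?\<Phi> (cd q) h"
      by (rule epicD[OF q]) (use gh in auto)
    then show "g = h" using dual_adjunction_right_1[OF d gh(1) _ refl, of "cd q"] dual_adjunction_right_1[OF d gh(2) _ refl, of "cd q"] gh(3-5)
      by (metis cd_one cd_tens dm_one dm_tens)
  qed auto
qed

text \<open>\<open>D \<star> -\<close> is a left adjoint and preserves cokernels. The tensored
  object occupies the second place of \<open>dual\<close>.\<close>

lemma cokernel_tens_left:
  assumes d: "dual X D c e" and k: "cokernel i q"
  shows "cokernel (one D \<star> i) (one D \<star> q)"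
proof -
  note [simp] = dualD(1-8)[OF d] cokernelD[OF k]
  let ?\<Phi> = "\<lambda>A f. (one X \<star> f) \<bullet> (c \<star> one A)"
  have \<Phi>: "?\<Phi> (dm r) (f \<bullet> (one D \<star> r)) = ?\<Phi> (cd r) f \<bullet> r" if "arr f" "arr r" "dm f = D @ cd r" for f r
  proof -
    have "(one (X @ D) \<star> r) \<bullet> (c \<star> one (dm r)) = (c \<star> one (cd r)) \<bullet> r"
      using slide[of c r] that by simp
    then show ?thesis using that
      by (simp add: whisker_comp_left tens_assoc[symmetric] comp_assoc tens_one)
  qed
  show ?thesis unfolding cokernel_def epic_def
  proof (intro conjI allI impI)
    fix g h assume gh: "arr g" "arr h" "dm g = cd (one D \<star> q)" "dm h = cd (one D \<star> q)" "cd g = cd h"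
      "g \<bullet> (one D \<star> q) = h \<bullet> (one D \<star> q)"
    then have "?\<Phi> (cd q) g \<bullet> q = ?\<Phi> (cd q) h \<bullet> q"
      using \<Phi>[of g q] \<Phi>[of h q] by simp
    then have "?\<Phi> (cd q) g = ?\<Phi> (cd q) h"
      by (rule epicD[rotated]) (use gh in auto)
    then show "g = h" using dual_adjunction_left_1[OF d gh(1) _ refl, of "cd q"] dual_adjunction_left_1[OF d gh(2) _ refl, of "cd q"] gh(3-5)
      by (metis cd_one cd_tens dm_one dm_tens)
  next
    fix g assume g: "arr g" "dm g = cd (one D \<star> i)" "g \<bullet> (one D \<star> i) = nul (dm (one D \<star> i)) (cd g)"
    then have "?\<Phi> (cd i) g \<bullet> i = nul (dm i) (X @ cd g)"
      using \<Phi>[of g i] by simp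
    then obtain w where w: "arr w" "dm w = cd q" "cd w = X @ cd g" "w \<bullet> q = ?\<Phi> (cd i) g"
      using cokernel_factor[OF k, of "?\<Phi> (cd i) g"] g by auto
    have "g = (e \<star> one (cd g)) \<bullet> (one D \<star> (w \<bullet> q))"
      using dual_adjunction_left_1[OF d, of g "cd i" "cd g"] g w by simp
    also have "\<dots> = ((e \<star> one (cd g)) \<bullet> (one D \<star> w)) \<bullet> (one D \<star> q)"
      using g w(1-3) by (simp add: whisker_comp_left comp_assoc)
    finally show "\<exists>u. arr u \<and> dm u = cd (one D \<star> q) \<and> cd u = cd g \<and> u \<bullet> (one D \<star> q) = g"
      using g w by (intro exI[of _ "(e \<star> one (cd g)) \<bullet> (one D \<star> w)"]) auto
  qed (auto simp: interchange)
qed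

text \<open>The adjunction with the unit as target: an arrow into D is the same as a pairing of its
  source with X.\<close>

lemma pairing_inject:
  assumes d: "dual X D c e" and g: "arr g" "cd g = D" and h: "arr h" "cd h = D" and gh: "dm g = dm h"
    and eq: "e \<bullet> (g \<star> one X) = e \<bullet> (h \<star> one X)"
  shows "g = h"
proof -
  note [simp] = dualD(1-8)[OF d] g h
  have "g = ((e \<bullet> (g \<star> one X)) \<star> one D) \<bullet> (one (dm h) \<star> c)"
    using dual_adjunction_right_2[OF d g(1) gh, of "[]"] gh by simp
  also have "\<dots> = h" unfolding eq
    using dual_adjunction_right_2[OF d h(1) refl, of "[]"] gh by simp
  finally show ?thesis .
qed

end

text \<open>\<open>epic_factor\<close> says that an epimorphism is a cokernel of its kernel without
  naming a kernel: an arrow that kills whatever \<open>b\<close> kills factors through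
  \<open>b\<close>.\<close>

locale strict_abelian_category = strict_category +
  assumes dual_exists: "obj X \<Longrightarrow> \<exists>D c e. dual X D c e"
    and kernel_exists: "arr f \<Longrightarrow> \<exists>k. kernel f k"
    and epic_factor: "epic b \<Longrightarrow> arr g \<Longrightarrow> dm g = dm b \<Longrightarrow>
      (\<And>h. arr h \<Longrightarrow> cd h = dm b \<Longrightarrow> b \<bullet> h = nul (dm h) (cd b) \<Longrightarrow> g \<bullet> h = nul (dm h) (cd g)) \<Longrightarrow>
      \<exists>u. arr u \<and> dm u = cd b \<and> cd u = cd g \<and> u \<bullet> b = g"
begin

section \<open>Images of idempotents and additivity of the dimension\<close>

lemma idempotent_splits:
  assumes A: "arr A" "dm A = X" "cd A = X" "A \<bullet> A = A"
  obtains I i p where "arr i" "dm i = I" "cd i = X" "arr p" "dm p = X" "cd p = I"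
    "i \<bullet> p = A" "p \<bullet> i = one I"
proof -
  note [simp] = A
  have X [simp]: "obj X" using obj_dm[of A] by simp
  \<comment> \<open>The image of an idempotent is the kernel of the complementary
    idempotent.\<close>
  obtain i where i: "kernel (one X \<uplus> (-1) \<ltimes> A) i" using kernel_exists[of "one X \<uplus> (-1) \<ltimes> A"] by auto
  note [simp] = kernelD(2,4)[OF i, simplified]
  have "(one X \<uplus> (-1) \<ltimes> A) \<bullet> A = nul X X"
    using scal_add[of A 1 "-1"] by (simp add: comp_plus_left)
  then obtain p where p [simp]: "arr p" "dm p = X" "cd p = dm i" and ip: "i \<bullet> p = A"
    using kernel_factor[OF i, of A] by auto
  have "A \<bullet> i = i"
  proof -
    have "i \<uplus> (-1) \<ltimes> (A \<bullet> i) = nul (dm i) X"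
      using kernelD(5)[OF i] by (simp add: comp_plus_left)
    then show ?thesis using eq_if_diff_nul[of i "A \<bullet> i"] by simp
  qed
  then have "i \<bullet> (p \<bullet> i) = i \<bullet> one (dm i)" using comp_assoc[of i p i] ip by simp
  then have "p \<bullet> i = one (dm i)"
    by (rule monicD[OF kernelD(3)[OF i]]) auto
  with ip show ?thesis using that[of i "dm i" p] by simp
qed

text \<open>The image \<open>I\<close> of the idempotent is the n-th exterior or symmetric power of
  V, for \<epsilon> = -1 or \<epsilon> = 1. As a retract of the tensor power, its dimension is the
  trace of the idempotent.\<close>

lemma has_dim_symmetrizer:
  assumes V: "has_dim V z" and \<epsilon>: "\<epsilon> * \<epsilon> = 1"
  shows "\<exists>I. obj I \<and> has_dim I (\<Prod>k<n. (z + \<epsilon> * of_nat k) / of_nat (Suc k))"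
proof -
  obtain D c e where d: "dual V D c e" and z: "e \<bullet> br V D \<bullet> c = z \<ltimes> one []"
    using V by (auto simp: has_dim_def)
  have V [simp]: "obj V" by (rule dualD(1)[OF d])
  obtain D' c' e' where d': "dual (tpow V n) D' c' e'" and
    t: "e' \<bullet> br (tpow V n) D' \<bullet> (symmetrizer \<epsilon> V n \<star> one D') \<bullet> c'
      = (\<Prod>k<n. (z + \<epsilon> * of_nat k) / of_nat (Suc k)) \<ltimes> one []"
    using trace_symmetrizer[OF d z \<epsilon>] by blast
  obtain I i p where ip: "arr i" "dm i = I" "cd i = tpow V n" "arr p" "dm p = tpow V n" "cd p = I"
    "i \<bullet> p = symmetrizer \<epsilon> V n" "p \<bullet> i = one I"
    using idempotent_splits[OF symmetrizer_typing[OF V] symmetrizer_idem[OF V \<epsilon>]] by metis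
  have I: "obj I" using obj_dm[OF ip(1)] ip(2) by simp
  then obtain DI cI eI where dI: "dual I DI cI eI" using dual_exists by blast
  show ?thesis using has_dim_retract[OF d' _ dI ip(1-6,8)] t ip(7) I by auto
qed

text \<open>Arrows into X' are pairings with X. An arrow killed by the transpose of i is a pairing
  that vanishes on Y; it factors through the cokernel q, so it is a pairing with S, that is, an
  arrow into S'.\<close>

lemma kernel_transpose:
  assumes dX: "dual X X' cX eX" and dY: "dual Y Y' cY eY" and dS: "dual S S' cS eS"
    and i: "dm i = Y" "cd i = X" and q: "cd q = S" and coker: "cokernel i q"
    and i': "arr i'" "dm i' = X'" "cd i' = Y'" "eY \<bullet> (i' \<star> one Y) = eX \<bullet> (one X' \<star> i)"
    and q': "arr q'" "dm q' = S'" "cd q' = X'" "eX \<bullet> (q' \<star> one X) = eS \<bullet> (one S' \<star> q)"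
  shows "kernel i' q'"
proof -
  note [simp] = dualD(1-8)[OF dX] dualD(1-8)[OF dY] dualD(1-8)[OF dS] cokernelD[OF coker] i q i'(1-3) q'(1-3)
  have precomp: "eY \<bullet> ((i' \<bullet> h) \<star> one Y) = (eX \<bullet> (h \<star> one X)) \<bullet> (one (dm h) \<star> i)"
    if "arr h" "cd h = X'" for h
  proof -
    have "eY \<bullet> ((i' \<bullet> h) \<star> one Y) = (eY \<bullet> (i' \<star> one Y)) \<bullet> (h \<star> one Y)"
      using that by (simp add: whisker_comp_right comp_assoc)
    also have "\<dots> = eX \<bullet> ((one X' \<star> i) \<bullet> (h \<star> one Y))"
      unfolding i'(4) using that by (simp add: comp_assoc)
    also have "(one X' \<star> i) \<bullet> (h \<star> one Y) = (h \<star> one X) \<bullet> (one (dm h) \<star> i)"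
      using slide[of h i] that by simp
    finally show ?thesis using that by (simp add: comp_assoc)
  qed
  have postcomp: "eX \<bullet> ((q' \<bullet> w) \<star> one X) = (eS \<bullet> (w \<star> one S)) \<bullet> (one (dm w) \<star> q)"
    if "arr w" "cd w = S'" for w
  proof -
    have "eX \<bullet> ((q' \<bullet> w) \<star> one X) = (eX \<bullet> (q' \<star> one X)) \<bullet> (w \<star> one X)"
      using that by (simp add: whisker_comp_right comp_assoc)
    also have "\<dots> = eS \<bullet> ((one S' \<star> q) \<bullet> (w \<star> one X))"
      unfolding q'(4) using that by (simp add: comp_assoc)
    also have "(one S' \<star> q) \<bullet> (w \<star> one X) = (w \<star> one S) \<bullet> (one (dm w) \<star> q)"
      using slide[of w q] that by simp
    finally show ?thesis using that by (simp add: comp_assoc)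
  qed
  \<comment> \<open>In \<open>cokernel_tens_left\<close> the tensored object must be a dual;
    \<open>dual_sym\<close> makes A the dual of its own dual.\<close>
  have cok: "cokernel (one A \<star> i) (one A \<star> q)" if "obj A" for A
    using dual_exists[OF that] cokernel_tens_left[OF dual_sym coker] by blast
  have "i' \<bullet> q' = nul S' Y'"
  proof (rule pairing_inject[OF dY])
    have "eY \<bullet> ((i' \<bullet> q') \<star> one Y) = (eX \<bullet> (q' \<star> one X)) \<bullet> (one S' \<star> i)"
      using precomp[of q'] by simp
    also have "\<dots> = eS \<bullet> (one S' \<star> (q \<bullet> i))"
      unfolding q'(4) by (simp add: comp_assoc interchange)
    finally show "eY \<bullet> ((i' \<bullet> q') \<star> one Y) = eY \<bullet> (nul S' Y' \<star> one Y)" by simp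
  qed auto
  then show ?thesis unfolding kernel_def monic_def
  proof (intro conjI allI impI)
    fix g h assume gh: "arr g" "arr h" "cd g = dm q'" "cd h = dm q'" "dm g = dm h" "q' \<bullet> g = q' \<bullet> h"
    have ep: "epic (one (dm h) \<star> q)" using cokernelD(3)[OF cok[of "dm h"]] gh by simp
    show "g = h"
    proof (rule pairing_inject[OF dS])
      have "(eS \<bullet> (g \<star> one S)) \<bullet> (one (dm h) \<star> q) = (eS \<bullet> (h \<star> one S)) \<bullet> (one (dm h) \<star> q)"
        using postcomp[of g] postcomp[of h] gh by simp
      then show "eS \<bullet> (g \<star> one S) = eS \<bullet> (h \<star> one S)"
        by (rule epicD[OF ep]) (use gh(1-5) in auto)
    qed (use gh in auto)
  next
    fix h assume h: "arr h" "cd h = dm i'" "i' \<bullet> h = nul (dm h) (cd i')"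
    have "(eX \<bullet> (h \<star> one X)) \<bullet> (one (dm h) \<star> i) = nul (dm h @ Y) []"
      using precomp[of h] h by simp
    then obtain l where l: "arr l" "dm l = dm h @ S" "cd l = []" "l \<bullet> (one (dm h) \<star> q) = eX \<bullet> (h \<star> one X)"
      using cokernel_factor[OF cok[of "dm h"], of "eX \<bullet> (h \<star> one X)"] h by auto
    \<comment> \<open>The pairing \<open>l\<close> with S, bent into an arrow to S'.\<close>
    let ?w = "(l \<star> one S') \<bullet> (one (dm h) \<star> cS)"
    have w: "eS \<bullet> (?w \<star> one S) = l"
      using dual_adjunction_right_1[OF dS l(1-3)] by simp
    have "q' \<bullet> ?w = h"
    proof (rule pairing_inject[OF dX])
      show "eX \<bullet> ((q' \<bullet> ?w) \<star> one X) = eX \<bullet> (h \<star> one X)"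
        using postcomp[of ?w] h(1,2) l(1-3) unfolding w l(4)[symmetric] by simp
    qed (use h(1,2) l(1-3) in auto)
    then show "\<exists>u. arr u \<and> dm u = dm h \<and> cd u = dm q' \<and> q' \<bullet> u = h"
      using h(1,2) l(1-3) by (intro exI[of _ ?w]) auto
  qed auto
qed

text \<open>Let \<open>K\<close> be the kernel of \<open>q \<star> i' : X \<star> X' \<rightarrow> S \<star> Y'\<close>, that is, \<open>Y \<star> X' + X \<star> S'\<close>. The coevaluation of
  \<open>X\<close> factors through \<open>K\<close>, and on \<open>K\<close> the pairing of \<open>X\<close> is the sum of the pairings of \<open>Y\<close> and \<open>S\<close>
  along the projections \<open>a : K \<rightarrow> Y \<star> Y'\<close> and \<open>b : K \<rightarrow> S \<star> S'\<close>, because both sides agree on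
  \<open>Y \<star> X'\<close> and on \<open>X \<star> S'\<close>.\<close>

lemma has_dim_additive:
  assumes Y: "has_dim Y y" and S: "has_dim S s"
    and i: "dm i = Y" "cd i = X" and q: "cd q = S" and ker: "kernel q i" and coker: "cokernel i q"
  shows "has_dim X (y + s)"
proof -
  obtain Y' cY eY where dY: "dual Y Y' cY eY" "eY \<bullet> br Y Y' \<bullet> cY = y \<ltimes> one []"
    using Y by (auto simp: has_dim_def)
  obtain S' cS eS where dS: "dual S S' cS eS" "eS \<bullet> br S S' \<bullet> cS = s \<ltimes> one []"
    using S by (auto simp: has_dim_def)
  have "obj X" using obj_cd[OF cokernelD(1)[OF coker]] i by simp
  then obtain X' cX eX where dX: "dual X X' cX eX" using dual_exists by blast
  note [simp] = dualD(1-8)[OF dX] dualD(1-8)[OF dY(1)] dualD(1-8)[OF dS(1)] cokernelD[OF coker] i q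
  obtain i' where i' [simp]: "arr i'" "dm i' = X'" "cd i' = Y'"
    and i'c: "(one X \<star> i') \<bullet> cX = (i \<star> one Y') \<bullet> cY" and i'e: "eY \<bullet> (i' \<star> one Y) = eX \<bullet> (one X' \<star> i)"
    using transpose_exists[OF dY(1) dX, of i] by auto
  obtain q' where q' [simp]: "arr q'" "dm q' = S'" "cd q' = X'"
    and q'c: "(one S \<star> q') \<bullet> cS = (q \<star> one X') \<bullet> cX" and q'e: "eX \<bullet> (q' \<star> one X) = eS \<bullet> (one S' \<star> q)"
    using transpose_exists[OF dX dS(1), of q] by auto
  have ker': "kernel i' q'"
    by (rule kernel_transpose[OF dX dY(1) dS(1) i q coker i' i'e q' q'e])
  note [simp] = kernelD(5)[OF ker', simplified]
  define tX tY tS where t: "tX = eX \<bullet> br X X'" "tY = eY \<bullet> br Y Y'" "tS = eS \<bullet> br S S'"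
  have tt [simp]: "arr tX" "dm tX = X @ X'" "cd tX = []" "arr tY" "dm tY = Y @ Y'" "cd tY = []"
    "arr tS" "dm tS = S @ S'" "cd tS = []" by (auto simp: t)
  have ti: "tX \<bullet> (i \<star> one X') = tY \<bullet> (one Y \<star> i')"
  proof -
    have "tX \<bullet> (i \<star> one X') = (eX \<bullet> (one X' \<star> i)) \<bullet> br Y X'"
      using br_natural[of i "one X'"] by (simp add: t comp_assoc)
    also have "\<dots> = tY \<bullet> (one Y \<star> i')"
      using br_natural[of "one Y" i'] by (simp add: t comp_assoc i'e[symmetric])
    finally show ?thesis .
  qed
  have tq: "tX \<bullet> (one X \<star> q') = tS \<bullet> (q \<star> one S')"
  proof -
    have "tX \<bullet> (one X \<star> q') = (eX \<bullet> (q' \<star> one X)) \<bullet> br X S'"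
      using br_natural[of "one X" q'] by (simp add: t comp_assoc)
    also have "\<dots> = tS \<bullet> (q \<star> one S')"
      using br_natural[of q "one S'"] by (simp add: t comp_assoc q'e)
    finally show ?thesis .
  qed
  obtain k where k: "kernel (q \<star> i') k" using kernel_exists[of "q \<star> i'"] by auto
  define K where "K = dm k"
  have kk [simp]: "arr k" "dm k = K" "cd k = X @ X'" "(q \<star> i') \<bullet> k = nul K (S @ Y')"
    using kernelD[OF k] by (auto simp: K_def)
  have [simp]: "obj K" using obj_dm[of k] by simp
  have qi1: "q \<star> i' = (q \<star> one Y') \<bullet> (one X \<star> i')" and qi2: "q \<star> i' = (one S \<star> i') \<bullet> (q \<star> one X')"
    using slide[of q i'] by simp_all
  have kerY: "kernel (q \<star> one Y') (i \<star> one Y')" by (rule kernel_tens_dual[OF dY(1) ker])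
  have kerX: "kernel (q \<star> one X') (i \<star> one X')" by (rule kernel_tens_dual[OF dX ker])
  have kerS: "kernel (one S \<star> i') (one S \<star> q')" by (rule kernel_tens_left[OF dS(1) ker'])
  have "(q \<star> i') \<bullet> cX = nul [] (S @ Y')"
  proof -
    have "(q \<star> i') \<bullet> cX = (q \<star> one Y') \<bullet> ((one X \<star> i') \<bullet> cX)" by (simp add: qi1 comp_assoc)
    also have "\<dots> = ((q \<bullet> i) \<star> one Y') \<bullet> cY" unfolding i'c by (subst whisker_comp_right) (auto simp: comp_assoc)
    finally show ?thesis by simp
  qed
  then obtain \<kappa> where \<kappa> [simp]: "arr \<kappa>" "dm \<kappa> = []" "cd \<kappa> = K" and k\<kappa>: "k \<bullet> \<kappa> = cX"
    using kernel_factor[OF k, of cX] by auto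
  have "(q \<star> one Y') \<bullet> ((one X \<star> i') \<bullet> k) = nul K (S @ Y')"
    using kk(4) unfolding qi1 by (simp add: comp_assoc)
  then obtain a where a [simp]: "arr a" "dm a = K" "cd a = Y @ Y'" and ia: "(i \<star> one Y') \<bullet> a = (one X \<star> i') \<bullet> k"
    using kernel_factor[OF kerY, of "(one X \<star> i') \<bullet> k"] by auto
  have "(one S \<star> i') \<bullet> ((q \<star> one X') \<bullet> k) = nul K (S @ Y')"
    using kk(4) unfolding qi2 by (simp add: comp_assoc)
  then obtain b where b [simp]: "arr b" "dm b = K" "cd b = S @ S'" and qb: "(one S \<star> q') \<bullet> b = (q \<star> one X') \<bullet> k"
    using kernel_factor[OF kerS, of "(q \<star> one X') \<bullet> k"] by auto
  have a\<kappa>: "a \<bullet> \<kappa> = cY"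
  proof (rule monicD[OF kernelD(3)[OF kerY]])
    show "(i \<star> one Y') \<bullet> a \<bullet> \<kappa> = (i \<star> one Y') \<bullet> cY"
      using comp_cong_assoc[OF ia, of \<kappa>] k\<kappa> i'c by (simp add: comp_assoc)
  qed auto
  have b\<kappa>: "b \<bullet> \<kappa> = cS"
  proof (rule monicD[OF kernelD(3)[OF kerS]])
    show "(one S \<star> q') \<bullet> b \<bullet> \<kappa> = (one S \<star> q') \<bullet> cS"
      using comp_cong_assoc[OF qb, of \<kappa>] k\<kappa> q'c by (simp add: comp_assoc)
  qed auto
  have "(q \<star> i') \<bullet> (i \<star> one X') = nul (Y @ X') (S @ Y')" by (simp add: interchange)
  then obtain u where u [simp]: "arr u" "dm u = Y @ X'" "cd u = K" and ku: "k \<bullet> u = i \<star> one X'"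
    using kernel_factor[OF k, of "i \<star> one X'"] by auto
  have "(q \<star> i') \<bullet> (one X \<star> q') = nul (X @ S') (S @ Y')" by (simp add: interchange)
  then obtain v where v [simp]: "arr v" "dm v = X @ S'" "cd v = K" and kv: "k \<bullet> v = one X \<star> q'"
    using kernel_factor[OF k, of "one X \<star> q'"] by auto
  have au: "a \<bullet> u = one Y \<star> i'"
  proof (rule monicD[OF kernelD(3)[OF kerY]])
    show "(i \<star> one Y') \<bullet> a \<bullet> u = (i \<star> one Y') \<bullet> (one Y \<star> i')"
      using comp_cong_assoc[OF ia, of u] by (simp add: comp_assoc ku interchange)
  qed auto
  have av: "a \<bullet> v = nul (X @ S') (Y @ Y')"
  proof (rule monicD[OF kernelD(3)[OF kerY]])
    show "(i \<star> one Y') \<bullet> a \<bullet> v = (i \<star> one Y') \<bullet> nul (X @ S') (Y @ Y')"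
      using comp_cong_assoc[OF ia, of v] by (simp add: comp_assoc kv interchange)
  qed auto
  have bu: "b \<bullet> u = nul (Y @ X') (S @ S')"
  proof (rule monicD[OF kernelD(3)[OF kerS]])
    show "(one S \<star> q') \<bullet> b \<bullet> u = (one S \<star> q') \<bullet> nul (Y @ X') (S @ S')"
      using comp_cong_assoc[OF qb, of u] by (simp add: comp_assoc ku interchange)
  qed auto
  have bv: "b \<bullet> v = q \<star> one S'"
  proof (rule monicD[OF kernelD(3)[OF kerS]])
    show "(one S \<star> q') \<bullet> b \<bullet> v = (one S \<star> q') \<bullet> (q \<star> one S')"
      using comp_cong_assoc[OF qb, of v] by (simp add: comp_assoc kv interchange)
  qed auto
  obtain A c e where "dual S' A c e" using dual_exists[of S'] by auto
  then have epi_q: "epic (q \<star> one S')"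
    using epic_tens_right[OF _ cokernelD(3)[OF coker]] by blast
  \<comment> \<open>The composite \<open>b \<bullet> v\<close> is already epic.\<close>
  have epi_b: "epic b" unfolding epic_def
  proof (intro conjI allI impI)
    fix g h assume gh: "arr g" "arr h" "dm g = cd b" "dm h = cd b" "cd g = cd h" "g \<bullet> b = h \<bullet> b"
    have "(g \<bullet> b) \<bullet> v = (h \<bullet> b) \<bullet> v" using gh(6) by simp
    then have "g \<bullet> (q \<star> one S') = h \<bullet> (q \<star> one S')" using gh(1-5) by (simp add: comp_assoc bv)
    then show "g = h" by (rule epicD[OF epi_q]) (use gh(1-5) in auto)
  qed auto
  define g where "g = tX \<bullet> k \<uplus> (-1) \<ltimes> (tY \<bullet> a \<uplus> tS \<bullet> b)"
  have g [simp]: "arr g" "dm g = K" "cd g = []" by (auto simp: g_def)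
  have gu: "g \<bullet> u = nul (Y @ X') []"
    using scal_add[of "tY \<bullet> (one Y \<star> i')" 1 "-1", symmetric]
    by (simp add: g_def comp_plus_left comp_assoc au bu ku ti)
  have gv: "g \<bullet> v = nul (X @ S') []"
    using scal_add[of "tS \<bullet> (q \<star> one S')" 1 "-1", symmetric] plus_commute[of "nul (X @ S') []" "tS \<bullet> (q \<star> one S')"]
    by (simp add: g_def comp_plus_left comp_assoc av bv kv tq)
  \<comment> \<open>An arrow killed by \<open>b\<close> factors through \<open>u\<close>, because
    its composite with \<open>k\<close> lies in the kernel of \<open>q \<star> one X'\<close>. Hence
    \<open>g\<close> vanishes on it and descends along the epimorphism \<open>b\<close>. The
    resulting \<open>l\<close> is zero, since \<open>g\<close> also vanishes along \<open>v\<close>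
    and \<open>b \<bullet> v\<close> is epic.\<close>
  obtain l where l: "arr l" "dm l = cd b" "cd l = []" "l \<bullet> b = g"
  proof -
    have "g \<bullet> h = nul (dm h) (cd g)" if h: "arr h" "cd h = dm b" "b \<bullet> h = nul (dm h) (cd b)" for h
    proof -
      have "(q \<star> one X') \<bullet> (k \<bullet> h) = nul (dm h) (S @ X')"
        using comp_cong_assoc[OF qb, of h] h by (simp add: comp_assoc)
      then obtain w where w: "arr w" "dm w = dm h" "cd w = Y @ X'" "(i \<star> one X') \<bullet> w = k \<bullet> h"
        using kernel_factor[OF kerX, of "k \<bullet> h"] h by auto
      have h_eq: "h = u \<bullet> w"
      proof (rule monicD[OF kernelD(3)[OF k]])
        show "k \<bullet> h = k \<bullet> u \<bullet> w" using comp_cong_assoc[OF ku, of w] w by simp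
      qed (use w h in auto)
      show ?thesis unfolding h_eq using comp_cong_assoc[OF gu, of w] w(1,3) by simp
    qed
    then show ?thesis using epic_factor[OF epi_b, of g] that by auto
  qed
  have "l \<bullet> (q \<star> one S') = nul (S @ S') [] \<bullet> (q \<star> one S')"
    using comp_cong_assoc[OF l(4), of v] l(1-3) by (simp add: bv gv)
  then have "l = nul (S @ S') []" by (rule epicD[OF epi_q]) (use l(1-3) in auto)
  then have "g = nul K []" using l(4) by simp
  then have "tX \<bullet> k \<uplus> (-1) \<ltimes> (tY \<bullet> a \<uplus> tS \<bullet> b) = nul K []" by (simp only: g_def)
  then have "tX \<bullet> k = tY \<bullet> a \<uplus> tS \<bullet> b" by (subst eq_if_diff_nul[of "tX \<bullet> k" "tY \<bullet> a \<uplus> tS \<bullet> b"]) simp_all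
  from arg_cong[OF this, of "\<lambda>f. f \<bullet> \<kappa>"] have "tX \<bullet> cX = tY \<bullet> cY \<uplus> tS \<bullet> cS"
    by (simp add: comp_plus_left comp_assoc k\<kappa> a\<kappa> b\<kappa>)
  then have "eX \<bullet> br X X' \<bullet> cX = (y + s) \<ltimes> one []"
    using dY(2) dS(2) by (simp add: t comp_assoc scal_add)
  then show ?thesis by (rule has_dimI[OF dX])
qed

end

section \<open>Coherence and strictification\<close>

context category
begin

lemma hom_iff: "f \<in> hom C X Y \<longleftrightarrow> f \<in> Ar C \<and> src C f = X \<and> tgt C f = Y"
  by (auto simp: hom_def)

lemma ident_simps [simp]:
  assumes "X \<in> Ob C" shows "\<iota> X \<in> Ar C" "src C (\<iota> X) = X" "tgt C (\<iota> X) = X"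
  using ident_hom[OF assms] by (auto simp: hom_iff)

lemma cmp_simps [simp]:
  assumes "f \<in> Ar C" "g \<in> Ar C" "src C g = tgt C f"
  shows "g \<cdot> f \<in> Ar C" "src C (g \<cdot> f) = src C f" "tgt C (g \<cdot> f) = tgt C g"
  using cmp_hom[of f "src C f" "tgt C f" g "tgt C g"] assms by (auto simp: hom_iff)

lemma src_tgt_Ob [simp]: "f \<in> Ar C \<Longrightarrow> src C f \<in> Ob C" "f \<in> Ar C \<Longrightarrow> tgt C f \<in> Ob C"
  by (rule src_Ob tgt_Ob, assumption)+

lemma cmp_ident [simp]:
  assumes "f \<in> Ar C"
  shows "src C f = X \<Longrightarrow> f \<cdot> \<iota> X = f" "tgt C f = X \<Longrightarrow> \<iota> X \<cdot> f = f"
  using assms cmp_ident_right[of f] cmp_ident_left[of f] by (auto simp: hom_iff)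

lemma cmp_assoc_simp:
  assumes "f \<in> Ar C" "g \<in> Ar C" "h \<in> Ar C" "src C g = tgt C f" "src C h = tgt C g"
  shows "(h \<cdot> g) \<cdot> f = h \<cdot> (g \<cdot> f)"
  using cmp_assoc[of f "src C f" "tgt C f" g "tgt C g" h "tgt C h"] assms by (auto simp: hom_iff)

lemma cmp_subst:
  assumes "h \<cdot> g = k" "f \<in> Ar C" "g \<in> Ar C" "h \<in> Ar C" "src C g = tgt C f" "src C h = tgt C g"
  shows "h \<cdot> (g \<cdot> f) = k \<cdot> f"
  using cmp_assoc_simp assms by metis

text \<open>\<open>inv_arr\<close> is a definite description; uniqueness of inverses is what makes
  it denote one.\<close>

lemma inv_arr_simps [simp]:
  assumes "iso_arr C f"
  shows "f \<in> Ar C" "inv_arr C f \<in> Ar C" "src C (inv_arr C f) = tgt C f" "tgt C (inv_arr C f) = src C f"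
    "inv_arr C f \<cdot> f = \<iota> (src C f)" "f \<cdot> inv_arr C f = \<iota> (tgt C f)"
proof -
  obtain g where g: "inverse_pair C f g" using assms by (auto simp: iso_arr_def)
  have "h = g" if h: "inverse_pair C f h" for h
  proof -
    have "h \<cdot> (f \<cdot> g) = (h \<cdot> f) \<cdot> g"
      using g h by (intro cmp_assoc_simp[symmetric]) (auto simp: inverse_pair_def hom_iff)
    then show ?thesis using g h by (auto simp: inverse_pair_def hom_iff)
  qed
  then have "inv_arr C f = g" unfolding inv_arr_def using g by blast
  then show "f \<in> Ar C" "inv_arr C f \<in> Ar C" "src C (inv_arr C f) = tgt C f" "tgt C (inv_arr C f) = src C f"
    "inv_arr C f \<cdot> f = \<iota> (src C f)" "f \<cdot> inv_arr C f = \<iota> (tgt C f)"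
    using g by (auto simp: inverse_pair_def hom_iff)
qed

lemma inv_arr_cancel [simp]:
  assumes "iso_arr C f" "g \<in> Ar C"
  shows "tgt C g = src C f \<Longrightarrow> inv_arr C f \<cdot> (f \<cdot> g) = g"
    "tgt C g = tgt C f \<Longrightarrow> f \<cdot> (inv_arr C f \<cdot> g) = g"
  using assms by (simp_all add: cmp_assoc_simp[symmetric])

lemma iso_cancel_right:
  assumes "iso_arr C e" "f \<cdot> e = g \<cdot> e" "f \<in> Ar C" "g \<in> Ar C" "src C f = tgt C e" "src C g = tgt C e"
  shows "f = g"
proof -
  have "(f \<cdot> e) \<cdot> inv_arr C e = (g \<cdot> e) \<cdot> inv_arr C e" using assms by simp
  then show ?thesis using assms(1,3-) by (simp add: cmp_assoc_simp)
qed

lemma iso_cancel_left: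
  assumes "iso_arr C e" "e \<cdot> f = e \<cdot> g" "f \<in> Ar C" "g \<in> Ar C" "tgt C f = src C e" "tgt C g = src C e"
  shows "f = g"
  by (metis assms inv_arr_cancel(1))

lemma iso_arrI:
  assumes "f \<in> Ar C" "g \<in> Ar C" "src C g = tgt C f" "tgt C g = src C f"
    "g \<cdot> f = \<iota> (src C f)" "f \<cdot> g = \<iota> (tgt C f)"
  shows "iso_arr C f"
  using assms unfolding iso_arr_def inverse_pair_def by (auto simp: hom_iff)

lemma iso_ident [simp]: "X \<in> Ob C \<Longrightarrow> iso_arr C (\<iota> X)"
  by (rule iso_arrI[of _ "\<iota> X"]) auto

lemma iso_inv [simp]: "iso_arr C f \<Longrightarrow> iso_arr C (inv_arr C f)"
  by (rule iso_arrI[of _ f]) auto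

lemma iso_cmp [simp]:
  assumes "iso_arr C f" "iso_arr C g" "src C g = tgt C f" shows "iso_arr C (g \<cdot> f)"
  using assms by (intro iso_arrI[of _ "inv_arr C f \<cdot> inv_arr C g"]) (simp_all add: cmp_assoc_simp)

end

context linear_category
begin

lemma linear_simps [simp]:
  shows "X \<in> Ob C \<Longrightarrow> Y \<in> Ob C \<Longrightarrow> \<zero> X Y \<in> Ar C" "X \<in> Ob C \<Longrightarrow> Y \<in> Ob C \<Longrightarrow> src C (\<zero> X Y) = X"
    "X \<in> Ob C \<Longrightarrow> Y \<in> Ob C \<Longrightarrow> tgt C (\<zero> X Y) = Y"
    "f \<in> Ar C \<Longrightarrow> c \<odot> f \<in> Ar C" "f \<in> Ar C \<Longrightarrow> src C (c \<odot> f) = src C f" "f \<in> Ar C \<Longrightarrow> tgt C (c \<odot> f) = tgt C f"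
    "f \<in> Ar C \<Longrightarrow> g \<in> Ar C \<Longrightarrow> src C f = src C g \<Longrightarrow> tgt C f = tgt C g \<Longrightarrow> f \<oplus> g \<in> Ar C"
    "f \<in> Ar C \<Longrightarrow> g \<in> Ar C \<Longrightarrow> src C f = src C g \<Longrightarrow> tgt C f = tgt C g \<Longrightarrow> src C (f \<oplus> g) = src C g"
    "f \<in> Ar C \<Longrightarrow> g \<in> Ar C \<Longrightarrow> src C f = src C g \<Longrightarrow> tgt C f = tgt C g \<Longrightarrow> tgt C (f \<oplus> g) = tgt C g"
  using zer_hom[of X Y] scale_hom[of f "src C f" "tgt C f" c] add_hom[of f "src C f" "tgt C f" g]
  by (auto simp: hom_iff)

text \<open>Distributivity makes \<open>0 \<odot> f\<close> idempotent under addition, and adding a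
  negative leaves the zero arrow.\<close>

lemma scale_zero: assumes "f \<in> hom C X Y" shows "0 \<odot> f = \<zero> X Y"
proof -
  let ?z = "0 \<odot> f"
  have z: "?z \<in> hom C X Y" by (rule scale_hom[OF assms])
  obtain g where g: "g \<in> hom C X Y" "?z \<oplus> g = \<zero> X Y" using add_neg[OF z] by blast
  have zz: "?z \<oplus> ?z = ?z" using scale_add_left[OF assms, of 0 0] by simp
  have "?z = ?z \<oplus> (?z \<oplus> g)" using add_zer[OF z] g by simp
  also have "\<dots> = \<zero> X Y" using add_assoc[OF z z g(1)] zz g(2) by simp
  finally show ?thesis .
qed

lemma zer_cmp [simp]:
  assumes "f \<in> Ar C" "tgt C f = X" "Y \<in> Ob C" shows "\<zero> X Y \<cdot> f = \<zero> (src C f) Y"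
proof -
  have f: "f \<in> hom C (src C f) X" and z: "\<zero> X Y \<in> hom C X Y" and zf: "\<zero> X Y \<cdot> f \<in> hom C (src C f) Y"
    using assms by (auto simp: hom_iff)
  show ?thesis using cmp_scale_left[OF f z, of 0] scale_zero[OF z] scale_zero[OF zf] by simp
qed

lemma cmp_zer [simp]:
  assumes "f \<in> Ar C" "src C f = Y" "X \<in> Ob C" shows "f \<cdot> \<zero> X Y = \<zero> X (tgt C f)"
proof -
  have f: "f \<in> hom C Y (tgt C f)" and z: "\<zero> X Y \<in> hom C X Y" and zf: "f \<cdot> \<zero> X Y \<in> hom C X (tgt C f)"
    using assms by (auto simp: hom_iff)
  show ?thesis using cmp_scale_right[OF z f, of 0] scale_zero[OF z] scale_zero[OF zf] by simp
qed

lemma add_simps: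
  assumes "f \<in> Ar C" "g \<in> Ar C" "src C g = src C f" "tgt C g = tgt C f"
  shows "f \<oplus> g = g \<oplus> f" "c \<odot> (f \<oplus> g) = (c \<odot> f) \<oplus> (c \<odot> g)"
    "h \<in> Ar C \<Longrightarrow> src C h = src C g \<Longrightarrow> tgt C h = tgt C g \<Longrightarrow> (f \<oplus> g) \<oplus> h = f \<oplus> (g \<oplus> h)"
    "h \<in> Ar C \<Longrightarrow> src C h = tgt C f \<Longrightarrow> h \<cdot> (f \<oplus> g) = (h \<cdot> f) \<oplus> (h \<cdot> g)"
    "h \<in> Ar C \<Longrightarrow> tgt C h = src C f \<Longrightarrow> (f \<oplus> g) \<cdot> h = (f \<cdot> h) \<oplus> (g \<cdot> h)"
  using assms add_commute[of f "src C f" "tgt C f" g] scale_add_right[of f "src C f" "tgt C f" g c]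
    add_assoc[of f "src C f" "tgt C f" g h] cmp_add_right[of f "src C f" "tgt C f" g h "tgt C h"]
    cmp_add_left[of h "src C h" "src C f" f "tgt C f" g]
  by (auto simp: hom_iff)

lemma add_zer_simp: "f \<in> Ar C \<Longrightarrow> src C f = X \<Longrightarrow> tgt C f = Y \<Longrightarrow> f \<oplus> \<zero> X Y = f"
  by (auto intro: add_zer simp: hom_iff)

lemma scale_simps:
  assumes "f \<in> Ar C"
  shows "1 \<odot> f = f" "c \<odot> (d \<odot> f) = (c * d) \<odot> f" "(c + d) \<odot> f = (c \<odot> f) \<oplus> (d \<odot> f)"
    "0 \<odot> f = \<zero> (src C f) (tgt C f)"
    "g \<in> Ar C \<Longrightarrow> src C g = tgt C f \<Longrightarrow> (c \<odot> g) \<cdot> f = c \<odot> (g \<cdot> f)"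
    "g \<in> Ar C \<Longrightarrow> src C g = tgt C f \<Longrightarrow> g \<cdot> (c \<odot> f) = c \<odot> (g \<cdot> f)"
  using assms scale_one[of f "src C f" "tgt C f"] scale_scale[of f "src C f" "tgt C f" c d]
    scale_add_left[of f "src C f" "tgt C f" c d] scale_zero[of f "src C f" "tgt C f"]
    cmp_scale_left[of f "src C f" "tgt C f" g "tgt C g" c]
    cmp_scale_right[of f "src C f" "tgt C f" g "tgt C g" c]
  by (auto simp: hom_iff)

lemma is_kernel_factor:
  assumes k: "is_kernel C f k" and g: "g \<in> Ar C" "tgt C g = src C f" "f \<cdot> g = \<zero> (src C g) (tgt C f)"
  shows "\<exists>u. u \<in> Ar C \<and> src C u = src C g \<and> tgt C u = src C k \<and> k \<cdot> u = g"
proof -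
  have "g \<in> hom C (src C g) (src C f)" using g by (simp add: hom_iff)
  then have "\<exists>!u. u \<in> hom C (src C g) (src C k) \<and> k \<cdot> u = g"
    using k g(3) unfolding is_kernel_def by blast
  then show ?thesis by (auto simp: hom_iff)
qed

lemma is_cokernel_factor:
  assumes q: "is_cokernel C f q" and g: "g \<in> Ar C" "src C g = tgt C f" "g \<cdot> f = \<zero> (src C f) (tgt C g)"
  shows "\<exists>u. u \<in> Ar C \<and> src C u = tgt C q \<and> tgt C u = tgt C g \<and> u \<cdot> q = g"
proof -
  have "g \<in> hom C (tgt C f) (tgt C g)" using g by (simp add: hom_iff)
  then have "\<exists>!u. u \<in> hom C (tgt C q) (tgt C g) \<and> u \<cdot> q = g"
    using q g(3) unfolding is_cokernel_def by blast
  then show ?thesis by (auto simp: hom_iff)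
qed

end

section \<open>Unit constraints and joining isomorphisms\<close>

context linear_monoidal_category
begin

lemmas [simp] = unt_Ob ten_Ob lun_iso run_iso asc_iso

lemma tenA_simps [simp]:
  assumes "f \<in> Ar C" "g \<in> Ar C"
  shows "f \<boxtimes> g \<in> Ar C" "src C (f \<boxtimes> g) = src C f \<otimes> src C g" "tgt C (f \<boxtimes> g) = tgt C f \<otimes> tgt C g"
  using tenA_hom[of f "src C f" "tgt C f" g "src C g" "tgt C g"] assms by (auto simp: hom_iff)

lemma constraint_simps [simp]:
  assumes "X \<in> Ob C"
  shows "src C (lun C X) = \<one> \<otimes> X" "tgt C (lun C X) = X" "src C (run C X) = X \<otimes> \<one>" "tgt C (run C X) = X"
    "Y \<in> Ob C \<Longrightarrow> Z \<in> Ob C \<Longrightarrow> src C (\<alpha> X Y Z) = (X \<otimes> Y) \<otimes> Z"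
    "Y \<in> Ob C \<Longrightarrow> Z \<in> Ob C \<Longrightarrow> tgt C (\<alpha> X Y Z) = X \<otimes> (Y \<otimes> Z)"
  using lun_hom[OF assms] run_hom[OF assms] asc_hom[OF assms, of Y Z] by (auto simp: hom_iff)

lemma constraint_Ar [simp]:
  assumes "X \<in> Ob C"
  shows "lun C X \<in> Ar C" "run C X \<in> Ar C" "Y \<in> Ob C \<Longrightarrow> Z \<in> Ob C \<Longrightarrow> \<alpha> X Y Z \<in> Ar C"
  using assms by (auto intro: inv_arr_simps(1))

lemma tenA_interchange:
  assumes "f \<in> Ar C" "f' \<in> Ar C" "g \<in> Ar C" "g' \<in> Ar C" "src C f' = tgt C f" "src C g' = tgt C g"
  shows "(f' \<boxtimes> g') \<cdot> (f \<boxtimes> g) = (f' \<cdot> f) \<boxtimes> (g' \<cdot> g)"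
  using tenA_cmp[of f "src C f" "tgt C f" f' "tgt C f'" g "src C g" "tgt C g" g' "tgt C g'"] assms
  by (auto simp: hom_iff)

lemma iso_tenA [simp]:
  assumes "iso_arr C f" "iso_arr C g" shows "iso_arr C (f \<boxtimes> g)"
  using assms by (intro iso_arrI[of _ "inv_arr C f \<boxtimes> inv_arr C g"]) (simp_all add: tenA_interchange tenA_ident)

lemma asc_natural_simp:
  assumes "f \<in> Ar C" "g \<in> Ar C" "h \<in> Ar C"
  shows "\<alpha> (tgt C f) (tgt C g) (tgt C h) \<cdot> ((f \<boxtimes> g) \<boxtimes> h) = (f \<boxtimes> (g \<boxtimes> h)) \<cdot> \<alpha> (src C f) (src C g) (src C h)"
  using asc_natural[of f "src C f" "tgt C f" g "src C g" "tgt C g" h "src C h" "tgt C h"] assms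
  by (auto simp: hom_iff)

lemma lun_natural_simp: "f \<in> Ar C \<Longrightarrow> lun C (tgt C f) \<cdot> (\<iota> \<one> \<boxtimes> f) = f \<cdot> lun C (src C f)"
  using lun_natural[of f "src C f" "tgt C f"] by (auto simp: hom_iff)

lemma run_natural_simp: "f \<in> Ar C \<Longrightarrow> run C (tgt C f) \<cdot> (f \<boxtimes> \<iota> \<one>) = f \<cdot> run C (src C f)"
  using run_natural[of f "src C f" "tgt C f"] by (auto simp: hom_iff)

text \<open>Tensoring with the unit is faithful, being naturally isomorphic to the identity functor.
  Identities between constraints may therefore be checked after adding a unit factor, where the
  pentagon and the triangle apply.\<close>

lemma tenA_unt_left_cancel:
  assumes "f \<in> Ar C" "g \<in> Ar C" "src C f = src C g" "tgt C f = tgt C g" "\<iota> \<one> \<boxtimes> f = \<iota> \<one> \<boxtimes> g"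
  shows "f = g"
proof (rule iso_cancel_right[of "lun C (src C f)"])
  show "f \<cdot> lun C (src C f) = g \<cdot> lun C (src C f)"
    using lun_natural_simp[OF assms(1)] lun_natural_simp[OF assms(2)] assms by simp
qed (use assms in auto)

lemma tenA_unt_right_cancel:
  assumes "f \<in> Ar C" "g \<in> Ar C" "src C f = src C g" "tgt C f = tgt C g" "f \<boxtimes> \<iota> \<one> = g \<boxtimes> \<iota> \<one>"
  shows "f = g"
proof (rule iso_cancel_right[of "run C (src C f)"])
  show "f \<cdot> run C (src C f) = g \<cdot> run C (src C f)"
    using run_natural_simp[OF assms(1)] run_natural_simp[OF assms(2)] assms by simp
qed (use assms in auto)

lemma tenA_cmp_left:
  assumes "f \<in> Ar C" "g \<in> Ar C" "src C g = tgt C f" "X \<in> Ob C"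
  shows "\<iota> X \<boxtimes> (g \<cdot> f) = (\<iota> X \<boxtimes> g) \<cdot> (\<iota> X \<boxtimes> f)"
  using assms by (simp add: tenA_interchange)

lemma tenA_cmp_right:
  assumes "f \<in> Ar C" "g \<in> Ar C" "src C g = tgt C f" "X \<in> Ob C"
  shows "(g \<cdot> f) \<boxtimes> \<iota> X = (g \<boxtimes> \<iota> X) \<cdot> (f \<boxtimes> \<iota> X)"
  using assms by (simp add: tenA_interchange)

text \<open>Kelly's consequences of the pentagon and triangle axioms.\<close>

lemma lun_tensor:
  assumes X: "X \<in> Ob C" and Y: "Y \<in> Ob C"
  shows "lun C (X \<otimes> Y) \<cdot> \<alpha> \<one> X Y = lun C X \<boxtimes> \<iota> Y"
proof (rule tenA_unt_left_cancel)
  note [simp] = X Y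
  \<comment> \<open>The two arrows performed first on the longer side of the pentagon for \<one>,
    \<one>, X, Y.\<close>
  let ?R = "\<alpha> \<one> (\<one> \<otimes> X) Y \<cdot> (\<alpha> \<one> \<one> X \<boxtimes> \<iota> Y)"
  have n1: "\<alpha> \<one> X Y \<cdot> ((run C \<one> \<boxtimes> \<iota> X) \<boxtimes> \<iota> Y) = (run C \<one> \<boxtimes> \<iota> (X \<otimes> Y)) \<cdot> \<alpha> (\<one> \<otimes> \<one>) X Y"
    using asc_natural_simp[of "run C \<one>" "\<iota> X" "\<iota> Y"] by (simp add: tenA_ident)
  have n2: "\<alpha> \<one> X Y \<cdot> ((\<iota> \<one> \<boxtimes> lun C X) \<boxtimes> \<iota> Y) = (\<iota> \<one> \<boxtimes> (lun C X \<boxtimes> \<iota> Y)) \<cdot> \<alpha> \<one> (\<one> \<otimes> X) Y"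
    using asc_natural_simp[of "\<iota> \<one>" "lun C X" "\<iota> Y"] by simp
  show "\<iota> \<one> \<boxtimes> (lun C (X \<otimes> Y) \<cdot> \<alpha> \<one> X Y) = \<iota> \<one> \<boxtimes> (lun C X \<boxtimes> \<iota> Y)"
  proof (rule iso_cancel_right[of ?R])
    have "(\<iota> \<one> \<boxtimes> (lun C (X \<otimes> Y) \<cdot> \<alpha> \<one> X Y)) \<cdot> ?R
      = (\<iota> \<one> \<boxtimes> lun C (X \<otimes> Y)) \<cdot> ((\<iota> \<one> \<boxtimes> \<alpha> \<one> X Y) \<cdot> ?R)"
      by (simp add: tenA_cmp_left cmp_assoc_simp)
    also have "\<dots> = ((\<iota> \<one> \<boxtimes> lun C (X \<otimes> Y)) \<cdot> \<alpha> \<one> \<one> (X \<otimes> Y)) \<cdot> \<alpha> (\<one> \<otimes> \<one>) X Y"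
      by (simp add: pentagon cmp_assoc_simp)
    also have "\<dots> = \<alpha> \<one> X Y \<cdot> (((\<iota> \<one> \<boxtimes> lun C X) \<cdot> \<alpha> \<one> \<one> X) \<boxtimes> \<iota> Y)"
      by (simp add: triangle n1)
    also have "\<dots> = (\<alpha> \<one> X Y \<cdot> ((\<iota> \<one> \<boxtimes> lun C X) \<boxtimes> \<iota> Y)) \<cdot> (\<alpha> \<one> \<one> X \<boxtimes> \<iota> Y)"
      by (simp add: tenA_cmp_right cmp_assoc_simp del: triangle)
    also have "\<dots> = (\<iota> \<one> \<boxtimes> (lun C X \<boxtimes> \<iota> Y)) \<cdot> ?R"
      unfolding n2 by (simp add: cmp_assoc_simp)
    finally show "(\<iota> \<one> \<boxtimes> (lun C (X \<otimes> Y) \<cdot> \<alpha> \<one> X Y)) \<cdot> ?R = (\<iota> \<one> \<boxtimes> (lun C X \<boxtimes> \<iota> Y)) \<cdot> ?R" .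
  qed auto
qed (use assms in auto)

lemma run_tensor:
  assumes X: "X \<in> Ob C" and Y: "Y \<in> Ob C"
  shows "(\<iota> X \<boxtimes> run C Y) \<cdot> \<alpha> X Y \<one> = run C (X \<otimes> Y)"
proof (rule tenA_unt_right_cancel)
  note [simp] = X Y
  have n1: "\<alpha> X Y \<one> \<cdot> ((\<iota> X \<boxtimes> run C Y) \<boxtimes> \<iota> \<one>) = (\<iota> X \<boxtimes> (run C Y \<boxtimes> \<iota> \<one>)) \<cdot> \<alpha> X (Y \<otimes> \<one>) \<one>"
    using asc_natural_simp[of "\<iota> X" "run C Y" "\<iota> \<one>"] by simp
  have n2: "\<alpha> X Y \<one> \<cdot> (\<iota> (X \<otimes> Y) \<boxtimes> lun C \<one>) = (\<iota> X \<boxtimes> (\<iota> Y \<boxtimes> lun C \<one>)) \<cdot> \<alpha> X Y (\<one> \<otimes> \<one>)"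
    using asc_natural_simp[of "\<iota> X" "\<iota> Y" "lun C \<one>"] by (simp add: tenA_ident)
  show "((\<iota> X \<boxtimes> run C Y) \<cdot> \<alpha> X Y \<one>) \<boxtimes> \<iota> \<one> = run C (X \<otimes> Y) \<boxtimes> \<iota> \<one>"
  proof (rule iso_cancel_left[of "\<alpha> X Y \<one>"])
    have "\<alpha> X Y \<one> \<cdot> (((\<iota> X \<boxtimes> run C Y) \<cdot> \<alpha> X Y \<one>) \<boxtimes> \<iota> \<one>)
      = (\<alpha> X Y \<one> \<cdot> ((\<iota> X \<boxtimes> run C Y) \<boxtimes> \<iota> \<one>)) \<cdot> (\<alpha> X Y \<one> \<boxtimes> \<iota> \<one>)"
      by (simp add: tenA_cmp_right cmp_assoc_simp)
    also have "\<dots> = (\<iota> X \<boxtimes> (\<iota> Y \<boxtimes> lun C \<one>)) \<cdot> ((\<iota> X \<boxtimes> \<alpha> Y \<one> \<one>) \<cdot> (\<alpha> X (Y \<otimes> \<one>) \<one> \<cdot> (\<alpha> X Y \<one> \<boxtimes> \<iota> \<one>)))"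
      unfolding n1 by (simp add: triangle[symmetric] tenA_cmp_left cmp_assoc_simp)
    also have "\<dots> = (\<alpha> X Y \<one> \<cdot> (\<iota> (X \<otimes> Y) \<boxtimes> lun C \<one>)) \<cdot> \<alpha> (X \<otimes> Y) \<one> \<one>"
      unfolding n2 by (simp add: pentagon cmp_assoc_simp)
    also have "\<dots> = \<alpha> X Y \<one> \<cdot> (run C (X \<otimes> Y) \<boxtimes> \<iota> \<one>)"
      by (simp add: triangle cmp_assoc_simp)
    finally show "\<alpha> X Y \<one> \<cdot> (((\<iota> X \<boxtimes> run C Y) \<cdot> \<alpha> X Y \<one>) \<boxtimes> \<iota> \<one>) = \<alpha> X Y \<one> \<cdot> (run C (X \<otimes> Y) \<boxtimes> \<iota> \<one>)" .
  qed auto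
qed (use assms in auto)

text \<open>Naturality of \<open>lun\<close> at itself identifies
  \<open>\<iota> \<one> \<boxtimes> lun C \<one>\<close> with
  \<open>lun C (\<one> \<otimes> \<one>)\<close>. The triangle axiom and \<open>lun_tensor\<close>
  then have the same left-hand side.\<close>

lemma lun_unt: "lun C \<one> = run C \<one>"
proof (rule tenA_unt_right_cancel)
  have "\<iota> \<one> \<boxtimes> lun C \<one> = lun C (\<one> \<otimes> \<one>)"
    by (rule iso_cancel_left[of "lun C \<one>"]) (use lun_natural_simp[of "lun C \<one>"] in auto)
  then show "lun C \<one> \<boxtimes> \<iota> \<one> = run C \<one> \<boxtimes> \<iota> \<one>"
    using triangle[of \<one> \<one>] lun_tensor[of \<one> \<one>] by simp
qed auto

lemma tenA_linear_simps:
  assumes "f \<in> Ar C" "g \<in> Ar C"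
  shows "(c \<odot> f) \<boxtimes> g = c \<odot> (f \<boxtimes> g)" "f \<boxtimes> (c \<odot> g) = c \<odot> (f \<boxtimes> g)"
    "f' \<in> Ar C \<Longrightarrow> src C f' = src C f \<Longrightarrow> tgt C f' = tgt C f \<Longrightarrow> (f \<oplus> f') \<boxtimes> g = (f \<boxtimes> g) \<oplus> (f' \<boxtimes> g)"
  using assms tenA_scale_left[of f "src C f" "tgt C f" g "src C g" "tgt C g" c]
    tenA_scale_right[of f "src C f" "tgt C f" g "src C g" "tgt C g" c]
    tenA_add_left[of f "src C f" "tgt C f" f' g "src C g" "tgt C g"]
  by (auto simp: hom_iff)

primrec tprod :: "'o list \<Rightarrow> 'o" where
  "tprod [] = \<one>"
| "tprod (X # Xs) = X \<otimes> tprod Xs"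

text \<open>The canonical isomorphism from \<open>tprod A \<otimes> tprod B\<close> to
  \<open>tprod (A @ B)\<close>, which absorbs the factors of the first list one at a time. The rest
  of the file gets its coherence from \<open>tjoin_Nil_right\<close> and
  \<open>tjoin_assoc\<close>.\<close>

primrec tjoin :: "'o list \<Rightarrow> 'o list \<Rightarrow> 'a" where
  "tjoin [] Ys = lun C (tprod Ys)"
| "tjoin (X # Xs) Ys = (\<iota> X \<boxtimes> tjoin Xs Ys) \<cdot> \<alpha> X (tprod Xs) (tprod Ys)"

lemma tprod_Ob [simp]: "set A \<subseteq> Ob C \<Longrightarrow> tprod A \<in> Ob C"
  by (induction A) auto

lemma tjoin_iso_typing:
  assumes "set A \<subseteq> Ob C" "set B \<subseteq> Ob C"
  shows "iso_arr C (tjoin A B) \<and> tjoin A B \<in> Ar C \<and> src C (tjoin A B) = tprod A \<otimes> tprod B \<and> tgt C (tjoin A B) = tprod (A @ B)"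
  using assms by (induction A) auto

lemma tjoin_simps [simp]:
  assumes "set A \<subseteq> Ob C" "set B \<subseteq> Ob C"
  shows "iso_arr C (tjoin A B)" "tjoin A B \<in> Ar C" "src C (tjoin A B) = tprod A \<otimes> tprod B" "tgt C (tjoin A B) = tprod (A @ B)"
  using tjoin_iso_typing[OF assms] by auto

text \<open>The empty list requires \<open>lun_unt\<close>, and each further factor is an instance
  of \<open>run_tensor\<close>.\<close>

lemma tjoin_Nil_right: "set A \<subseteq> Ob C \<Longrightarrow> tjoin A [] = run C (tprod A)"
  by (induction A) (auto simp: lun_unt run_tensor)

text \<open>In the induction on A the empty list is \<open>lun_tensor\<close> with naturality of
  \<open>lun\<close>, and a further factor is the pentagon.\<close>

lemma tjoin_assoc:
  assumes "set A \<subseteq> Ob C" "set B \<subseteq> Ob C" "set D \<subseteq> Ob C"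
  shows "tjoin (A @ B) D \<cdot> (tjoin A B \<boxtimes> \<iota> (tprod D))
    = tjoin A (B @ D) \<cdot> ((\<iota> (tprod A) \<boxtimes> tjoin B D) \<cdot> \<alpha> (tprod A) (tprod B) (tprod D))"
  using assms(1)
proof (induction A)
  case Nil
  have "lun C (tprod (B @ D)) \<cdot> ((\<iota> \<one> \<boxtimes> tjoin B D) \<cdot> \<alpha> \<one> (tprod B) (tprod D))
    = (tjoin B D \<cdot> lun C (tprod B \<otimes> tprod D)) \<cdot> \<alpha> \<one> (tprod B) (tprod D)"
    using lun_natural_simp[of "tjoin B D"] assms by (simp add: cmp_assoc_simp[symmetric])
  also have "\<dots> = tjoin B D \<cdot> (lun C (tprod B) \<boxtimes> \<iota> (tprod D))"
    using assms by (simp add: cmp_assoc_simp lun_tensor)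
  finally show ?case by simp
next
  case (Cons X A)
  let ?A = "tprod A" and ?B = "tprod B" and ?D = "tprod D"
  have [simp]: "X \<in> Ob C" "set A \<subseteq> Ob C" "set B \<subseteq> Ob C" "set D \<subseteq> Ob C" using Cons assms by auto
  have n1: "\<alpha> X (tprod (A @ B)) ?D \<cdot> ((\<iota> X \<boxtimes> tjoin A B) \<boxtimes> \<iota> ?D)
     = (\<iota> X \<boxtimes> (tjoin A B \<boxtimes> \<iota> ?D)) \<cdot> \<alpha> X (?A \<otimes> ?B) ?D"
    using asc_natural_simp[of "\<iota> X" "tjoin A B" "\<iota> ?D"] by simp
  have n2: "\<alpha> X ?A (tprod (B @ D)) \<cdot> (\<iota> (X \<otimes> ?A) \<boxtimes> tjoin B D)
     = (\<iota> X \<boxtimes> (\<iota> ?A \<boxtimes> tjoin B D)) \<cdot> \<alpha> X ?A (?B \<otimes> ?D)"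
    using asc_natural_simp[of "\<iota> X" "\<iota> ?A" "tjoin B D"] by (simp add: tenA_ident)
  have "tjoin ((X # A) @ B) D \<cdot> (tjoin (X # A) B \<boxtimes> \<iota> ?D)
    = (\<iota> X \<boxtimes> tjoin (A @ B) D) \<cdot> ((\<alpha> X (tprod (A @ B)) ?D \<cdot> ((\<iota> X \<boxtimes> tjoin A B) \<boxtimes> \<iota> ?D)) \<cdot> (\<alpha> X ?A ?B \<boxtimes> \<iota> ?D))"
    by (simp add: tenA_cmp_right cmp_assoc_simp)
  also have "\<dots> = (\<iota> X \<boxtimes> (tjoin (A @ B) D \<cdot> (tjoin A B \<boxtimes> \<iota> ?D))) \<cdot> (\<alpha> X (?A \<otimes> ?B) ?D \<cdot> (\<alpha> X ?A ?B \<boxtimes> \<iota> ?D))"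
    unfolding n1 by (simp add: tenA_cmp_left cmp_assoc_simp)
  also have "\<dots> = (\<iota> X \<boxtimes> tjoin A (B @ D)) \<cdot> ((\<iota> X \<boxtimes> (\<iota> ?A \<boxtimes> tjoin B D)) \<cdot>
      ((\<iota> X \<boxtimes> \<alpha> ?A ?B ?D) \<cdot> (\<alpha> X (?A \<otimes> ?B) ?D \<cdot> (\<alpha> X ?A ?B \<boxtimes> \<iota> ?D))))"
    using Cons.IH by (simp add: tenA_cmp_left cmp_assoc_simp)
  also have "\<dots> = (\<iota> X \<boxtimes> tjoin A (B @ D)) \<cdot> ((\<alpha> X ?A (tprod (B @ D)) \<cdot> (\<iota> (X \<otimes> ?A) \<boxtimes> tjoin B D)) \<cdot> \<alpha> (X \<otimes> ?A) ?B ?D)"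
    unfolding n2 by (simp add: pentagon cmp_assoc_simp)
  finally show ?case by (simp add: cmp_assoc_simp)
qed

end

section \<open>The strict category of lists\<close>

context symmetric_monoidal_category
begin

text \<open>The strictification: an arrow from \<open>A\<close> to \<open>B\<close> is an arrow between the right-nested tensor products
  of these lists (ending in \<open>\<one>\<close>), together with \<open>A\<close> and \<open>B\<close>.\<close>

definition sobj :: "'o list \<Rightarrow> bool" where "sobj A \<longleftrightarrow> set A \<subseteq> Ob C"

definition sarr :: "'o list \<times> 'a \<times> 'o list \<Rightarrow> bool" where
  "sarr t \<longleftrightarrow> (case t of (A, f, B) \<Rightarrow> sobj A \<and> sobj B \<and> f \<in> Ar C \<and> src C f = tprod A \<and> tgt C f = tprod B)"

definition sdm :: "'o list \<times> 'a \<times> 'o list \<Rightarrow> 'o list" where "sdm t = fst t"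

definition scd :: "'o list \<times> 'a \<times> 'o list \<Rightarrow> 'o list" where "scd t = snd (snd t)"

definition sone :: "'o list \<Rightarrow> 'o list \<times> 'a \<times> 'o list" where "sone A = (A, \<iota> (tprod A), A)"

definition scomp :: "'o list \<times> 'a \<times> 'o list \<Rightarrow> 'o list \<times> 'a \<times> 'o list \<Rightarrow> 'o list \<times> 'a \<times> 'o list" where
  "scomp t u = (sdm u, fst (snd t) \<cdot> fst (snd u), scd t)"

text \<open>This is \<open>f \<boxtimes> g\<close> conjugated by the joining isomorphisms. Longer
  computations use its characterization in \<open>join_tens_natural\<close>, which is free of
  inverses.\<close>

definition join_tens :: "'o list \<Rightarrow> 'o list \<Rightarrow> 'o list \<Rightarrow> 'o list \<Rightarrow> 'a \<Rightarrow> 'a \<Rightarrow> 'a" where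
  "join_tens A A' B B' f g = tjoin B B' \<cdot> ((f \<boxtimes> g) \<cdot> inv_arr C (tjoin A A'))"

definition stens :: "'o list \<times> 'a \<times> 'o list \<Rightarrow> 'o list \<times> 'a \<times> 'o list \<Rightarrow> 'o list \<times> 'a \<times> 'o list" where
  "stens t u = (sdm t @ sdm u, join_tens (sdm t) (sdm u) (scd t) (scd u) (fst (snd t)) (fst (snd u)), scd t @ scd u)"

definition snul :: "'o list \<Rightarrow> 'o list \<Rightarrow> 'o list \<times> 'a \<times> 'o list" where "snul A B = (A, \<zero> (tprod A) (tprod B), B)"

definition splus :: "'o list \<times> 'a \<times> 'o list \<Rightarrow> 'o list \<times> 'a \<times> 'o list \<Rightarrow> 'o list \<times> 'a \<times> 'o list" where
  "splus t u = (sdm t, fst (snd t) \<oplus> fst (snd u), scd t)"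

definition sscal :: "complex \<Rightarrow> 'o list \<times> 'a \<times> 'o list \<Rightarrow> 'o list \<times> 'a \<times> 'o list" where
  "sscal c t = (sdm t, c \<odot> fst (snd t), scd t)"

definition join_br :: "'o list \<Rightarrow> 'o list \<Rightarrow> 'a" where
  "join_br A B = tjoin B A \<cdot> (\<beta> (tprod A) (tprod B) \<cdot> inv_arr C (tjoin A B))"

definition sbr :: "'o list \<Rightarrow> 'o list \<Rightarrow> 'o list \<times> 'a \<times> 'o list" where
  "sbr A B = (A @ B, join_br A B, B @ A)"

lemmas s_defs = sdm_def scd_def sone_def scomp_def stens_def snul_def splus_def sscal_def sbr_def

lemma sobj_simps [simp]: "sobj []" "sobj (A @ B) \<longleftrightarrow> sobj A \<and> sobj B" "sobj (X # A) \<longleftrightarrow> X \<in> Ob C \<and> sobj A"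
  by (auto simp: sobj_def)

lemma sobj_tprod [simp]: "sobj A \<Longrightarrow> tprod A \<in> Ob C"
  by (simp add: sobj_def)

lemma sobj_tjoin [simp]:
  assumes "sobj A" "sobj B"
  shows "iso_arr C (tjoin A B)" "tjoin A B \<in> Ar C" "src C (tjoin A B) = tprod A \<otimes> tprod B" "tgt C (tjoin A B) = tprod (A @ B)"
  using assms by (simp_all add: sobj_def)

lemma braiding_simps [simp]:
  assumes "X \<in> Ob C" "Y \<in> Ob C"
  shows "\<beta> X Y \<in> Ar C" "src C (\<beta> X Y) = X \<otimes> Y" "tgt C (\<beta> X Y) = Y \<otimes> X"
  using bra_hom[OF assms] by (auto simp: hom_iff)

lemma bra_natural_simp:
  assumes "f \<in> Ar C" "g \<in> Ar C"
  shows "\<beta> (tgt C f) (tgt C g) \<cdot> (f \<boxtimes> g) = (g \<boxtimes> f) \<cdot> \<beta> (src C f) (src C g)"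
  using bra_natural[of f "src C f" "tgt C f" g "src C g" "tgt C g"] assms by (auto simp: hom_iff)

lemma sarr_simp [simp]:
  "sarr (A, f, B) \<longleftrightarrow> sobj A \<and> sobj B \<and> f \<in> Ar C \<and> src C f = tprod A \<and> tgt C f = tprod B"
  by (simp add: sarr_def)

lemma join_tens_simps [simp]:
  assumes "sarr (A, f, B)" "sarr (A', g, B')"
  shows "join_tens A A' B B' f g \<in> Ar C" "src C (join_tens A A' B B' f g) = tprod (A @ A')"
    "tgt C (join_tens A A' B B' f g) = tprod (B @ B')"
  using assms by (simp_all add: join_tens_def)

lemma join_tens_natural:
  assumes "sarr (A, f, B)" "sarr (A', g, B')"
  shows "join_tens A A' B B' f g \<cdot> tjoin A A' = tjoin B B' \<cdot> (f \<boxtimes> g)"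
  using assms by (simp add: join_tens_def cmp_assoc_simp)

lemma join_tens_unique:
  assumes "sarr (A, f, B)" "sarr (A', g, B')" "h \<in> Ar C" "src C h = tprod (A @ A')"
    "h \<cdot> tjoin A A' = tjoin B B' \<cdot> (f \<boxtimes> g)"
  shows "h = join_tens A A' B B' f g"
  by (rule iso_cancel_right[of "tjoin A A'"]) (use assms join_tens_natural[OF assms(1,2)] in auto)

lemma join_br_simps [simp]:
  assumes "sobj A" "sobj B"
  shows "join_br A B \<in> Ar C" "src C (join_br A B) = tprod (A @ B)" "tgt C (join_br A B) = tprod (B @ A)"
  using assms by (simp_all add: join_br_def)

lemma join_br_natural:
  assumes "sobj A" "sobj B"
  shows "join_br A B \<cdot> tjoin A B = tjoin B A \<cdot> \<beta> (tprod A) (tprod B)"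
  using assms by (simp add: join_br_def cmp_assoc_simp)

text \<open>Both sides are compared after the isomorphism \<open>?M\<close> that joins three lists.
  \<open>tjoin_assoc\<close> gives its two forms at the source and at the target, and naturality of
  the associativity constraint connects them.\<close>

lemma join_tens_assoc:
  assumes f: "sarr (A, f, B)" "sarr (A', f', B')" "sarr (A'', f'', B'')"
  shows "join_tens (A @ A') A'' (B @ B') B'' (join_tens A A' B B' f f') f''
    = join_tens A (A' @ A'') B (B' @ B'') f (join_tens A' A'' B' B'' f' f'')"
    (is "?L = ?R")
proof (rule iso_cancel_right)
  note [simp] = f[simplified]
  let ?M = "tjoin (A @ A') A'' \<cdot> (tjoin A A' \<boxtimes> \<iota> (tprod A''))"
  let ?F = "join_tens A A' B B' f f'" and ?F' = "join_tens A' A'' B' B'' f' f''"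
  have F: "?F \<cdot> tjoin A A' = tjoin B B' \<cdot> (f \<boxtimes> f')" and F': "?F' \<cdot> tjoin A' A'' = tjoin B' B'' \<cdot> (f' \<boxtimes> f'')"
    using f by (auto intro!: join_tens_natural)
  have L: "?L \<cdot> tjoin (A @ A') A'' = tjoin (B @ B') B'' \<cdot> (?F \<boxtimes> f'')"
    and R: "?R \<cdot> tjoin A (A' @ A'') = tjoin B (B' @ B'') \<cdot> (f \<boxtimes> ?F')"
    by (auto intro!: join_tens_natural)
  have n: "\<alpha> (tprod B) (tprod B') (tprod B'') \<cdot> ((f \<boxtimes> f') \<boxtimes> f'') = (f \<boxtimes> (f' \<boxtimes> f'')) \<cdot> \<alpha> (tprod A) (tprod A') (tprod A'')"
    using asc_natural_simp[of f f' f''] by simp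
  have MA: "?M = tjoin A (A' @ A'') \<cdot> ((\<iota> (tprod A) \<boxtimes> tjoin A' A'') \<cdot> \<alpha> (tprod A) (tprod A') (tprod A''))"
    by (rule tjoin_assoc) (use f in \<open>auto simp: sobj_def\<close>)
  have MB: "tjoin (B @ B') B'' \<cdot> (tjoin B B' \<boxtimes> \<iota> (tprod B''))
    = tjoin B (B' @ B'') \<cdot> ((\<iota> (tprod B) \<boxtimes> tjoin B' B'') \<cdot> \<alpha> (tprod B) (tprod B') (tprod B''))"
    by (rule tjoin_assoc) (use f in \<open>auto simp: sobj_def\<close>)
  have "?L \<cdot> ?M = tjoin (B @ B') B'' \<cdot> ((?F \<cdot> tjoin A A') \<boxtimes> f'')"
    by (simp add: cmp_subst[OF L] cmp_assoc_simp tenA_interchange)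
  also have "\<dots> = (tjoin (B @ B') B'' \<cdot> (tjoin B B' \<boxtimes> \<iota> (tprod B''))) \<cdot> ((f \<boxtimes> f') \<boxtimes> f'')"
    unfolding F by (simp add: cmp_assoc_simp tenA_interchange)
  also have "\<dots> = tjoin B (B' @ B'') \<cdot> ((\<iota> (tprod B) \<boxtimes> tjoin B' B'') \<cdot> ((f \<boxtimes> (f' \<boxtimes> f'')) \<cdot> \<alpha> (tprod A) (tprod A') (tprod A'')))"
    unfolding MB by (simp add: cmp_assoc_simp n)
  also have "\<dots> = (tjoin B (B' @ B'') \<cdot> (f \<boxtimes> (?F' \<cdot> tjoin A' A''))) \<cdot> \<alpha> (tprod A) (tprod A') (tprod A'')"
    unfolding F' by (simp add: cmp_assoc_simp tenA_interchange cmp_subst[OF tenA_interchange])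
  also have "\<dots> = (tjoin B (B' @ B'') \<cdot> (f \<boxtimes> ?F')) \<cdot> ((\<iota> (tprod A) \<boxtimes> tjoin A' A'') \<cdot> \<alpha> (tprod A) (tprod A') (tprod A''))"
    by (simp add: cmp_assoc_simp tenA_interchange cmp_subst[OF tenA_interchange])
  also have "\<dots> = ?R \<cdot> ?M"
    unfolding MA R[symmetric] by (simp add: cmp_assoc_simp)
  finally show "?L \<cdot> ?M = ?R \<cdot> ?M" .
qed (use f in auto)

lemma join_tens_interchange:
  assumes "sarr (A, f, B)" "sarr (A', f', B')" "sarr (B, g, D)" "sarr (B', g', D')"
  shows "join_tens B B' D D' g g' \<cdot> join_tens A A' B B' f f' = join_tens A A' D D' (g \<cdot> f) (g' \<cdot> f')"
  using assms by (simp add: join_tens_def cmp_assoc_simp tenA_interchange cmp_subst[OF tenA_interchange])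

text \<open>The three associativity constraints of the hexagon are absorbed by three instances of
  \<open>tjoin_assoc\<close>. After \<open>?M\<close>, both sides become the same composite built
  from the right-hand side of the hexagon.\<close>

lemma join_br_append:
  assumes "sobj A" "sobj B" "sobj D"
  shows "join_br A (B @ D) = join_tens B (A @ D) B (D @ A) (\<iota> (tprod B)) (join_br A D) \<cdot>
    join_tens (A @ B) D (B @ A) D (join_br A B) (\<iota> (tprod D))" (is "?L = ?R2 \<cdot> ?R1")
proof (rule iso_cancel_right)
  note [simp] = assms
  have set [simp]: "set A \<subseteq> Ob C" "set B \<subseteq> Ob C" "set D \<subseteq> Ob C" using assms by (auto simp: sobj_def)
  let ?A = "tprod A" and ?B = "tprod B" and ?D = "tprod D"
  let ?M = "tjoin A (B @ D) \<cdot> ((\<iota> ?A \<boxtimes> tjoin B D) \<cdot> \<alpha> ?A ?B ?D)"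
  note ta = tjoin_assoc[of A B D, simplified] tjoin_assoc[of B D A, simplified] tjoin_assoc[of B A D, simplified]
  have n: "\<beta> ?A (tprod (B @ D)) \<cdot> (\<iota> ?A \<boxtimes> tjoin B D) = (tjoin B D \<boxtimes> \<iota> ?A) \<cdot> \<beta> ?A (?B \<otimes> ?D)"
    using bra_natural_simp[of "\<iota> ?A" "tjoin B D"] by simp
  have R1: "?R1 \<cdot> tjoin (A @ B) D = tjoin (B @ A) D \<cdot> (join_br A B \<boxtimes> \<iota> ?D)"
    by (rule join_tens_natural) auto
  have R2: "?R2 \<cdot> tjoin B (A @ D) = tjoin B (D @ A) \<cdot> (\<iota> ?B \<boxtimes> join_br A D)"
    by (rule join_tens_natural) auto
  have "?L \<cdot> ?M = (?L \<cdot> tjoin A (B @ D)) \<cdot> ((\<iota> ?A \<boxtimes> tjoin B D) \<cdot> \<alpha> ?A ?B ?D)"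
    by (simp add: cmp_assoc_simp)
  also have "\<dots> = tjoin (B @ D) A \<cdot> ((\<beta> ?A (tprod (B @ D)) \<cdot> (\<iota> ?A \<boxtimes> tjoin B D)) \<cdot> \<alpha> ?A ?B ?D)"
    using join_br_natural[of A "B @ D"] by (simp add: cmp_assoc_simp)
  also have "\<dots> = (tjoin (B @ D) A \<cdot> (tjoin B D \<boxtimes> \<iota> ?A)) \<cdot> (\<beta> ?A (?B \<otimes> ?D) \<cdot> \<alpha> ?A ?B ?D)"
    unfolding n by (simp add: cmp_assoc_simp)
  also have "\<dots> = tjoin B (D @ A) \<cdot> ((\<iota> ?B \<boxtimes> tjoin D A) \<cdot> (\<alpha> ?B ?D ?A \<cdot> (\<beta> ?A (?B \<otimes> ?D) \<cdot> \<alpha> ?A ?B ?D)))"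
    unfolding ta by (simp add: cmp_assoc_simp)
  also have "\<dots> = tjoin B (D @ A) \<cdot> ((\<iota> ?B \<boxtimes> (tjoin D A \<cdot> \<beta> ?A ?D)) \<cdot> (\<alpha> ?B ?A ?D \<cdot> (\<beta> ?A ?B \<boxtimes> \<iota> ?D)))"
    by (simp add: hexagon tenA_cmp_left cmp_assoc_simp)
  finally have L: "?L \<cdot> ?M = tjoin B (D @ A) \<cdot> ((\<iota> ?B \<boxtimes> (tjoin D A \<cdot> \<beta> ?A ?D)) \<cdot> (\<alpha> ?B ?A ?D \<cdot> (\<beta> ?A ?B \<boxtimes> \<iota> ?D)))" .
  have "(?R2 \<cdot> ?R1) \<cdot> ?M = ?R2 \<cdot> ((?R1 \<cdot> tjoin (A @ B) D) \<cdot> (tjoin A B \<boxtimes> \<iota> ?D))"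
    unfolding ta(1)[symmetric] by (simp add: cmp_assoc_simp)
  also have "\<dots> = ?R2 \<cdot> (tjoin (B @ A) D \<cdot> ((join_br A B \<cdot> tjoin A B) \<boxtimes> \<iota> ?D))"
    unfolding R1 by (simp add: tenA_cmp_right cmp_assoc_simp)
  also have "\<dots> = ?R2 \<cdot> ((tjoin (B @ A) D \<cdot> (tjoin B A \<boxtimes> \<iota> ?D)) \<cdot> (\<beta> ?A ?B \<boxtimes> \<iota> ?D))"
    using join_br_natural[of A B] by (simp add: tenA_cmp_right cmp_assoc_simp)
  also have "\<dots> = (?R2 \<cdot> tjoin B (A @ D)) \<cdot> ((\<iota> ?B \<boxtimes> tjoin A D) \<cdot> (\<alpha> ?B ?A ?D \<cdot> (\<beta> ?A ?B \<boxtimes> \<iota> ?D)))"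
    unfolding ta by (simp add: cmp_assoc_simp)
  also have "\<dots> = tjoin B (D @ A) \<cdot> ((\<iota> ?B \<boxtimes> (join_br A D \<cdot> tjoin A D)) \<cdot> (\<alpha> ?B ?A ?D \<cdot> (\<beta> ?A ?B \<boxtimes> \<iota> ?D)))"
    unfolding R2 by (simp add: tenA_cmp_left cmp_assoc_simp)
  finally show "?L \<cdot> ?M = (?R2 \<cdot> ?R1) \<cdot> ?M"
    unfolding L using join_br_natural[of A D] by simp
qed (use assms in auto)

lemma join_tens_unit:
  assumes "sarr (A, f, B)"
  shows "join_tens [] A [] B (\<iota> \<one>) f = f" "join_tens A [] B [] f (\<iota> \<one>) = f"
  using assms lun_natural_simp[of f] run_natural_simp[of f]
  by (auto intro!: join_tens_unique[symmetric] simp: tjoin_Nil_right[OF iffD1[OF sobj_def]])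

lemma join_tens_one:
  assumes "sobj A" "sobj B"
  shows "join_tens A B A B (\<iota> (tprod A)) (\<iota> (tprod B)) = \<iota> (tprod (A @ B))"
  using assms by (simp add: join_tens_def tenA_ident)

lemma join_tens_linear:
  assumes "sarr (A, f, B)" "sarr (A', g, B')"
  shows "join_tens A A' B B' (c \<odot> f) g = c \<odot> join_tens A A' B B' f g"
    "join_tens A A' B B' f (c \<odot> g) = c \<odot> join_tens A A' B B' f g"
    "sarr (A, f', B) \<Longrightarrow> join_tens A A' B B' (f \<oplus> f') g = join_tens A A' B B' f g \<oplus> join_tens A A' B B' f' g"
  using assms by (simp_all add: join_tens_def tenA_linear_simps scale_simps add_simps(2-5))

lemma join_br_natural_arrows:
  assumes "sarr (A, f, B)" "sarr (A', g, B')"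
  shows "join_br B B' \<cdot> join_tens A A' B B' f g = join_tens A' A B' B g f \<cdot> join_br A A'"
proof -
  have n: "\<beta> (tprod B) (tprod B') \<cdot> (f \<boxtimes> g) = (g \<boxtimes> f) \<cdot> \<beta> (tprod A) (tprod A')"
    using bra_natural_simp[of f g] assms by simp
  show ?thesis using assms
    by (simp add: join_tens_def join_br_def cmp_assoc_simp cmp_subst[OF n])
qed

lemma join_br_symmetric:
  assumes "sobj A" "sobj B"
  shows "join_br B A \<cdot> join_br A B = \<iota> (tprod (A @ B))"
  using assms by (simp add: join_br_def cmp_assoc_simp bra_symmetric cmp_subst[OF bra_symmetric])

lemma strict_category:
  "strict_category sobj sarr sdm scd sone scomp stens snul splus sscal sbr"
  by unfold_locales
    (auto simp: s_defs add_simps(2-5) scale_simps add_zer_simp join_tens_linear join_tens_assoc join_tens_unit join_tens_one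
      join_tens_interchange join_br_natural_arrows join_br_symmetric join_br_append cmp_assoc_simp
      intro: add_simps(1))

end

section \<open>Transport of duals to the strict category\<close>

context rigid_symmetric_category
begin

text \<open>The duality axioms for arbitrary data, so that the chosen duals can be transported along
  isomorphisms.\<close>

definition dual_pair :: "'o \<Rightarrow> 'o \<Rightarrow> 'a \<Rightarrow> 'a \<Rightarrow> bool" where
  "dual_pair X D c e \<longleftrightarrow> X \<in> Ob C \<and> D \<in> Ob C \<and> c \<in> Ar C \<and> src C c = \<one> \<and> tgt C c = X \<otimes> D \<and>
     e \<in> Ar C \<and> src C e = D \<otimes> X \<and> tgt C e = \<one> \<and>
     run C X \<cdot> (\<iota> X \<boxtimes> e) \<cdot> \<alpha> X D X \<cdot> (c \<boxtimes> \<iota> X) = lun C X \<and>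
     lun C D \<cdot> (e \<boxtimes> \<iota> D) \<cdot> inv_arr C (\<alpha> D X D) \<cdot> (\<iota> D \<boxtimes> c) = run C D"

lemma dual_pairD:
  assumes "dual_pair X D c e"
  shows "X \<in> Ob C" "D \<in> Ob C" "c \<in> Ar C" "src C c = \<one>" "tgt C c = X \<otimes> D"
    "e \<in> Ar C" "src C e = D \<otimes> X" "tgt C e = \<one>"
    "run C X \<cdot> (\<iota> X \<boxtimes> e) \<cdot> \<alpha> X D X \<cdot> (c \<boxtimes> \<iota> X) = lun C X"
    "lun C D \<cdot> (e \<boxtimes> \<iota> D) \<cdot> inv_arr C (\<alpha> D X D) \<cdot> (\<iota> D \<boxtimes> c) = run C D"
  using assms by (auto simp: dual_pair_def)

lemma dual_pair_dua: "V \<in> Ob C \<Longrightarrow> dual_pair V (dua C V) (coev C V) (ev C V)"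
  using dua_Ob[of V] coev_hom[of V] ev_hom[of V] duality_left[of V] duality_right[of V]
  by (auto simp: dual_pair_def hom_iff)

text \<open>A one-element list has the tensor product \<open>D \<otimes> \<one>\<close> instead of
  D, so duals must be moved along such isomorphisms. After composing with \<psi> or \<rho>,
  naturality of the constraints reduces each zigzag to the old one.\<close>

lemma dual_pair_iso:
  assumes d: "dual_pair Y D c e"
    and \<psi>: "iso_arr C \<psi>" "src C \<psi> = Y" "tgt C \<psi> = X" and \<rho>: "iso_arr C \<rho>" "src C \<rho> = D" "tgt C \<rho> = E"
  shows "dual_pair X E ((\<psi> \<boxtimes> \<rho>) \<cdot> c) (e \<cdot> (inv_arr C \<rho> \<boxtimes> inv_arr C \<psi>))"
proof -
  note [simp] = dual_pairD(1-8)[OF d] \<psi> \<rho>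
  have [simp]: "X \<in> Ob C" "E \<in> Ob C"
    using src_tgt_Ob(2)[of \<psi>] src_tgt_Ob(2)[of \<rho>] by simp_all
  let ?c = "(\<psi> \<boxtimes> \<rho>) \<cdot> c" and ?e = "e \<cdot> (inv_arr C \<rho> \<boxtimes> inv_arr C \<psi>)"
  have n1: "\<alpha> X E X \<cdot> ((\<psi> \<boxtimes> \<rho>) \<boxtimes> \<psi>) = (\<psi> \<boxtimes> (\<rho> \<boxtimes> \<psi>)) \<cdot> \<alpha> Y D Y"
    using asc_natural_simp[of \<psi> \<rho> \<psi>] by simp
  have z1: "run C X \<cdot> (\<iota> X \<boxtimes> ?e) \<cdot> \<alpha> X E X \<cdot> (?c \<boxtimes> \<iota> X) = lun C X"
  proof (rule iso_cancel_right[of "\<iota> \<one> \<boxtimes> \<psi>"])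
    have "(run C X \<cdot> (\<iota> X \<boxtimes> ?e) \<cdot> \<alpha> X E X \<cdot> (?c \<boxtimes> \<iota> X)) \<cdot> (\<iota> \<one> \<boxtimes> \<psi>)
      = run C X \<cdot> (\<iota> X \<boxtimes> ?e) \<cdot> (\<alpha> X E X \<cdot> ((\<psi> \<boxtimes> \<rho>) \<boxtimes> \<psi>)) \<cdot> (c \<boxtimes> \<iota> Y)"
      by (simp add: cmp_assoc_simp tenA_interchange)
    also have "\<dots> = (run C X \<cdot> (\<psi> \<boxtimes> \<iota> \<one>)) \<cdot> (\<iota> Y \<boxtimes> e) \<cdot> \<alpha> Y D Y \<cdot> (c \<boxtimes> \<iota> Y)"
      unfolding n1 by (simp add: cmp_assoc_simp tenA_interchange tenA_ident cmp_subst[OF tenA_interchange])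
    also have "\<dots> = \<psi> \<cdot> (run C Y \<cdot> (\<iota> Y \<boxtimes> e) \<cdot> \<alpha> Y D Y \<cdot> (c \<boxtimes> \<iota> Y))"
      using run_natural_simp[of \<psi>] by (simp add: cmp_assoc_simp)
    also have "\<dots> = lun C X \<cdot> (\<iota> \<one> \<boxtimes> \<psi>)"
      unfolding dual_pairD(9)[OF d] using lun_natural_simp[of \<psi>] by simp
    finally show "(run C X \<cdot> (\<iota> X \<boxtimes> ?e) \<cdot> \<alpha> X E X \<cdot> (?c \<boxtimes> \<iota> X)) \<cdot> (\<iota> \<one> \<boxtimes> \<psi>) = lun C X \<cdot> (\<iota> \<one> \<boxtimes> \<psi>)" .
  qed auto
  have n2: "inv_arr C (\<alpha> E X E) \<cdot> (\<rho> \<boxtimes> (\<psi> \<boxtimes> \<rho>)) = ((\<rho> \<boxtimes> \<psi>) \<boxtimes> \<rho>) \<cdot> inv_arr C (\<alpha> D Y D)"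
  proof (rule iso_cancel_right[of "\<alpha> D Y D"])
    have "(\<rho> \<boxtimes> (\<psi> \<boxtimes> \<rho>)) \<cdot> \<alpha> D Y D = \<alpha> E X E \<cdot> ((\<rho> \<boxtimes> \<psi>) \<boxtimes> \<rho>)"
      using asc_natural_simp[of \<rho> \<psi> \<rho>] by simp
    then show "(inv_arr C (\<alpha> E X E) \<cdot> (\<rho> \<boxtimes> (\<psi> \<boxtimes> \<rho>))) \<cdot> \<alpha> D Y D = (((\<rho> \<boxtimes> \<psi>) \<boxtimes> \<rho>) \<cdot> inv_arr C (\<alpha> D Y D)) \<cdot> \<alpha> D Y D"
      by (simp add: cmp_assoc_simp)
  qed auto
  have z2: "lun C E \<cdot> (?e \<boxtimes> \<iota> E) \<cdot> inv_arr C (\<alpha> E X E) \<cdot> (\<iota> E \<boxtimes> ?c) = run C E"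
  proof (rule iso_cancel_right[of "\<rho> \<boxtimes> \<iota> \<one>"])
    have "(lun C E \<cdot> (?e \<boxtimes> \<iota> E) \<cdot> inv_arr C (\<alpha> E X E) \<cdot> (\<iota> E \<boxtimes> ?c)) \<cdot> (\<rho> \<boxtimes> \<iota> \<one>)
      = lun C E \<cdot> (?e \<boxtimes> \<iota> E) \<cdot> (inv_arr C (\<alpha> E X E) \<cdot> (\<rho> \<boxtimes> (\<psi> \<boxtimes> \<rho>))) \<cdot> (\<iota> D \<boxtimes> c)"
      by (simp add: cmp_assoc_simp tenA_interchange)
    also have "\<dots> = (lun C E \<cdot> (\<iota> \<one> \<boxtimes> \<rho>)) \<cdot> (e \<boxtimes> \<iota> D) \<cdot> inv_arr C (\<alpha> D Y D) \<cdot> (\<iota> D \<boxtimes> c)"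
      unfolding n2 by (simp add: cmp_assoc_simp tenA_interchange tenA_ident cmp_subst[OF tenA_interchange])
    also have "\<dots> = \<rho> \<cdot> (lun C D \<cdot> (e \<boxtimes> \<iota> D) \<cdot> inv_arr C (\<alpha> D Y D) \<cdot> (\<iota> D \<boxtimes> c))"
      using lun_natural_simp[of \<rho>] by (simp add: cmp_assoc_simp)
    also have "\<dots> = run C E \<cdot> (\<rho> \<boxtimes> \<iota> \<one>)"
      unfolding dual_pairD(10)[OF d] using run_natural_simp[of \<rho>] by simp
    finally show "(lun C E \<cdot> (?e \<boxtimes> \<iota> E) \<cdot> inv_arr C (\<alpha> E X E) \<cdot> (\<iota> E \<boxtimes> ?c)) \<cdot> (\<rho> \<boxtimes> \<iota> \<one>) = run C E \<cdot> (\<rho> \<boxtimes> \<iota> \<one>)" .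
  qed auto
  show ?thesis unfolding dual_pair_def using z1 z2 by simp
qed

interpretation S: strict_category sobj sarr sdm scd sone scomp stens snul splus sscal sbr
  by (rule strict_category)

text \<open>The constraints in the zigzags of C are those hidden in the strict tensor product:
  associativity by \<open>tjoin_assoc\<close>, units because joining with an empty list is a unit
  constraint.\<close>

lemma strict_dual:
  assumes A: "sobj A" "sobj B" and d: "dual_pair (tprod A) (tprod B) c e"
  shows "S.dual A B ([], tjoin A B \<cdot> c, A @ B) (B @ A, e \<cdot> inv_arr C (tjoin B A), [])"
proof -
  note [simp] = dual_pairD(1-8)[OF d] A
  have set [simp]: "set A \<subseteq> Ob C" "set B \<subseteq> Ob C" using A by (auto simp: sobj_def)
  let ?A = "tprod A" and ?B = "tprod B"
  let ?c = "tjoin A B \<cdot> c" and ?e = "e \<cdot> inv_arr C (tjoin B A)"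
  let ?T1 = "join_tens [] A (A @ B) A ?c (\<iota> ?A)" and ?T2 = "join_tens A (B @ A) A [] (\<iota> ?A) ?e"
  have T1: "?T1 \<cdot> lun C ?A = tjoin (A @ B) A \<cdot> (?c \<boxtimes> \<iota> ?A)"
    and T2: "?T2 \<cdot> tjoin A (B @ A) = run C ?A \<cdot> (\<iota> ?A \<boxtimes> ?e)"
    using join_tens_natural[of "[]" ?c "A @ B" A "\<iota> ?A" A] join_tens_natural[of A "\<iota> ?A" A "B @ A" ?e "[]"]
    by (simp_all add: tjoin_Nil_right)
  have z1: "?T2 \<cdot> ?T1 = \<iota> ?A"
  proof (rule iso_cancel_right[of "lun C ?A"])
    have "(?T2 \<cdot> ?T1) \<cdot> lun C ?A = ?T2 \<cdot> (tjoin (A @ B) A \<cdot> (tjoin A B \<boxtimes> \<iota> ?A)) \<cdot> (c \<boxtimes> \<iota> ?A)"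
      by (simp add: cmp_assoc_simp T1 tenA_cmp_right)
    also have "\<dots> = (?T2 \<cdot> tjoin A (B @ A)) \<cdot> (\<iota> ?A \<boxtimes> tjoin B A) \<cdot> \<alpha> ?A ?B ?A \<cdot> (c \<boxtimes> \<iota> ?A)"
      by (simp add: tjoin_assoc cmp_assoc_simp)
    also have "\<dots> = run C ?A \<cdot> (\<iota> ?A \<boxtimes> e) \<cdot> \<alpha> ?A ?B ?A \<cdot> (c \<boxtimes> \<iota> ?A)"
      unfolding T2 by (simp add: cmp_assoc_simp cmp_subst[OF tenA_interchange])
    finally show "(?T2 \<cdot> ?T1) \<cdot> lun C ?A = \<iota> ?A \<cdot> lun C ?A"
      unfolding dual_pairD(9)[OF d] by simp
  qed auto
  let ?T3 = "join_tens B [] B (A @ B) (\<iota> ?B) ?c" and ?T4 = "join_tens (B @ A) B [] B ?e (\<iota> ?B)"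
  have T3: "?T3 \<cdot> run C ?B = tjoin B (A @ B) \<cdot> (\<iota> ?B \<boxtimes> ?c)"
    and T4: "?T4 \<cdot> tjoin (B @ A) B = lun C ?B \<cdot> (?e \<boxtimes> \<iota> ?B)"
    using join_tens_natural[of B "\<iota> ?B" B "[]" ?c "A @ B"] join_tens_natural[of "B @ A" ?e "[]" B "\<iota> ?B" B]
    by (simp_all add: tjoin_Nil_right)
  have j: "tjoin B (A @ B) \<cdot> (\<iota> ?B \<boxtimes> tjoin A B) = tjoin (B @ A) B \<cdot> (tjoin B A \<boxtimes> \<iota> ?B) \<cdot> inv_arr C (\<alpha> ?B ?A ?B)"
    by (rule iso_cancel_right[of "\<alpha> ?B ?A ?B"])
      (simp_all add: tjoin_assoc[symmetric] cmp_assoc_simp)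
  have z2: "?T4 \<cdot> ?T3 = \<iota> ?B"
  proof (rule iso_cancel_right[of "run C ?B"])
    have "(?T4 \<cdot> ?T3) \<cdot> run C ?B = ?T4 \<cdot> (tjoin B (A @ B) \<cdot> (\<iota> ?B \<boxtimes> tjoin A B)) \<cdot> (\<iota> ?B \<boxtimes> c)"
      by (simp add: cmp_assoc_simp T3 tenA_cmp_left)
    also have "\<dots> = (?T4 \<cdot> tjoin (B @ A) B) \<cdot> (tjoin B A \<boxtimes> \<iota> ?B) \<cdot> inv_arr C (\<alpha> ?B ?A ?B) \<cdot> (\<iota> ?B \<boxtimes> c)"
      unfolding j by (simp add: cmp_assoc_simp)
    also have "\<dots> = lun C ?B \<cdot> (e \<boxtimes> \<iota> ?B) \<cdot> inv_arr C (\<alpha> ?B ?A ?B) \<cdot> (\<iota> ?B \<boxtimes> c)"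
      unfolding T4 by (simp add: cmp_assoc_simp cmp_subst[OF tenA_interchange])
    finally show "(?T4 \<cdot> ?T3) \<cdot> run C ?B = \<iota> ?B \<cdot> run C ?B"
      unfolding dual_pairD(10)[OF d] by simp
  qed auto
  show ?thesis unfolding S.dual_def using z1 z2 by (simp add: s_defs)
qed

text \<open>The dual of the list A is taken to be \<open>[D]\<close>, reached by
  \<open>?\<rho>\<close> from D to \<open>D \<otimes> \<one>\<close>. Naturality of the braiding
  cancels \<psi> and \<open>?\<rho>\<close> against their inverses, so the loop keeps its
  value.\<close>

lemma strict_has_dim:
  assumes Y: "Y \<in> Ob C" and A: "sobj A" and \<psi>: "iso_arr C \<psi>" "src C \<psi> = Y" "tgt C \<psi> = tprod A"
    and z: "ev C Y \<cdot> \<beta> Y (dua C Y) \<cdot> coev C Y = z \<odot> \<iota> \<one>"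
  shows "S.has_dim A z"
proof -
  define D where "D = dua C Y"
  have D [simp]: "D \<in> Ob C" unfolding D_def by (rule dua_Ob[OF Y])
  have d: "dual_pair Y D (coev C Y) (ev C Y)" unfolding D_def by (rule dual_pair_dua[OF Y])
  let ?\<rho> = "inv_arr C (run C D)"
  let ?c = "(\<psi> \<boxtimes> ?\<rho>) \<cdot> coev C Y" and ?e = "ev C Y \<cdot> (inv_arr C ?\<rho> \<boxtimes> inv_arr C \<psi>)"
  note [simp] = \<psi> A Y dual_pairD(1-8)[OF d]
  have dA: "dual_pair (tprod A) (tprod [D]) ?c ?e"
    by (rule dual_pair_iso[OF d]) auto
  have "?e \<cdot> \<beta> (tprod A) (tprod [D]) \<cdot> ?c = ev C Y \<cdot> (inv_arr C ?\<rho> \<boxtimes> inv_arr C \<psi>) \<cdot> (\<beta> (tprod A) (tprod [D]) \<cdot> (\<psi> \<boxtimes> ?\<rho>)) \<cdot> coev C Y"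
    by (simp add: cmp_assoc_simp)
  also have "\<beta> (tprod A) (tprod [D]) \<cdot> (\<psi> \<boxtimes> ?\<rho>) = (?\<rho> \<boxtimes> \<psi>) \<cdot> \<beta> Y D"
    using bra_natural_simp[of \<psi> ?\<rho>] by simp
  also have "ev C Y \<cdot> (inv_arr C ?\<rho> \<boxtimes> inv_arr C \<psi>) \<cdot> ((?\<rho> \<boxtimes> \<psi>) \<cdot> \<beta> Y D) \<cdot> coev C Y = ev C Y \<cdot> \<beta> Y D \<cdot> coev C Y"
    by (simp add: cmp_assoc_simp cmp_subst[OF tenA_interchange] tenA_ident)
  finally have "?e \<cdot> \<beta> (tprod A) (tprod [D]) \<cdot> ?c = z \<odot> \<iota> \<one>" using z by (simp add: D_def)
  \<comment> \<open>The transported duality becomes opaque variables, which keeps the simplifier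
    from taking it apart again.\<close>
  then obtain c e where ce: "dual_pair (tprod A) (tprod [D]) c e"
    and t: "e \<cdot> \<beta> (tprod A) (tprod [D]) \<cdot> c = z \<odot> \<iota> \<one>" using dA by blast
  note [simp] = dual_pairD(1-8)[OF ce]
  have D1: "sobj [D]" by simp
  have "S.dual A [D] ([], tjoin A [D] \<cdot> c, A @ [D]) ([D] @ A, e \<cdot> inv_arr C (tjoin [D] A), [])"
    by (rule strict_dual[OF A D1 ce])
  moreover have "scomp ([D] @ A, e \<cdot> inv_arr C (tjoin [D] A), []) (scomp (sbr A [D]) ([], tjoin A [D] \<cdot> c, A @ [D]))
    = sscal z (sone [])"
    using t D1 by (simp add: s_defs join_br_def cmp_assoc_simp del: tprod.simps(2) tjoin.simps)
  ultimately show ?thesis by (rule S.has_dimI)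
qed

end

section \<open>Monomorphisms, epimorphisms, kernels and cokernels\<close>

context abelian_category
begin

text \<open>The composite \<open>k \<cdot> g\<close> is killed by f, and uniqueness of its
  factorization through k is cancellation.\<close>

lemma kernel_mono:
  assumes k: "is_kernel C f k" shows "mono_arr C k"
  unfolding mono_arr_def
proof (intro conjI allI ballI impI)
  show k1: "k \<in> Ar C" using k by (simp add: is_kernel_def)
  fix W g h assume g: "g \<in> hom C W (src C k)" and h: "h \<in> hom C W (src C k)" and gh: "k \<cdot> g = k \<cdot> h"
  have f: "f \<in> Ar C" "tgt C k = src C f" "f \<cdot> k = \<zero> (src C k) (tgt C f)" using k by (auto simp: is_kernel_def)
  have g': "g \<in> Ar C" "src C g = W" "tgt C g = src C k" and h': "h \<in> Ar C" "src C h = W" "tgt C h = src C k"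
    using g h by (auto simp: hom_iff)
  have "f \<cdot> (k \<cdot> g) = (f \<cdot> k) \<cdot> g"
    using f(1,2) k1 g' by (simp add: cmp_assoc_simp)
  also have "\<dots> = \<zero> W (tgt C f)" using f k1 g' by simp
  finally have "\<exists>!u. u \<in> hom C W (src C k) \<and> k \<cdot> u = k \<cdot> g"
    using k k1 f(2) g' unfolding is_kernel_def by (auto simp: hom_iff)
  then show "g = h" using g h gh by metis
qed

lemma cokernel_epi:
  assumes q: "is_cokernel C f q" shows "epi_arr C q"
  unfolding epi_arr_def
proof (intro conjI allI ballI impI)
  show q1: "q \<in> Ar C" using q by (simp add: is_cokernel_def)
  fix Z g h assume g: "g \<in> hom C (tgt C q) Z" and h: "h \<in> hom C (tgt C q) Z" and gh: "g \<cdot> q = h \<cdot> q"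
  have f: "f \<in> Ar C" "src C q = tgt C f" "q \<cdot> f = \<zero> (src C f) (tgt C q)" using q by (auto simp: is_cokernel_def)
  have g': "g \<in> Ar C" "tgt C g = Z" "src C g = tgt C q" and h': "h \<in> Ar C" "tgt C h = Z" "src C h = tgt C q"
    using g h by (auto simp: hom_iff)
  have "(g \<cdot> q) \<cdot> f = g \<cdot> (q \<cdot> f)"
    using f(1,2) q1 g' by (simp add: cmp_assoc_simp)
  also have "\<dots> = \<zero> (src C f) Z" using f q1 g' by simp
  finally have "\<exists>!u. u \<in> hom C (tgt C q) Z \<and> u \<cdot> q = g \<cdot> q"
    using q q1 f(2) g' unfolding is_cokernel_def by (auto simp: hom_iff)
  then show "g = h" using g h gh by metis
qed

text \<open>A monomorphism is the kernel of its cokernel: it is the kernel of some \<open>f\<close>, and \<open>f\<close> factors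
  through the cokernel.\<close>

lemma mono_kernel_of_cokernel:
  assumes i: "mono_arr C i" and q: "is_cokernel C i q"
  shows "is_kernel C q i"
proof -
  obtain f where f: "is_kernel C f i" using mono_is_kernel[OF i] by blast
  have i1: "i \<in> Ar C" "tgt C i = src C f" and f1: "f \<in> Ar C" "f \<cdot> i = \<zero> (src C i) (tgt C f)"
    using f by (auto simp: is_kernel_def)
  have q1: "q \<in> Ar C" "src C q = tgt C i" "q \<cdot> i = \<zero> (src C i) (tgt C q)" using q by (auto simp: is_cokernel_def)
  obtain l where l: "l \<in> Ar C" "src C l = tgt C q" "tgt C l = tgt C f" "l \<cdot> q = f"
    using is_cokernel_factor[OF q f1(1)] f1 i1 by auto
  have "\<exists>!u. u \<in> hom C W (src C i) \<and> i \<cdot> u = g"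
    if g: "g \<in> hom C W (src C q)" "q \<cdot> g = \<zero> W (tgt C q)" for W g
  proof -
    have g': "g \<in> Ar C" "src C g = W" "tgt C g = src C q" using g by (auto simp: hom_iff)
    have "f \<cdot> g = l \<cdot> (q \<cdot> g)" using l q1 g' by (simp add: cmp_subst[OF l(4)])
    also have "\<dots> = \<zero> W (tgt C f)" using g(2) g' l src_tgt_Ob(1)[of g] by simp
    finally show ?thesis using f g' q1 i1 unfolding is_kernel_def by (auto simp: hom_iff)
  qed
  then show ?thesis using q1 i1 unfolding is_kernel_def by auto
qed

end

section \<open>The strict category is abelian\<close>

context symmetric_tensor_category
begin

interpretation S: strict_category sobj sarr sdm scd sone scomp stens snul splus sscal sbr
  by (rule strict_category)

lemma strict_dual_exists:
  assumes "sobj A" shows "\<exists>B c e. S.dual A B c e"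
proof -
  have [simp]: "tprod A \<in> Ob C" using assms by simp
  let ?D = "dua C (tprod A)"
  have D [simp]: "?D \<in> Ob C" "sobj [?D]" using dua_Ob[of "tprod A"] by simp_all
  have "dual_pair (tprod A) (tprod [?D]) ((\<iota> (tprod A) \<boxtimes> inv_arr C (run C ?D)) \<cdot> coev C (tprod A))
    (ev C (tprod A) \<cdot> (inv_arr C (inv_arr C (run C ?D)) \<boxtimes> inv_arr C (\<iota> (tprod A))))"
    by (rule dual_pair_iso[OF dual_pair_dua]) auto
  then show ?thesis using strict_dual[OF assms D(2)] by blast
qed

text \<open>The kernel object K enters as the list \<open>[K]\<close> with tensor product
  \<open>K \<otimes> \<one>\<close>, so the kernel arrow is preceded by \<open>run\<close>.\<close>

lemma strict_kernel_exists:
  assumes f: "sarr f" shows "\<exists>k. S.kernel f k"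
proof -
  obtain A f0 B where f_eq: "f = (A, f0, B)" by (cases f)
  have f' [simp]: "sobj A" "sobj B" "f0 \<in> Ar C" "src C f0 = tprod A" "tgt C f0 = tprod B"
    using f by (auto simp: f_eq)
  obtain k where k: "is_kernel C f0 k" using ex_kernel[of f0] by auto
  have k' [simp]: "k \<in> Ar C" "tgt C k = tprod A" "f0 \<cdot> k = \<zero> (src C k) (tprod B)" using k by (auto simp: is_kernel_def)
  have mono: "mono_arr C k" by (rule kernel_mono[OF k])
  let ?r = "run C (src C k)" and ?k = "([src C k], k \<cdot> run C (src C k), A)"
  have K: "sarr ?k" by simp
  have "S.kernel f ?k" unfolding S.kernel_def S.monic_def
  proof (intro conjI allI impI)
    fix g h assume gh: "sarr g" "sarr h" "scd g = sdm ?k" "scd h = sdm ?k" "sdm g = sdm h" "scomp ?k g = scomp ?k h"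
    obtain W g0 h0 where gh_eq: "g = (W, g0, [src C k])" "h = (W, h0, [src C k])"
      using gh(3-5) by (cases g; cases h) (auto simp: s_defs)
    have [simp]: "sobj W" "g0 \<in> Ar C" "src C g0 = tprod W" "tgt C g0 = src C k \<otimes> \<one>"
      "h0 \<in> Ar C" "src C h0 = tprod W" "tgt C h0 = src C k \<otimes> \<one>"
      using gh(1,2) by (auto simp: gh_eq)
    have "k \<cdot> (?r \<cdot> g0) = k \<cdot> (?r \<cdot> h0)" using gh(6) by (simp add: gh_eq s_defs cmp_assoc_simp)
    then have "?r \<cdot> g0 = ?r \<cdot> h0" using mono unfolding mono_arr_def by (auto simp: hom_iff)
    then have "g0 = h0" by (rule iso_cancel_left[rotated]) auto
    then show "g = h" by (simp add: gh_eq)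
  next
    fix g assume g: "sarr g" "scd g = sdm f" "scomp f g = snul (sdm g) (scd f)"
    obtain W g0 where g_eq: "g = (W, g0, A)"
      using g(2) by (cases g) (auto simp: s_defs f_eq)
    have [simp]: "sobj W" "g0 \<in> Ar C" "src C g0 = tprod W" "tgt C g0 = tprod A"
      using g(1) by (auto simp: g_eq)
    have "f0 \<cdot> g0 = \<zero> (tprod W) (tprod B)" using g(3) by (simp add: g_eq f_eq s_defs)
    then obtain u where u: "u \<in> Ar C" "src C u = tprod W" "tgt C u = src C k" "k \<cdot> u = g0"
      using is_kernel_factor[OF k, of g0] by auto
    then show "\<exists>u. sarr u \<and> sdm u = sdm g \<and> scd u = sdm ?k \<and> scomp ?k u = g"
      by (intro exI[of _ "(W, inv_arr C ?r \<cdot> u, [src C k])"]) (simp add: g_eq s_defs cmp_assoc_simp)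
  qed (auto simp: f_eq s_defs cmp_assoc_simp cmp_subst[OF k'(3)])
  then show ?thesis by blast
qed

text \<open>One-element lists detect that the underlying arrow is epic in C, where it is the
  cokernel of some f. Preceded by \<open>run\<close>, this f is itself a strict arrow killed by
  \<open>b\<close>, hence by \<open>g\<close>, and the universal property applies.\<close>

lemma strict_epic_factor:
  assumes b: "S.epic b" and g: "sarr g" "sdm g = sdm b"
    and bg: "\<And>h. sarr h \<Longrightarrow> scd h = sdm b \<Longrightarrow> scomp b h = snul (sdm h) (scd b) \<Longrightarrow> scomp g h = snul (sdm h) (scd g)"
  shows "\<exists>u. sarr u \<and> sdm u = scd b \<and> scd u = scd g \<and> scomp u b = g"
proof -
  obtain A b0 B where b_eq: "b = (A, b0, B)" by (cases b)
  obtain g0 D where g_eq: "g = (A, g0, D)" using g(2) by (cases g) (auto simp: s_defs b_eq)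
  have "sarr b" using b by (simp add: S.epic_def)
  then have [simp]: "sobj A" "sobj B" "b0 \<in> Ar C" "src C b0 = tprod A" "tgt C b0 = tprod B"
    "sobj D" "g0 \<in> Ar C" "src C g0 = tprod A" "tgt C g0 = tprod D"
    using g(1) by (auto simp: b_eq g_eq)
  have "epi_arr C b0" unfolding epi_arr_def
  proof (intro conjI allI ballI impI)
    fix Z x y assume "x \<in> hom C (tgt C b0) Z" "y \<in> hom C (tgt C b0) Z" and xy: "x \<cdot> b0 = y \<cdot> b0"
    then have x [simp]: "x \<in> Ar C" "src C x = tprod B" "tgt C x = Z" and y [simp]: "y \<in> Ar C" "src C y = tprod B" "tgt C y = Z"
      by (auto simp: hom_iff)
    have [simp]: "Z \<in> Ob C" using src_tgt_Ob(2)[of x] by simp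
    let ?r = "inv_arr C (run C Z)"
    let ?x = "(B, ?r \<cdot> x, [Z])" and ?y = "(B, ?r \<cdot> y, [Z])"
    have "scomp ?x b = scomp ?y b" using xy by (simp add: s_defs b_eq cmp_assoc_simp)
    then have "?x = ?y" by (rule S.epicD[OF b]) (simp_all add: s_defs b_eq)
    then have "?r \<cdot> x = ?r \<cdot> y" by simp
    then show "x = y" by (rule iso_cancel_left[rotated]) auto
  qed auto
  then obtain f where f: "is_cokernel C f b0" using epi_is_cokernel by blast
  have f' [simp]: "f \<in> Ar C" "tgt C f = tprod A" "b0 \<cdot> f = \<zero> (src C f) (tprod B)" using f by (auto simp: is_cokernel_def)
  let ?r = "run C (src C f)"
  let ?f = "([src C f], f \<cdot> ?r, A)"
  have "scomp g ?f = snul (sdm ?f) (scd g)"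
    by (rule bg) (simp_all add: s_defs b_eq cmp_subst[OF f'(3)])
  then have "(g0 \<cdot> f) \<cdot> ?r = \<zero> (src C f) (tprod D) \<cdot> ?r" by (simp add: s_defs g_eq cmp_assoc_simp)
  then have "g0 \<cdot> f = \<zero> (src C f) (tprod D)" by (rule iso_cancel_right[rotated]) auto
  then obtain u where "u \<in> Ar C" "src C u = tprod B" "tgt C u = tprod D" "u \<cdot> b0 = g0"
    using is_cokernel_factor[OF f, of g0] by auto
  then show ?thesis by (intro exI[of _ "(B, u, D)"]) (simp add: s_defs b_eq g_eq)
qed

lemma strict_abelian_category:
  "strict_abelian_category sobj sarr sdm scd sone scomp stens snul splus sscal sbr"
  by unfold_locales (rule strict_dual_exists strict_kernel_exists strict_epic_factor; blast)+

text \<open>An arrow f of C becomes \<open>f \<boxtimes> \<iota> \<one>\<close> between one-element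
  lists. Naturality of \<open>run\<close> moves the universal property across; the next lemma does
  the same for cokernels.\<close>

lemma strict_kernel_single:
  assumes "is_kernel C q i"
  shows "S.kernel ([src C q], q \<boxtimes> \<iota> \<one>, [tgt C q]) ([src C i], i \<boxtimes> \<iota> \<one>, [src C q])"
proof -
  have [simp]: "q \<in> Ar C" "i \<in> Ar C" "tgt C i = src C q" and qi: "q \<cdot> i = \<zero> (src C i) (tgt C q)"
    using assms by (auto simp: is_kernel_def)
  have mono: "mono_arr C i" by (rule kernel_mono[OF assms])
  have ri: "run C (src C q) \<cdot> (i \<boxtimes> \<iota> \<one>) = i \<cdot> run C (src C i)" using run_natural_simp[of i] by simp
  have rq: "run C (tgt C q) \<cdot> (q \<boxtimes> \<iota> \<one>) = q \<cdot> run C (src C q)" using run_natural_simp[of q] by simp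
  let ?i = "([src C i], i \<boxtimes> \<iota> \<one>, [src C q])" and ?q = "([src C q], q \<boxtimes> \<iota> \<one>, [tgt C q])"
  show ?thesis unfolding S.kernel_def S.monic_def
  proof (intro conjI allI impI)
    fix g h assume gh: "sarr g" "sarr h" "scd g = sdm ?i" "scd h = sdm ?i" "sdm g = sdm h" "scomp ?i g = scomp ?i h"
    obtain W g0 h0 where gh_eq: "g = (W, g0, [src C i])" "h = (W, h0, [src C i])"
      using gh(3-5) by (cases g; cases h) (auto simp: s_defs)
    have [simp]: "sobj W" "g0 \<in> Ar C" "src C g0 = tprod W" "tgt C g0 = src C i \<otimes> \<one>"
      "h0 \<in> Ar C" "src C h0 = tprod W" "tgt C h0 = src C i \<otimes> \<one>"
      using gh(1,2) by (auto simp: gh_eq)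
    have "(i \<boxtimes> \<iota> \<one>) \<cdot> g0 = (i \<boxtimes> \<iota> \<one>) \<cdot> h0" using gh(6) by (simp add: gh_eq s_defs)
    then have "i \<cdot> (run C (src C i) \<cdot> g0) = i \<cdot> (run C (src C i) \<cdot> h0)"
      using cmp_subst[OF ri, of g0] cmp_subst[OF ri, of h0] by (simp add: cmp_assoc_simp)
    then have "run C (src C i) \<cdot> g0 = run C (src C i) \<cdot> h0" using mono unfolding mono_arr_def by (auto simp: hom_iff)
    then have "g0 = h0" by (rule iso_cancel_left[rotated]) auto
    then show "g = h" by (simp add: gh_eq)
  next
    fix g assume g: "sarr g" "scd g = sdm ?q" "scomp ?q g = snul (sdm g) (scd ?q)"
    obtain W g0 where g_eq: "g = (W, g0, [src C q])"
      using g(2) by (cases g) (auto simp: s_defs)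
    have [simp]: "sobj W" "g0 \<in> Ar C" "src C g0 = tprod W" "tgt C g0 = src C q \<otimes> \<one>"
      using g(1) by (auto simp: g_eq)
    have "(q \<boxtimes> \<iota> \<one>) \<cdot> g0 = \<zero> (tprod W) (tgt C q \<otimes> \<one>)" using g(3) by (simp add: g_eq s_defs)
    then have "q \<cdot> (run C (src C q) \<cdot> g0) = \<zero> (tprod W) (tgt C q)"
      using cmp_subst[OF rq, of g0] by (simp add: cmp_assoc_simp)
    then obtain u where u: "u \<in> Ar C" "src C u = tprod W" "tgt C u = src C i" "i \<cdot> u = run C (src C q) \<cdot> g0"
      using is_kernel_factor[OF assms, of "run C (src C q) \<cdot> g0"] by auto
    have "(i \<boxtimes> \<iota> \<one>) \<cdot> (inv_arr C (run C (src C i)) \<cdot> u) = g0"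
    proof (rule iso_cancel_left[of "run C (src C q)"])
      show "run C (src C q) \<cdot> (i \<boxtimes> \<iota> \<one>) \<cdot> (inv_arr C (run C (src C i)) \<cdot> u) = run C (src C q) \<cdot> g0"
        using u cmp_subst[OF ri, of "inv_arr C (run C (src C i)) \<cdot> u"] by (simp add: cmp_assoc_simp)
    qed (use u in auto)
    then show "\<exists>u. sarr u \<and> sdm u = sdm g \<and> scd u = sdm ?i \<and> scomp ?i u = g"
      using u(1-3) by (intro exI[of _ "(W, inv_arr C (run C (src C i)) \<cdot> u, [src C i])"]) (simp add: g_eq s_defs)
  next
    have "(\<zero> (src C i) (tgt C q)) \<boxtimes> \<iota> \<one> = \<zero> (src C i \<otimes> \<one>) (tgt C q \<otimes> \<one>)"
      using tenA_linear_simps(1)[of "\<zero> (src C i) (tgt C q)" "\<iota> \<one>" 0] by (simp add: scale_simps)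
    then show "scomp ?q ?i = snul (sdm ?i) (scd ?q)"
      by (simp add: s_defs tenA_interchange qi)
  qed (auto simp: s_defs)
qed

lemma strict_cokernel_single:
  assumes "is_cokernel C i q"
  shows "S.cokernel ([src C i], i \<boxtimes> \<iota> \<one>, [tgt C i]) ([tgt C i], q \<boxtimes> \<iota> \<one>, [tgt C q])"
proof -
  have [simp]: "q \<in> Ar C" "i \<in> Ar C" "src C q = tgt C i" and qi: "q \<cdot> i = \<zero> (src C i) (tgt C q)"
    using assms by (auto simp: is_cokernel_def)
  have epi: "epi_arr C q" by (rule cokernel_epi[OF assms])
  let ?ri = "inv_arr C (run C (src C i))" and ?rx = "inv_arr C (run C (tgt C i))" and ?rq = "inv_arr C (run C (tgt C q))"
  have inv_run: "(f \<boxtimes> \<iota> \<one>) \<cdot> inv_arr C (run C (src C f)) = inv_arr C (run C (tgt C f)) \<cdot> f" if f: "f \<in> Ar C" for f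
  proof (rule iso_cancel_left[of "run C (tgt C f)"])
    show "run C (tgt C f) \<cdot> (f \<boxtimes> \<iota> \<one>) \<cdot> inv_arr C (run C (src C f)) = run C (tgt C f) \<cdot> inv_arr C (run C (tgt C f)) \<cdot> f"
      using f cmp_subst[OF run_natural_simp[OF f], of "inv_arr C (run C (src C f))"] by (simp add: cmp_assoc_simp)
  qed (use f in auto)
  have ri: "(i \<boxtimes> \<iota> \<one>) \<cdot> ?ri = ?rx \<cdot> i" and rq: "(q \<boxtimes> \<iota> \<one>) \<cdot> ?rx = ?rq \<cdot> q"
    using inv_run[of i] inv_run[of q] by simp_all
  let ?i = "([src C i], i \<boxtimes> \<iota> \<one>, [tgt C i])" and ?q = "([tgt C i], q \<boxtimes> \<iota> \<one>, [tgt C q])"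
  show ?thesis unfolding S.cokernel_def S.epic_def
  proof (intro conjI allI impI)
    fix g h assume gh: "sarr g" "sarr h" "sdm g = scd ?q" "sdm h = scd ?q" "scd g = scd h" "scomp g ?q = scomp h ?q"
    obtain W g0 h0 where gh_eq: "g = ([tgt C q], g0, W)" "h = ([tgt C q], h0, W)"
      using gh(3-5) by (cases g; cases h) (auto simp: s_defs)
    have [simp]: "sobj W" "g0 \<in> Ar C" "tgt C g0 = tprod W" "src C g0 = tgt C q \<otimes> \<one>"
      "h0 \<in> Ar C" "tgt C h0 = tprod W" "src C h0 = tgt C q \<otimes> \<one>"
      using gh(1,2) by (auto simp: gh_eq)
    have "g0 \<cdot> (q \<boxtimes> \<iota> \<one>) = h0 \<cdot> (q \<boxtimes> \<iota> \<one>)" using gh(6) by (simp add: gh_eq s_defs)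
    then have "(g0 \<cdot> (q \<boxtimes> \<iota> \<one>)) \<cdot> ?rx = (h0 \<cdot> (q \<boxtimes> \<iota> \<one>)) \<cdot> ?rx" by simp
    then have "(g0 \<cdot> ?rq) \<cdot> q = (h0 \<cdot> ?rq) \<cdot> q"
      by (simp add: cmp_assoc_simp rq)
    then have "g0 \<cdot> ?rq = h0 \<cdot> ?rq" using epi unfolding epi_arr_def by (auto simp: hom_iff)
    then have "g0 = h0" by (rule iso_cancel_right[rotated]) auto
    then show "g = h" by (simp add: gh_eq)
  next
    fix g assume g: "sarr g" "sdm g = scd ?i" "scomp g ?i = snul (sdm ?i) (scd g)"
    obtain W g0 where g_eq: "g = ([tgt C i], g0, W)"
      using g(2) by (cases g) (auto simp: s_defs)
    have [simp]: "sobj W" "g0 \<in> Ar C" "tgt C g0 = tprod W" "src C g0 = tgt C i \<otimes> \<one>"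
      using g(1) by (auto simp: g_eq)
    have "g0 \<cdot> (i \<boxtimes> \<iota> \<one>) = \<zero> (src C i \<otimes> \<one>) (tprod W)" using g(3) by (simp add: g_eq s_defs)
    from cmp_subst[OF this, of ?ri] have "(g0 \<cdot> ?rx) \<cdot> i = \<zero> (src C i) (tprod W)"
      by (simp add: cmp_assoc_simp ri)
    then obtain u where u: "u \<in> Ar C" "src C u = tgt C q" "tgt C u = tprod W" "u \<cdot> q = g0 \<cdot> ?rx"
      using is_cokernel_factor[OF assms, of "g0 \<cdot> ?rx"] by auto
    have "(u \<cdot> run C (tgt C q)) \<cdot> (q \<boxtimes> \<iota> \<one>) = g0"
    proof (rule iso_cancel_right[of ?rx])
      show "((u \<cdot> run C (tgt C q)) \<cdot> (q \<boxtimes> \<iota> \<one>)) \<cdot> ?rx = g0 \<cdot> ?rx"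
        using u by (simp add: cmp_assoc_simp rq)
    qed (use u in auto)
    then show "\<exists>u. sarr u \<and> sdm u = scd ?q \<and> scd u = scd g \<and> scomp u ?q = g"
      using u(1-3) by (intro exI[of _ "([tgt C q], u \<cdot> run C (tgt C q), W)"]) (simp add: g_eq s_defs)
  next
    have "(\<zero> (src C i) (tgt C q)) \<boxtimes> \<iota> \<one> = \<zero> (src C i \<otimes> \<one>) (tgt C q \<otimes> \<one>)"
      using tenA_linear_simps(1)[of "\<zero> (src C i) (tgt C q)" "\<iota> \<one>" 0] by (simp add: scale_simps)
    then show "scomp ?q ?i = snul (sdm ?i) (scd ?q)"
      by (simp add: s_defs tenA_interchange qi)
  qed (auto simp: s_defs)
qed

section \<open>Dimensions of objects and integrality\<close>

context
  assumes bij: "bij_betw (\<lambda>c. c \<odot> \<iota> \<one>) UNIV (hom C \<one> \<one>)"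
begin

lemma scalar_inject: "z \<odot> \<iota> \<one> = w \<odot> \<iota> \<one> \<longleftrightarrow> z = w"
  using bij by (auto simp: bij_betw_def inj_def)

lemma cat_dim_scalar:
  assumes "X \<in> Ob C"
  shows "ev C X \<cdot> \<beta> X (dua C X) \<cdot> coev C X = cat_dim C X \<odot> \<iota> \<one>"
proof -
  note [simp] = dual_pairD(1-8)[OF dual_pair_dua[OF assms]]
  have "ev C X \<cdot> \<beta> X (dua C X) \<cdot> coev C X \<in> hom C \<one> \<one>" by (simp add: hom_iff)
  then obtain z where z: "ev C X \<cdot> \<beta> X (dua C X) \<cdot> coev C X = z \<odot> \<iota> \<one>"
    using bij by (auto simp: bij_betw_def)
  then have "cat_dim C X = z" unfolding cat_dim_def using scalar_inject by auto
  with z show ?thesis by simp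
qed

text \<open>Allowing any object isomorphic to \<open>tprod A\<close> covers one-element lists,
  general lists and isomorphic objects at once.\<close>

lemma has_dim_cat_dim:
  assumes "sobj A" "iso_arr C \<psi>" "src C \<psi> = X" "tgt C \<psi> = tprod A"
  shows "S.has_dim A (cat_dim C X)"
proof -
  have X: "X \<in> Ob C" using src_tgt_Ob(1)[of \<psi>] assms by simp
  show ?thesis by (rule strict_has_dim[OF X assms cat_dim_scalar[OF X]])
qed

lemma has_dim_single: "X \<in> Ob C \<Longrightarrow> S.has_dim [X] (cat_dim C X)"
  by (rule has_dim_cat_dim[of _ "inv_arr C (run C X)"]) auto

lemma has_dim_tprod: "sobj A \<Longrightarrow> S.has_dim A (cat_dim C (tprod A))"
  by (rule has_dim_cat_dim[of _ "\<iota> (tprod A)"]) auto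

lemma has_dim_eq: "S.has_dim A z \<Longrightarrow> S.has_dim A w \<Longrightarrow> z = w"
  using S.has_dim_unique[of A z w] by (simp add: s_defs scalar_inject)

text \<open>Both numbers are dimensions of the one list \<open>[Y]\<close>, and dimensions of a list
  are unique.\<close>

lemma cat_dim_isomorphic:
  assumes "isomorphic C X Y" shows "cat_dim C X = cat_dim C Y"
proof -
  obtain f where f: "iso_arr C f" "src C f = X" "tgt C f = Y"
    using assms by (auto simp: isomorphic_def hom_iff)
  have Y: "Y \<in> Ob C" using src_tgt_Ob(2)[of f] f by simp
  have "S.has_dim [Y] (cat_dim C X)"
    by (rule has_dim_cat_dim[of _ "inv_arr C (run C Y) \<cdot> f"]) (use f Y in auto)
  then show ?thesis using has_dim_eq has_dim_single[OF Y] by blast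
qed

text \<open>The identity of a zero object is 0 times itself, which forces the coevaluation to
  vanish.\<close>

lemma cat_dim_zero_object:
  assumes "zero_object C Z" shows "cat_dim C Z = 0"
proof -
  have Z: "Z \<in> Ob C" using assms by (simp add: zero_object_def)
  note [simp] = dual_pairD(1-8)[OF dual_pair_dua[OF Z]]
  have "\<exists>!f. f \<in> hom C Z Z" using assms Z by (auto simp: zero_object_def)
  then have id: "\<iota> Z = 0 \<odot> \<iota> Z" using Z by (metis ident_hom scale_hom)
  have ten: "(0 \<odot> \<iota> Z) \<boxtimes> \<iota> (dua C Z) = 0 \<odot> (\<iota> Z \<boxtimes> \<iota> (dua C Z))"
    by (rule tenA_linear_simps) (simp_all add: Z)
  have "coev C Z = ((0 \<odot> \<iota> Z) \<boxtimes> \<iota> (dua C Z)) \<cdot> coev C Z"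
    unfolding id[symmetric] by (simp add: tenA_ident)
  also have "\<dots> = \<zero> \<one> (Z \<otimes> dua C Z)"
    unfolding ten by (simp add: scale_simps tenA_ident)
  finally have "coev C Z = \<zero> \<one> (Z \<otimes> dua C Z)" .
  then have "ev C Z \<cdot> \<beta> Z (dua C Z) \<cdot> coev C Z = 0 \<odot> \<iota> \<one>" by (simp add: scale_simps)
  then show ?thesis using cat_dim_scalar[OF Z] scalar_inject by simp
qed

lemma cat_dim_additive:
  assumes i: "i \<in> hom C Y X" "mono_arr C i" and q: "q \<in> hom C X S" "is_cokernel C i q"
  shows "cat_dim C X = cat_dim C Y + cat_dim C S"
proof -
  have t: "src C i = Y" "tgt C i = X" "src C q = X" "tgt C q = S" "i \<in> Ar C" "q \<in> Ar C"
    using i q by (auto simp: hom_iff)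
  have Ob: "X \<in> Ob C" "Y \<in> Ob C" "S \<in> Ob C"
    using src_tgt_Ob[OF t(5)] src_tgt_Ob[OF t(6)] t by auto
  have "S.has_dim [X] (cat_dim C Y + cat_dim C S)"
  proof (rule strict_abelian_category.has_dim_additive[OF strict_abelian_category has_dim_single has_dim_single])
    \<comment> \<open>Additivity uses exactness on both sides; the monomorphism \<open>i\<close> is
      the kernel of its cokernel \<open>q\<close>.\<close>
    show "S.kernel ([X], q \<boxtimes> \<iota> \<one>, [S]) ([Y], i \<boxtimes> \<iota> \<one>, [X])"
      using strict_kernel_single[OF mono_kernel_of_cokernel[OF i(2) q(2)]] t by simp
    show "S.cokernel ([Y], i \<boxtimes> \<iota> \<one>, [X]) ([X], q \<boxtimes> \<iota> \<one>, [S])"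
      using strict_cokernel_single[OF q(2)] t by simp
  qed (auto simp: s_defs Ob)
  then show ?thesis using has_dim_eq has_dim_single[OF Ob(1)] by blast
qed

text \<open>Along a composition series each extension adds the dimension of an irreducible object,
  which equals that of its representative in \<open>F\<close>.\<close>

lemma cat_dim_in_int_span:
  assumes F: "finite F" "\<And>S. irreducible_object C S \<Longrightarrow> \<exists>T \<in> F. isomorphic C S T"
    and X: "finite_length C X"
  shows "cat_dim C X \<in> int_span (cat_dim C ` F)"
  using X
proof (induction rule: finite_length.induct)
  case (zero Z)
  then show ?case by (simp add: cat_dim_zero_object int_span_0)
next
  case (step Y i X q S)
  obtain T where T: "T \<in> F" "isomorphic C S T" using F(2) step.hyps by blast
  then have "cat_dim C S \<in> int_span (cat_dim C ` F)"
    using cat_dim_isomorphic F(1) by (intro int_span_base) auto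
  then show ?case using cat_dim_additive[of i Y X q S] step by (auto intro: int_span_add)
qed

lemma cat_dim_integer:
  assumes fin: "finitely_many_irreducibles C" and V: "V \<in> Ob C"
  shows "cat_dim C V \<in> \<int>"
proof -
  obtain F where F: "finite F" "\<And>S. irreducible_object C S \<Longrightarrow> \<exists>T \<in> F. isomorphic C S T"
    using fin by (auto simp: finitely_many_irreducibles_def)
  let ?G = "cat_dim C ` F" and ?d = "cat_dim C V"
  have prod: "(\<Prod>k<n. (?d + \<epsilon> * of_nat k) / of_nat (Suc k)) \<in> int_span ?G" if \<epsilon>: "\<epsilon> * \<epsilon> = 1" for \<epsilon> n
  proof -
    obtain I where I: "sobj I" "S.has_dim I (\<Prod>k<n. (?d + \<epsilon> * of_nat k) / of_nat (Suc k))"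
      using strict_abelian_category.has_dim_symmetrizer[OF strict_abelian_category has_dim_single[OF V] \<epsilon>] by blast
    then have "(\<Prod>k<n. (?d + \<epsilon> * of_nat k) / of_nat (Suc k)) = cat_dim C (tprod I)"
      using has_dim_eq has_dim_tprod by blast
    then show ?thesis using cat_dim_in_int_span[OF F objects_finite_length] I(1) by simp
  qed
  show ?thesis
  proof (rule integer_if_gbinomials_in_int_span)
    show "finite ?G" using F(1) by simp
    show "?d gchoose n \<in> int_span ?G" for n
      using prod[of "-1" n] unfolding prod_eq_gbinomial by simp
    show "(- ?d) gchoose n \<in> int_span ?G" for n
    proof -
      have "(-1) ^ n * ((- ?d) gchoose n) \<in> int_span ?G"
        using prod[of 1 n] unfolding prod_eq_gbinomial_minus by simp
      \<comment> \<open>The sign in the dimension of the symmetric power is its own inverse, so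
        multiplying by it once more removes it.\<close>
      from int_span_scale[OF this, of "(-1) ^ n"] show ?thesis
        by (simp add: mult.assoc[symmetric] power_mult_distrib[symmetric])
    qed
  qed
qed

end
end

theorem theorem7p2:
  fixes C :: "('o, 'a, 'z) ten_cat_scheme"
  assumes "symmetric_tensor_category C"
    and "bij_betw (\<lambda>c. c \<odot>\<^bsub>C\<^esub> \<iota>\<^bsub>C\<^esub> \<one>\<^bsub>C\<^esub>) UNIV (hom C \<one>\<^bsub>C\<^esub> \<one>\<^bsub>C\<^esub>)"
    and "finitely_many_irreducibles C"
    and "V \<in> Ob C"
  shows "cat_dim C V \<in> \<int>"
  using assms by (rule symmetric_tensor_category.cat_dim_integer)

end
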